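(* Suppose that $G$ is a finitely generated group with property $(\tau)$, and let $\gamma\in Z$ satisfy $\gamma\prec\nu$, i.e. $\lim_{\mathcal U}\frac{\gamma_n}{\nu_n}=0$. Then the trivial representation of $G$ is not weakly contained in $\pi_\gamma$.
   Context: Let $G$ be a residually finite (discrete) group with normal subgroups of finite index $G\supset G_1\supset G_2\supset\cdots$, strictly decreasing, such that $\cap_{n\in\mathbb N}G_n=\{e\}$. Put $X_n=G/G_n$ (a finite group on which $G$ acts by left translation, $(g,x)\mapsto gx$) and $\nu_n=|X_n|$; thus $\nu_{n+1}/\nu_n\ge 2$. Let $\nu=(\nu_n)_{n\in\mathbb N}$. Let $l^2(X_n)$ be the finite-dimensional Hilbert space with respect to counting measure on $X_n$, and let $\lambda_n$ be the quasi-regular representation of $G$ on $l^2(X_n)$, $(\lambda_n(g)\xi)(x)=\xi(g^{-1}x)$. Fix a non-principal ultrafilter $\mathcal U$ on $\mathbb N$. Let $\widetilde H=\{\xi=(\xi_n)_{n\in\mathbb N}:\xi_n\in l^2(X_n),\ \sup_n\|\xi_n\|<\infty\}$ with the sesquilinear form $\langle\xi,\eta\rangle=\lim_{\mathcal U}\langle\xi_n,\eta_n\rangle$, let $\widetilde H_0=\{\xi\in\widetilde H:\langle\xi,\xi\rangle=0\}$, and let $\widehat H$ be the Hilbert space completion of $\widetilde H/\widetilde H_0$. The formula $\widehat\lambda(g)(\xi_n)_{n}=(\lambda_n(g)\xi_n)_{n}$, $g\in G$, defines a unitary representation $\widehat\lambda$ of $G$ on $\widehat H$. Let $Z$ be the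 set of all non-decreasing integer-valued sequences $\gamma=(\gamma_n)_{n\in\mathbb N}$ with $1\le\gamma_n\le\nu_n$ for all $n$ (growth functions). Write $\gamma\prec\gamma'$ if $\lim_{\mathcal U}\frac{\gamma_n}{\gamma'_n}=0$. For $\gamma\in Z$ and $k\in\mathbb N$ let $\widetilde H^{(k)}_\gamma\subset\widetilde H$ be the set of all sequences $(\xi_n)$ with $|\operatorname{supp}\xi_n|\le k\gamma_n$ for each $n$; let $\widetilde H_\gamma=\cup_{k=1}^\infty\widetilde H^{(k)}_\gamma$ (a linear subspace), and let $H_\gamma$ be the closure of $(\widetilde H_\gamma+\widetilde H_0)/\widetilde H_0$ in $\widehat H$. The subspace $H_\gamma$ is invariant under $\widehat\lambda$, and $\pi_\gamma=\widehat\lambda|_{H_\gamma}$. Property $(\tau)$ for $G$ means that the trivial representation is isolated among the finite-dimensional unitary representations of $G$ (i.e. it is an isolated point, in the Fell topology, of the set of equivalence classes of irreducible finite-dimensional unitary representations of $G$). Representations of $G$ are extended linearly to $\mathbb C[G]$. A unitary representation $\pi$ is weakly contained in $\sigma$ if $\|\pi(a)\|\le\|\sigma(a)\|$ for all $a\in\mathbb C[G]$. *)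

theory Defs
  imports
    "HOL-Algebra.AbelCoset"
    "HOL-Algebra.Generated_Groups"
    "HOL-Analysis.Abstract_Topology"
    "Jordan_Normal_Form.VS_Connect"
begin

section \<open>Complex inner product spaces with a group action\<close>

text \<open>
  A complex vector space with an explicit carrier, together with a sesquilinear form \<open>sprod\<close>
  (linear in the first argument, conjugate-linear in the second) and, for each element of a group,
  an operator \<open>act\<close>. The fields \<open>mult\<close> and \<open>one\<close>, which the \<open>module\<close> record inherits from
  \<open>ring\<close>, carry no meaning and are left undefined, as in \<^const>\<open>module_vec\<close>.
\<close>

record ('g, 'v) gspace = "(complex, 'v) module" +
  sprod :: "'v \<Rightarrow> 'v \<Rightarrow> complex"
  act :: "'g \<Rightarrow> 'v \<Rightarrow> 'v"

definition hnorm :: "('g, 'v, 'z) gspace_scheme \<Rightarrow> 'v \<Rightarrow> real" where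
  "hnorm M v = sqrt (Re (sprod M v v))"

definition unitary_rep ::
    "('g, 'm) monoid_scheme \<Rightarrow> ('g, 'v, 'z) gspace_scheme \<Rightarrow> bool" where
  "unitary_rep G M \<longleftrightarrow>
     (\<forall>g\<in>carrier G. act M g \<in> module_hom class_ring M M) \<and>
     (\<forall>g\<in>carrier G. \<forall>v\<in>carrier M. \<forall>w\<in>carrier M. sprod M (act M g v) (act M g w) = sprod M v w) \<and>
     (\<forall>v\<in>carrier M. act M \<one>\<^bsub>G\<^esub> v = v) \<and>
     (\<forall>g\<in>carrier G. \<forall>h\<in>carrier G. \<forall>v\<in>carrier M. act M (g \<otimes>\<^bsub>G\<^esub> h) v = act M g (act M h v))"

definition unitarily_equivalent ::
    "('g, 'm) monoid_scheme \<Rightarrow> ('g, 'v) gspace \<Rightarrow> ('g, 'w) gspace \<Rightarrow> bool" where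
  "unitarily_equivalent G M K \<longleftrightarrow>
     (\<exists>T \<in> module_hom class_ring M K.
        bij_betw T (carrier M) (carrier K) \<and>
        (\<forall>v\<in>carrier M. \<forall>w\<in>carrier M. sprod K (T v) (T w) = sprod M v w) \<and>
        (\<forall>g\<in>carrier G. \<forall>v\<in>carrier M. T (act M g v) = act K g (T v)))"

subsection \<open>The group algebra and weak containment\<close>

definition group_algebra :: "('g, 'm) monoid_scheme \<Rightarrow> ('g \<Rightarrow> complex) set" where
  "group_algebra G = {a. finite {g. a g \<noteq> 0} \<and> {g. a g \<noteq> 0} \<subseteq> carrier G}"

definition alg_act :: "('g, 'v) gspace \<Rightarrow> ('g \<Rightarrow> complex) \<Rightarrow> 'v \<Rightarrow> 'v" where
  "alg_act M a v = (\<Oplus>\<^bsub>M\<^esub>g\<in>{g. a g \<noteq> 0}. a g \<odot>\<^bsub>M\<^esub> act M g v)"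

definition opnorm :: "('g, 'v) gspace \<Rightarrow> ('g \<Rightarrow> complex) \<Rightarrow> real" where
  "opnorm M a = Sup {hnorm M (alg_act M a v) | v. v \<in> carrier M \<and> hnorm M v \<le> 1}"

definition weakly_contained ::
    "('g, 'm) monoid_scheme \<Rightarrow> ('g, 'v) gspace \<Rightarrow> ('g, 'w) gspace \<Rightarrow> bool" where
  "weakly_contained G P Q \<longleftrightarrow> (\<forall>a\<in>group_algebra G. opnorm P a \<le> opnorm Q a)"

section \<open>Finite-dimensional unitary representations and property \<open>(\<tau>)\<close>\<close>

definition cn_rep :: "nat \<Rightarrow> ('g \<Rightarrow> complex vec \<Rightarrow> complex vec) \<Rightarrow> ('g, complex vec) gspace" where
  "cn_rep d \<pi> = module.extend (module_vec TYPE(complex) d)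
     (gspace.fields (\<lambda>v w. v \<bullet>c w) \<pi>)"

definition trivial_rep :: "('g, complex vec) gspace" where
  "trivial_rep = cn_rep 1 (\<lambda>g v. v)"

text \<open>For finite-dimensional spaces only: invariant subspaces are not required to be closed.\<close>

definition fd_irreducible :: "('g, 'm) monoid_scheme \<Rightarrow> ('g, 'v) gspace \<Rightarrow> bool" where
  "fd_irreducible G M \<longleftrightarrow> carrier M \<noteq> {\<zero>\<^bsub>M\<^esub>} \<and>
     (\<forall>W. submodule class_ring W M \<and> (\<forall>g\<in>carrier G. act M g ` W \<subseteq> W)
        \<longrightarrow> W = {\<zero>\<^bsub>M\<^esub>} \<or> W = carrier M)"

text \<open>
  Every finite-dimensional Hilbert space is isometric to some \<open>\<complex>\<^sup>d\<close>, so the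
  representations on the spaces \<open>\<complex>\<^sup>d\<close> exhaust all equivalence classes.
\<close>

definition fd_irreps :: "('g, 'm) monoid_scheme \<Rightarrow> ('g, complex vec) gspace set" where
  "fd_irreps G = {cn_rep d \<pi> | d \<pi>. unitary_rep G (cn_rep d \<pi>) \<and> fd_irreducible G (cn_rep d \<pi>)}"

definition fd_class ::
    "('g, 'm) monoid_scheme \<Rightarrow> ('g, complex vec) gspace \<Rightarrow> ('g, complex vec) gspace set" where
  "fd_class G P = {Q \<in> fd_irreps G. unitarily_equivalent G P Q}"

text \<open>Functions of positive type associated with a representation.\<close>

definition pos_fun :: "('g, 'v) gspace \<Rightarrow> 'v \<Rightarrow> 'g \<Rightarrow> complex" where
  "pos_fun P v g = sprod P (act P g v) v"

text \<open>
  The standard basic sets \<open>W(P, \<phi>\<^sub>1, \<dots>, \<phi>\<^sub>n, F, \<epsilon>)\<close> of the Fell topology: those \<open>Q\<close> for which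
  every one of the finitely many functions of positive type \<open>\<phi>\<^sub>i\<close> associated with \<open>P\<close> (given here
  by the vectors in \<open>V\<close>) is, up to \<open>\<epsilon>\<close> on the finite (that is, compact) set \<open>F\<close>, a finite sum of
  functions of positive type associated with \<open>Q\<close>.
\<close>

definition fell_nbhd ::
    "('g, 'm) monoid_scheme \<Rightarrow> ('g, complex vec) gspace \<Rightarrow> complex vec set \<Rightarrow> 'g set \<Rightarrow> real
      \<Rightarrow> ('g, complex vec) gspace set" where
  "fell_nbhd G P V F \<epsilon> =
     {Q \<in> fd_irreps G. \<forall>v\<in>V. \<exists>ws. set ws \<subseteq> carrier Q \<and>
        (\<forall>g\<in>F. cmod (pos_fun P v g - (\<Sum>w\<leftarrow>ws. pos_fun Q w g)) < \<epsilon>)}"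

definition fell_topology ::
    "('g, 'm) monoid_scheme \<Rightarrow> ('g, complex vec) gspace set topology" where
  "fell_topology G = topology_generated_by
     {fd_class G ` fell_nbhd G P V F \<epsilon> | P V F \<epsilon>.
        P \<in> fd_irreps G \<and> finite V \<and> V \<subseteq> carrier P \<and> finite F \<and> F \<subseteq> carrier G \<and> 0 < \<epsilon>}"

definition property_tau :: "('g, 'm) monoid_scheme \<Rightarrow> bool" where
  "property_tau G \<longleftrightarrow> openin (fell_topology G) {fd_class G trivial_rep}"

section \<open>Separation and completion\<close>

definition null_vecs :: "('g, 'v) gspace \<Rightarrow> 'v set" where
  "null_vecs M = {v \<in> carrier M. sprod M v v = 0}"

text \<open>
  The quotient by the null vectors. On cosets the operations are given by representatives; the
  unions below are taken over equal sets when \<open>sprod\<close> is positive semidefinite and the operators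
  are isometric.
\<close>

definition hquot :: "('g, 'v) gspace \<Rightarrow> ('g, 'v set) gspace" where
  "hquot M = \<lparr>
     carrier = a_rcosets\<^bsub>M\<^esub> (null_vecs M),
     mult = undefined,
     one = undefined,
     zero = null_vecs M,
     add = set_add M,
     smult = (\<lambda>c A. \<Union>a\<in>A. null_vecs M +>\<^bsub>M\<^esub> (c \<odot>\<^bsub>M\<^esub> a)),
     sprod = (\<lambda>A B. the_elem (\<Union>a\<in>A. \<Union>b\<in>B. {sprod M a b})),
     act = (\<lambda>g A. \<Union>a\<in>A. null_vecs M +>\<^bsub>M\<^esub> act M g a)\<rparr>"

definition qmap :: "('g, 'v) gspace \<Rightarrow> 'v \<Rightarrow> 'v set" where
  "qmap M v = null_vecs M +>\<^bsub>M\<^esub> v"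

definition cauchy_seqs :: "('g, 'v) gspace \<Rightarrow> ('g, nat \<Rightarrow> 'v) gspace" where
  "cauchy_seqs M = \<lparr>
     carrier = {s. (\<forall>n. s n \<in> carrier M) \<and>
       (\<forall>e>0. \<exists>k. \<forall>m\<ge>k. \<forall>n\<ge>k. hnorm M (s m \<ominus>\<^bsub>M\<^esub> s n) < e)},
     mult = undefined,
     one = undefined,
     zero = (\<lambda>n. \<zero>\<^bsub>M\<^esub>),
     add = (\<lambda>s t n. s n \<oplus>\<^bsub>M\<^esub> t n),
     smult = (\<lambda>c s n. c \<odot>\<^bsub>M\<^esub> s n),
     sprod = (\<lambda>s t. lim (\<lambda>n. sprod M (s n) (t n))),
     act = (\<lambda>g s n. act M g (s n))\<rparr>"

text \<open>Cauchy sequences modulo null sequences: the null vectors of \<^const>\<open>cauchy_seqs\<close> are the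
  sequences converging to zero.\<close>

definition completion :: "('g, 'v) gspace \<Rightarrow> ('g, (nat \<Rightarrow> 'v) set) gspace" where
  "completion M = hquot (cauchy_seqs M)"

definition to_completion :: "('g, 'v) gspace \<Rightarrow> 'v \<Rightarrow> (nat \<Rightarrow> 'v) set" where
  "to_completion M v = qmap (cauchy_seqs M) (\<lambda>n. v)"

definition hclosure :: "('g, 'v) gspace \<Rightarrow> 'v set \<Rightarrow> 'v set" where
  "hclosure M S = {v \<in> carrier M. \<forall>e>0. \<exists>s\<in>S. hnorm M (v \<ominus>\<^bsub>M\<^esub> s) < e}"

section \<open>The representations \<open>\<pi>\<^sub>\<gamma>\<close>\<close>

definition finitely_generated :: "('g, 'm) monoid_scheme \<Rightarrow> bool" where
  "finitely_generated G \<longleftrightarrow> (\<exists>S. finite S \<and> S \<subseteq> carrier G \<and> generate G S = carrier G)"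

definition nonprincipal_ultrafilter :: "'i filter \<Rightarrow> bool" where
  "nonprincipal_ultrafilter U \<longleftrightarrow>
     U \<noteq> bot \<and> (\<forall>P. eventually P U \<or> eventually (\<lambda>i. \<not> P i) U) \<and> (\<forall>i. U \<noteq> principal {i})"

text \<open>
  The quasi-regular representation on \<open>l\<^sup>2(G/N)\<close>; functions on \<open>G/N\<close> are encoded as functions on
  all sets vanishing outside \<open>G/N\<close>.
\<close>

definition quasi_regular ::
    "('g, 'm) monoid_scheme \<Rightarrow> 'g set \<Rightarrow> ('g, 'g set \<Rightarrow> complex) gspace" where
  "quasi_regular G N = \<lparr>
     carrier = {\<xi>. \<forall>x. x \<notin> carrier (G Mod N) \<longrightarrow> \<xi> x = 0},
     mult = undefined,
     one = undefined,
     zero = (\<lambda>x. 0),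
     add = (\<lambda>\<xi> \<eta> x. \<xi> x + \<eta> x),
     smult = (\<lambda>c \<xi> x. c * \<xi> x),
     sprod = (\<lambda>\<xi> \<eta>. \<Sum>x\<in>carrier (G Mod N). \<xi> x * cnj (\<eta> x)),
     act = (\<lambda>g \<xi> x. if x \<in> carrier (G Mod N) then \<xi> (inv\<^bsub>G\<^esub> g <#\<^bsub>G\<^esub> x) else 0)\<rparr>"

definition bounded_seqs :: "nat filter \<Rightarrow> (nat \<Rightarrow> ('g, 'v) gspace) \<Rightarrow> ('g, nat \<Rightarrow> 'v) gspace" where
  "bounded_seqs U M = \<lparr>
     carrier = {\<xi>. (\<forall>n. \<xi> n \<in> carrier (M n)) \<and> bdd_above (range (\<lambda>n. hnorm (M n) (\<xi> n)))},
     mult = undefined,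
     one = undefined,
     zero = (\<lambda>n. \<zero>\<^bsub>M n\<^esub>),
     add = (\<lambda>\<xi> \<eta> n. \<xi> n \<oplus>\<^bsub>M n\<^esub> \<eta> n),
     smult = (\<lambda>c \<xi> n. c \<odot>\<^bsub>M n\<^esub> \<xi> n),
     sprod = (\<lambda>\<xi> \<eta>. Lim U (\<lambda>n. sprod (M n) (\<xi> n) (\<eta> n))),
     act = (\<lambda>g \<xi> n. act (M n) g (\<xi> n))\<rparr>"

definition H_tilde ::
    "('g, 'm) monoid_scheme \<Rightarrow> (nat \<Rightarrow> 'g set) \<Rightarrow> nat filter \<Rightarrow> ('g, nat \<Rightarrow> 'g set \<Rightarrow> complex) gspace"
  where "H_tilde G N U = bounded_seqs U (\<lambda>n. quasi_regular G (N n))"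

definition H_hat ::
    "('g, 'm) monoid_scheme \<Rightarrow> (nat \<Rightarrow> 'g set) \<Rightarrow> nat filter
      \<Rightarrow> ('g, (nat \<Rightarrow> (nat \<Rightarrow> 'g set \<Rightarrow> complex) set) set) gspace"
  where "H_hat G N U = completion (hquot (H_tilde G N U))"

definition index_seq :: "('g, 'm) monoid_scheme \<Rightarrow> (nat \<Rightarrow> 'g set) \<Rightarrow> nat \<Rightarrow> nat" where
  "index_seq G N n = card (carrier (G Mod N n))"

definition growth_functions :: "(nat \<Rightarrow> nat) \<Rightarrow> (nat \<Rightarrow> nat) set" where
  "growth_functions \<nu> = {\<gamma>. mono \<gamma> \<and> (\<forall>n. 1 \<le> \<gamma> n \<and> \<gamma> n \<le> \<nu> n)}"

definition growth_less :: "nat filter \<Rightarrow> (nat \<Rightarrow> nat) \<Rightarrow> (nat \<Rightarrow> nat) \<Rightarrow> bool" where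
  "growth_less U \<gamma> \<gamma>' \<longleftrightarrow> ((\<lambda>n. real (\<gamma> n) / real (\<gamma>' n)) \<longlongrightarrow> 0) U"

definition H_tilde_gamma ::
    "('g, 'm) monoid_scheme \<Rightarrow> (nat \<Rightarrow> 'g set) \<Rightarrow> nat filter \<Rightarrow> (nat \<Rightarrow> nat)
      \<Rightarrow> (nat \<Rightarrow> 'g set \<Rightarrow> complex) set" where
  "H_tilde_gamma G N U \<gamma> =
     (\<Union>k\<in>{1..}. {\<xi> \<in> carrier (H_tilde G N U).
        \<forall>n. card {x \<in> carrier (G Mod N n). \<xi> n x \<noteq> 0} \<le> k * \<gamma> n})"

text \<open>
  The image of \<^const>\<open>H_tilde_gamma\<close> under the quotient map is the quotient of its sum with the null
  vectors by the null vectors.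
\<close>

definition H_gamma ::
    "('g, 'm) monoid_scheme \<Rightarrow> (nat \<Rightarrow> 'g set) \<Rightarrow> nat filter \<Rightarrow> (nat \<Rightarrow> nat)
      \<Rightarrow> (nat \<Rightarrow> (nat \<Rightarrow> 'g set \<Rightarrow> complex) set) set set" where
  "H_gamma G N U \<gamma> = hclosure (H_hat G N U)
     (to_completion (hquot (H_tilde G N U)) ` qmap (H_tilde G N U) ` H_tilde_gamma G N U \<gamma>)"

definition pi_rep ::
    "('g, 'm) monoid_scheme \<Rightarrow> (nat \<Rightarrow> 'g set) \<Rightarrow> nat filter \<Rightarrow> (nat \<Rightarrow> nat)
      \<Rightarrow> ('g, (nat \<Rightarrow> (nat \<Rightarrow> 'g set \<Rightarrow> complex) set) set) gspace" where
  "pi_rep G N U \<gamma> = (H_hat G N U)\<lparr>carrier := H_gamma G N U \<gamma>\<rparr>"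

end

theory Submission
  imports Defs "HOL-Library.Indicator_Function"
begin

text \<open>
  Property \<open>(\<tau>)\<close> is a spectral gap that is uniform over the finite quotients of \<open>G\<close>. The point is that
  this gap persists in \<open>\<pi>\<^sub>\<gamma>\<close>, because a vector of small support in \<open>l\<^sup>2(X\<^sub>n)\<close> is almost orthogonal to
  the constants.

  If the class of the trivial representation is open, there are a finite set \<open>F \<subseteq> G\<close> and \<open>\<epsilon> > 0\<close> such
  that an irreducible finite-dimensional unitary representation with a unit vector \<open>w\<close> satisfying
  \<open>\<bar>\<langle>g w, w\<rangle> - 1\<bar> < \<epsilon>\<close> for all \<open>g \<in> F\<close> is trivial (\<open>property_tau_imp_tau_pair\<close>). A finite-dimensional
  representation without nonzero invariant vectors is an orthogonal sum of nontrivial irreducible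
  ones, so that
  \<open>(\<Sum>g\<in>F. \<parallel>g v - v\<parallel>\<^sup>2) \<ge> \<epsilon>\<^sup>2 \<parallel>v\<parallel>\<^sup>2\<close>
  on it (\<open>displacement_gap_finite_dim\<close>). This applies to the functions of sum zero on \<open>X\<^sub>n\<close>.

  For \<open>\<xi> \<in> l\<^sup>2(X\<^sub>n)\<close> with at most \<open>k \<gamma>\<^sub>n\<close> nonzero values, the Cauchy-Schwarz inequality
  \<open>\<bar>\<Sum>x. \<xi> x\<bar>\<^sup>2 \<le> k \<gamma>\<^sub>n \<parallel>\<xi>\<parallel>\<^sup>2\<close> bounds the squared norm of the constant part of \<open>\<xi>\<close> by \<open>(k \<gamma>\<^sub>n / \<nu>\<^sub>n) \<parallel>\<xi>\<parallel>\<^sup>2\<close>, and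
  the inequality holds for \<open>\<xi>\<close> with \<open>\<epsilon>\<^sup>2\<close> replaced by \<open>\<epsilon>\<^sup>2 (1 - k \<gamma>\<^sub>n / \<nu>\<^sub>n)\<close>
  (\<open>displacement_gap_small_support\<close>). In the limit along the ultrafilter the error term vanishes, and by
  continuity the inequality holds with \<open>\<epsilon>\<^sup>2\<close> on all of \<open>H\<^sub>\<gamma>\<close> (\<open>displacement_gap_pi_rep\<close>).

  Finally let \<open>a \<in> \<complex>[G]\<close> be the sum of the elements of \<open>F \<union> {\<one>}\<close>, and let \<open>m\<close> be their number. The
  trivial representation maps \<open>a\<close> to \<open>m\<close>, whereas the inequality forces
  \<open>\<parallel>\<pi>\<^sub>\<gamma>(a)\<parallel>\<^sup>2 \<le> max 0 (m\<^sup>2 - \<epsilon>\<^sup>2) < m\<^sup>2\<close> (\<open>opnorm_indicator_less\<close>). So the trivial representation is not weakly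
  contained in \<open>\<pi>\<^sub>\<gamma>\<close>.
\<close>

section \<open>Unitary representations on semidefinite spaces\<close>

text \<open>
  The form is only required to be positive semidefinite. The same locale then covers the spaces of
  bounded and of Cauchy sequences, which may have nonzero null vectors, as well as their quotients and
  the invariant submodules of all of these.
\<close>

locale unitary_module = grp: group G + module class_ring M
  for G :: "('g, 'm) monoid_scheme" and M :: "('g, 'v) gspace" +
  assumes sprod_add_left: "\<lbrakk>u \<in> carrier M; v \<in> carrier M; w \<in> carrier M\<rbrakk>
      \<Longrightarrow> sprod M (u \<oplus>\<^bsub>M\<^esub> v) w = sprod M u w + sprod M v w"
    and sprod_smult_left: "\<lbrakk>v \<in> carrier M; w \<in> carrier M\<rbrakk>
      \<Longrightarrow> sprod M (c \<odot>\<^bsub>M\<^esub> v) w = c * sprod M v w"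
    and sprod_cnj: "\<lbrakk>v \<in> carrier M; w \<in> carrier M\<rbrakk> \<Longrightarrow> cnj (sprod M v w) = sprod M w v"
    and sprod_nonneg: "v \<in> carrier M \<Longrightarrow> 0 \<le> Re (sprod M v v)"
    and unitary: "unitary_rep G M"
begin

lemma scale_closed [simp]: "v \<in> carrier M \<Longrightarrow> c \<odot>\<^bsub>M\<^esub> v \<in> carrier M"
  using smult_closed[of c v] by simp

lemma scale_add_right: "\<lbrakk>v \<in> carrier M; w \<in> carrier M\<rbrakk>
    \<Longrightarrow> c \<odot>\<^bsub>M\<^esub> (v \<oplus>\<^bsub>M\<^esub> w) = c \<odot>\<^bsub>M\<^esub> v \<oplus>\<^bsub>M\<^esub> c \<odot>\<^bsub>M\<^esub> w"
  using smult_r_distr[of c v w] by simp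

lemma scale_add_left: "v \<in> carrier M \<Longrightarrow> (b + c) \<odot>\<^bsub>M\<^esub> v = b \<odot>\<^bsub>M\<^esub> v \<oplus>\<^bsub>M\<^esub> c \<odot>\<^bsub>M\<^esub> v"
  using smult_l_distr[of b c v] by simp

lemma scale_scale: "v \<in> carrier M \<Longrightarrow> b \<odot>\<^bsub>M\<^esub> (c \<odot>\<^bsub>M\<^esub> v) = (b * c) \<odot>\<^bsub>M\<^esub> v"
  using smult_assoc1[of b c v] by simp

lemma scale_one [simp]: "v \<in> carrier M \<Longrightarrow> 1 \<odot>\<^bsub>M\<^esub> v = v"
  using smult_one[of v] by simp

lemma scale_zero [simp]: "v \<in> carrier M \<Longrightarrow> 0 \<odot>\<^bsub>M\<^esub> v = \<zero>\<^bsub>M\<^esub>"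
  using smult_l_null[of v] by simp

lemma scale_zero_right [simp]: "c \<odot>\<^bsub>M\<^esub> \<zero>\<^bsub>M\<^esub> = \<zero>\<^bsub>M\<^esub>"
  using smult_r_null[of c] by simp

lemma minus_as_scale: "v \<in> carrier M \<Longrightarrow> \<ominus>\<^bsub>M\<^esub> v = (- 1) \<odot>\<^bsub>M\<^esub> v"
proof -
  assume v: "v \<in> carrier M"
  have "v \<oplus>\<^bsub>M\<^esub> (- 1) \<odot>\<^bsub>M\<^esub> v = \<zero>\<^bsub>M\<^esub>"
    using scale_add_left[OF v, of 1 "- 1"] v by simp
  then show ?thesis
    using v by (intro M.minus_equality) (simp_all add: M.a_comm)
qed

lemma diff_as_scale: "\<lbrakk>v \<in> carrier M; w \<in> carrier M\<rbrakk> \<Longrightarrow> v \<ominus>\<^bsub>M\<^esub> w = v \<oplus>\<^bsub>M\<^esub> (- 1) \<odot>\<^bsub>M\<^esub> w"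
  by (simp add: a_minus_def minus_as_scale)

lemma diff_closed [simp]: "\<lbrakk>v \<in> carrier M; w \<in> carrier M\<rbrakk> \<Longrightarrow> v \<ominus>\<^bsub>M\<^esub> w \<in> carrier M"
  by (simp add: diff_as_scale)

lemma sprod_add_right: "\<lbrakk>u \<in> carrier M; v \<in> carrier M; w \<in> carrier M\<rbrakk>
    \<Longrightarrow> sprod M u (v \<oplus>\<^bsub>M\<^esub> w) = sprod M u v + sprod M u w"
  using sprod_cnj[of "v \<oplus>\<^bsub>M\<^esub> w" u] sprod_add_left[of v w u] by (simp add: sprod_cnj)

lemma sprod_smult_right: "\<lbrakk>v \<in> carrier M; w \<in> carrier M\<rbrakk>
    \<Longrightarrow> sprod M v (c \<odot>\<^bsub>M\<^esub> w) = cnj c * sprod M v w"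
  using sprod_cnj[of "c \<odot>\<^bsub>M\<^esub> w" v] sprod_smult_left[of w v c] by (simp add: sprod_cnj)

lemma sprod_zero_left [simp]: "v \<in> carrier M \<Longrightarrow> sprod M \<zero>\<^bsub>M\<^esub> v = 0"
  using sprod_smult_left[of v v 0] by simp

lemma sprod_zero_right [simp]: "v \<in> carrier M \<Longrightarrow> sprod M v \<zero>\<^bsub>M\<^esub> = 0"
  using sprod_smult_right[of v v 0] by simp

lemma sprod_diff_left: "\<lbrakk>u \<in> carrier M; v \<in> carrier M; w \<in> carrier M\<rbrakk>
    \<Longrightarrow> sprod M (u \<ominus>\<^bsub>M\<^esub> v) w = sprod M u w - sprod M v w"
  by (simp add: diff_as_scale sprod_add_left sprod_smult_left)

lemma sprod_diff_right: "\<lbrakk>u \<in> carrier M; v \<in> carrier M; w \<in> carrier M\<rbrakk>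
    \<Longrightarrow> sprod M u (v \<ominus>\<^bsub>M\<^esub> w) = sprod M u v - sprod M u w"
  by (simp add: diff_as_scale sprod_add_right sprod_smult_right)

lemma sprod_finsum_left:
  assumes "finite A" "f \<in> A \<rightarrow> carrier M" "w \<in> carrier M"
  shows "sprod M (\<Oplus>\<^bsub>M\<^esub>i\<in>A. f i) w = (\<Sum>i\<in>A. sprod M (f i) w)"
  using assms by (induction A) (auto simp: sprod_add_left Pi_def)

lemma sprod_finsum_right:
  assumes "finite A" "f \<in> A \<rightarrow> carrier M" "w \<in> carrier M"
  shows "sprod M w (\<Oplus>\<^bsub>M\<^esub>i\<in>A. f i) = (\<Sum>i\<in>A. sprod M w (f i))"
  using assms by (induction A) (auto simp: sprod_add_right Pi_def)

lemma hnorm_nonneg [simp]: "v \<in> carrier M \<Longrightarrow> 0 \<le> hnorm M v"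
  by (simp add: hnorm_def sprod_nonneg)

lemma hnorm_sq: "v \<in> carrier M \<Longrightarrow> (hnorm M v)\<^sup>2 = Re (sprod M v v)"
  by (simp add: hnorm_def sprod_nonneg)

lemma sprod_self: "v \<in> carrier M \<Longrightarrow> sprod M v v = complex_of_real ((hnorm M v)\<^sup>2)"
  using sprod_cnj[of v v] by (simp add: hnorm_sq complex_eq_iff)

lemma hnorm_sq_diff:
  assumes "v \<in> carrier M" "w \<in> carrier M"
  shows "(hnorm M (v \<ominus>\<^bsub>M\<^esub> w))\<^sup>2 = (hnorm M v)\<^sup>2 + (hnorm M w)\<^sup>2 - 2 * Re (sprod M v w)"
proof -
  have "Re (sprod M w v) = Re (sprod M v w)"
    using arg_cong[OF sprod_cnj[OF assms], of Re] by simp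
  then show ?thesis
    using assms by (simp add: hnorm_sq sprod_diff_left sprod_diff_right)
qed

lemma hnorm_smult: "v \<in> carrier M \<Longrightarrow> hnorm M (c \<odot>\<^bsub>M\<^esub> v) = cmod c * hnorm M v"
proof -
  assume v: "v \<in> carrier M"
  have "sprod M (c \<odot>\<^bsub>M\<^esub> v) (c \<odot>\<^bsub>M\<^esub> v) = (c * cnj c) * sprod M v v"
    using v by (simp add: sprod_smult_left sprod_smult_right)
  also have "\<dots> = complex_of_real ((cmod c * hnorm M v)\<^sup>2)"
    using v by (simp only: complex_norm_square[symmetric]) (simp add: sprod_self power_mult_distrib)
  finally show ?thesis
    using v by (simp add: hnorm_def[of M "c \<odot>\<^bsub>M\<^esub> v"] real_sqrt_mult)
qed

text \<open>
  The usual proof expands \<open>\<parallel>v - c w\<parallel>\<^sup>2 \<ge> 0\<close> at \<open>c = \<langle>v, w\<rangle> / \<parallel>w\<parallel>\<^sup>2\<close>. Since \<open>w\<close> may be a nonzero null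
  vector, the scalar is \<open>c = t \<langle>v, w\<rangle>\<close> with \<open>t\<close> still free; for null \<open>w\<close> a large \<open>t\<close> does it.
\<close>

lemma cauchy_schwarz:
  assumes v: "v \<in> carrier M" and w: "w \<in> carrier M"
  shows "cmod (sprod M v w) \<le> hnorm M v * hnorm M w"
proof -
  define z where "z = sprod M v w"
  have quad: "0 \<le> (hnorm M v)\<^sup>2 + t\<^sup>2 * (cmod z)\<^sup>2 * (hnorm M w)\<^sup>2 - 2 * t * (cmod z)\<^sup>2" for t :: real
  proof -
    let ?c = "complex_of_real t * z"
    have "0 \<le> (hnorm M (v \<ominus>\<^bsub>M\<^esub> ?c \<odot>\<^bsub>M\<^esub> w))\<^sup>2" by simp
    also have "\<dots> = (hnorm M v)\<^sup>2 + (cmod ?c * hnorm M w)\<^sup>2 - 2 * Re (cnj ?c * z)"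
      using v w by (simp add: hnorm_sq_diff hnorm_smult sprod_smult_right z_def)
    also have "cnj ?c * z = complex_of_real (t * (cmod z)\<^sup>2)"
      by (simp only: of_real_mult complex_norm_square complex_cnj_mult complex_cnj_complex_of_real)
        (simp add: mult_ac)
    finally show ?thesis
      by (simp only: Re_complex_of_real) (simp add: norm_mult power_mult_distrib algebra_simps)
  qed
  have "(cmod z)\<^sup>2 \<le> (hnorm M v)\<^sup>2 * (hnorm M w)\<^sup>2"
  proof (cases "hnorm M w = 0")
    case True
    have "z = 0"
    proof (rule ccontr)
      assume "z \<noteq> 0"
      then obtain t where t: "t * (cmod z)\<^sup>2 = (hnorm M v)\<^sup>2 + 1"
        by (rule_tac that[of "((hnorm M v)\<^sup>2 + 1) / (cmod z)\<^sup>2"]) simp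
      have "0 \<le> (hnorm M v)\<^sup>2 - 2 * (t * (cmod z)\<^sup>2)"
        using quad[of t] True by (simp add: mult.assoc)
      moreover have "0 \<le> (hnorm M v)\<^sup>2" by simp
      ultimately show False unfolding t by argo
    qed
    then show ?thesis by simp
  next
    case False
    then obtain t where t: "t * (hnorm M w)\<^sup>2 = 1"
      by (rule_tac that[of "1 / (hnorm M w)\<^sup>2"]) simp
    have "t\<^sup>2 * (cmod z)\<^sup>2 * (hnorm M w)\<^sup>2 = t * (cmod z)\<^sup>2 * (t * (hnorm M w)\<^sup>2)"
      by (simp only: power2_eq_square mult_ac)
    then have "t * (cmod z)\<^sup>2 \<le> (hnorm M v)\<^sup>2"
      using quad[of t] unfolding t mult_1_right by argo
    then have "t * (cmod z)\<^sup>2 * (hnorm M w)\<^sup>2 \<le> (hnorm M v)\<^sup>2 * (hnorm M w)\<^sup>2"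
      by (rule mult_right_mono) simp
    moreover have "t * (cmod z)\<^sup>2 * (hnorm M w)\<^sup>2 = (cmod z)\<^sup>2 * (t * (hnorm M w)\<^sup>2)"
      by simp
    ultimately show ?thesis unfolding t by simp
  qed
  then have "(cmod z)\<^sup>2 \<le> (hnorm M v * hnorm M w)\<^sup>2" by (simp add: power_mult_distrib)
  then show ?thesis
    unfolding z_def by (rule power2_le_imp_le) (simp add: v w)
qed

lemma hnorm_triangle:
  assumes v: "v \<in> carrier M" and w: "w \<in> carrier M"
  shows "hnorm M (v \<oplus>\<^bsub>M\<^esub> w) \<le> hnorm M v + hnorm M w"
proof -
  have "Re (sprod M v w) \<le> hnorm M v * hnorm M w" "Re (sprod M w v) \<le> hnorm M v * hnorm M w"
    using order_trans[OF complex_Re_le_cmod cauchy_schwarz[OF v w]]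
      order_trans[OF complex_Re_le_cmod cauchy_schwarz[OF w v]] by (simp_all add: mult.commute)
  then have "(hnorm M (v \<oplus>\<^bsub>M\<^esub> w))\<^sup>2 \<le> (hnorm M v + hnorm M w)\<^sup>2"
    using v w by (simp add: hnorm_sq sprod_add_left sprod_add_right power2_sum)
  then show ?thesis by (rule power2_le_imp_le) (simp add: v w)
qed

lemma act_closed [simp]: "\<lbrakk>g \<in> carrier G; v \<in> carrier M\<rbrakk> \<Longrightarrow> act M g v \<in> carrier M"
  using unitary by (auto simp: unitary_rep_def module_hom_def)

lemma act_add: "\<lbrakk>g \<in> carrier G; v \<in> carrier M; w \<in> carrier M\<rbrakk>
    \<Longrightarrow> act M g (v \<oplus>\<^bsub>M\<^esub> w) = act M g v \<oplus>\<^bsub>M\<^esub> act M g w"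
  using unitary by (auto simp: unitary_rep_def module_hom_def)

lemma act_smult: "\<lbrakk>g \<in> carrier G; v \<in> carrier M\<rbrakk>
    \<Longrightarrow> act M g (c \<odot>\<^bsub>M\<^esub> v) = c \<odot>\<^bsub>M\<^esub> act M g v"
  using unitary by (auto simp: unitary_rep_def module_hom_def)

lemma act_diff: "\<lbrakk>g \<in> carrier G; v \<in> carrier M; w \<in> carrier M\<rbrakk>
    \<Longrightarrow> act M g (v \<ominus>\<^bsub>M\<^esub> w) = act M g v \<ominus>\<^bsub>M\<^esub> act M g w"
  by (simp add: diff_as_scale act_add act_smult)

lemma sprod_act [simp]: "\<lbrakk>g \<in> carrier G; v \<in> carrier M; w \<in> carrier M\<rbrakk>
    \<Longrightarrow> sprod M (act M g v) (act M g w) = sprod M v w"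
  using unitary by (auto simp: unitary_rep_def)

lemma hnorm_act [simp]: "\<lbrakk>g \<in> carrier G; v \<in> carrier M\<rbrakk> \<Longrightarrow> hnorm M (act M g v) = hnorm M v"
  by (simp add: hnorm_def)

lemma act_one: "v \<in> carrier M \<Longrightarrow> act M \<one>\<^bsub>G\<^esub> v = v"
  using unitary by (auto simp: unitary_rep_def)

lemma act_mult: "\<lbrakk>g \<in> carrier G; h \<in> carrier G; v \<in> carrier M\<rbrakk>
    \<Longrightarrow> act M (g \<otimes>\<^bsub>G\<^esub> h) v = act M g (act M h v)"
  using unitary by (auto simp: unitary_rep_def)

lemma sprod_act_adjoint:
  assumes "g \<in> carrier G" "v \<in> carrier M" "w \<in> carrier M"
  shows "sprod M (act M g v) w = sprod M v (act M (inv\<^bsub>G\<^esub> g) w)"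
proof -
  have "act M g (act M (inv\<^bsub>G\<^esub> g) w) = w"
    using assms by (simp flip: act_mult add: act_one)
  then show ?thesis
    using sprod_act[of g v "act M (inv\<^bsub>G\<^esub> g) w"] assms by simp
qed

lemma tendsto_sprod:
  assumes s: "\<And>n. s n \<in> carrier M" and t: "\<And>n. t n \<in> carrier M"
    and v: "v \<in> carrier M" and w: "w \<in> carrier M"
    and sv: "((\<lambda>n. hnorm M (v \<ominus>\<^bsub>M\<^esub> s n)) \<longlongrightarrow> 0) F" and tw: "((\<lambda>n. hnorm M (w \<ominus>\<^bsub>M\<^esub> t n)) \<longlongrightarrow> 0) F"
  shows "((\<lambda>n. sprod M (s n) (t n)) \<longlongrightarrow> sprod M v w) F"
proof -
  let ?a = "\<lambda>n. hnorm M (v \<ominus>\<^bsub>M\<^esub> s n)" and ?b = "\<lambda>n. hnorm M (w \<ominus>\<^bsub>M\<^esub> t n)"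
  have le: "cmod (sprod M (s n) (t n) - sprod M v w) \<le> ?a n * hnorm M w + hnorm M v * ?b n + ?a n * ?b n" for n
  proof -
    have "sprod M (s n) (t n) - sprod M v w
        = - sprod M (v \<ominus>\<^bsub>M\<^esub> s n) w - sprod M v (w \<ominus>\<^bsub>M\<^esub> t n) + sprod M (v \<ominus>\<^bsub>M\<^esub> s n) (w \<ominus>\<^bsub>M\<^esub> t n)"
      using s[of n] t[of n] v w by (simp add: sprod_diff_left sprod_diff_right)
    then have "cmod (sprod M (s n) (t n) - sprod M v w)
        \<le> cmod (sprod M (v \<ominus>\<^bsub>M\<^esub> s n) w) + cmod (sprod M v (w \<ominus>\<^bsub>M\<^esub> t n))
          + cmod (sprod M (v \<ominus>\<^bsub>M\<^esub> s n) (w \<ominus>\<^bsub>M\<^esub> t n))"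
      by (simp only:) (rule order_trans[OF norm_triangle_ineq], simp,
          rule order_trans[OF norm_triangle_ineq4], simp)
    also have "\<dots> \<le> ?a n * hnorm M w + hnorm M v * ?b n + ?a n * ?b n"
      using s[of n] t[of n] v w by (intro add_mono cauchy_schwarz) auto
    finally show ?thesis .
  qed
  have lim: "((\<lambda>n. ?a n * hnorm M w + hnorm M v * ?b n + ?a n * ?b n) \<longlongrightarrow> 0) F"
    using tendsto_add[OF tendsto_add[OF tendsto_mult_left_zero[OF sv, of "hnorm M w"]
          tendsto_mult_right_zero[OF tw, of "hnorm M v"]] tendsto_mult_zero[OF sv tw]]
    by simp
  have "((\<lambda>n. cmod (sprod M (s n) (t n) - sprod M v w)) \<longlongrightarrow> 0) F"
    by (rule tendsto_sandwich[OF always_eventually always_eventually tendsto_const lim]) (simp_all add: le)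
  then show ?thesis by (rule LIM_zero_cancel[OF tendsto_norm_zero_cancel])
qed

lemma restrict:
  assumes W: "submodule class_ring W M" and inv: "\<And>g. g \<in> carrier G \<Longrightarrow> act M g ` W \<subseteq> W"
  shows "unitary_module G (M\<lparr>carrier := W\<rparr>)"
proof -
  have sub: "v \<in> carrier M" if "v \<in> W" for v
    using submodule.subset[OF W] that by auto
  interpret W: module class_ring "M\<lparr>carrier := W\<rparr>"
    using submodule_is_module[OF W] .
  show ?thesis
  proof unfold_locales
    show "unitary_rep G (M\<lparr>carrier := W\<rparr>)"
      using inv sub by (auto simp: unitary_rep_def module_hom_def act_add act_smult act_one act_mult)
  qed (auto simp: sub sprod_add_left sprod_smult_left sprod_cnj sprod_nonneg)
qed

end

subsection \<open>Displacement and the averaging operator\<close>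

text \<open>
  A bound \<open>\<delta> \<parallel>v\<parallel>\<^sup>2 \<le> displacement M F v\<close> for all \<open>v\<close> is the spectral gap that the proof carries from
  one space to the next. With squares, both sides are additive over orthogonal decompositions into
  invariant subspaces and continuous in \<open>v\<close>.
\<close>

definition displacement :: "('g, 'v) gspace \<Rightarrow> 'g set \<Rightarrow> 'v \<Rightarrow> real" where
  "displacement M F v = (\<Sum>g\<in>F. (hnorm M (act M g v \<ominus>\<^bsub>M\<^esub> v))\<^sup>2)"

context unitary_module
begin

lemma displacement_eq:
  assumes "F \<subseteq> carrier G" "v \<in> carrier M"
  shows "displacement M F v = (\<Sum>g\<in>F. 2 * (hnorm M v)\<^sup>2 - 2 * Re (sprod M (act M g v) v))"
  unfolding displacement_def
proof (rule sum.cong[OF refl])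
  fix g assume "g \<in> F"
  then have "g \<in> carrier G" using assms by auto
  then show "(hnorm M (act M g v \<ominus>\<^bsub>M\<^esub> v))\<^sup>2 = 2 * (hnorm M v)\<^sup>2 - 2 * Re (sprod M (act M g v) v)"
    using assms by (simp add: hnorm_sq_diff)
qed

lemma alg_act_indicator:
  assumes "F \<subseteq> carrier G" "v \<in> carrier M"
  shows "alg_act M (indicator F) v = (\<Oplus>\<^bsub>M\<^esub>g\<in>F. act M g v)"
proof -
  have eq: "{g. indicator F g \<noteq> (0 :: complex)} = F" by (auto simp: indicator_def)
  show ?thesis
    unfolding alg_act_def eq
    by (rule M.finsum_cong') (use assms in auto)
qed

lemma alg_act_indicator_closed:
  assumes "F \<subseteq> carrier G" "v \<in> carrier M"
  shows "alg_act M (indicator F) v \<in> carrier M"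
  using assms by (subst alg_act_indicator) (auto intro!: M.finsum_closed)

lemma hnorm_alg_act_indicator:
  assumes "finite F" "F \<subseteq> carrier G" "v \<in> carrier M"
  shows "(hnorm M (alg_act M (indicator F) v))\<^sup>2
    = (\<Sum>g\<in>F. \<Sum>h\<in>F. Re (sprod M (act M g v) (act M h v)))"
proof -
  have cl: "(\<lambda>g. act M g v) \<in> F \<rightarrow> carrier M" using assms by auto
  then have cl': "(\<Oplus>\<^bsub>M\<^esub>g\<in>F. act M g v) \<in> carrier M" by (rule M.finsum_closed)
  have "sprod M (\<Oplus>\<^bsub>M\<^esub>g\<in>F. act M g v) (\<Oplus>\<^bsub>M\<^esub>g\<in>F. act M g v)
      = (\<Sum>g\<in>F. \<Sum>h\<in>F. sprod M (act M g v) (act M h v))"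
    unfolding sprod_finsum_left[OF assms(1) cl cl']
    using assms cl by (intro sum.cong refl sprod_finsum_right) auto
  then show ?thesis
    using assms cl' by (simp add: alg_act_indicator hnorm_sq)
qed

text \<open>
  Write \<open>2 Re \<langle>g v, h v\<rangle> = 2 \<parallel>v\<parallel>\<^sup>2 - \<parallel>g v - h v\<parallel>\<^sup>2\<close>. Summed over all pairs, the right-hand side loses
  \<open>\<parallel>g v - h v\<parallel>\<^sup>2\<close> for each pair; the pairs with \<open>g = \<one>\<close> and those with \<open>h = \<one>\<close> alone account for
  twice the displacement.
\<close>

lemma hnorm_alg_act_le:
  assumes F: "finite F" "F \<subseteq> carrier G" "\<one>\<^bsub>G\<^esub> \<in> F" and v: "v \<in> carrier M"
  shows "(hnorm M (alg_act M (indicator F) v))\<^sup>2 \<le> (real (card F))\<^sup>2 * (hnorm M v)\<^sup>2 - displacement M F v"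
proof -
  let ?N = "(hnorm M v)\<^sup>2"
  define d where "d g h = (hnorm M (act M g v \<ominus>\<^bsub>M\<^esub> act M h v))\<^sup>2" for g h
  have cl: "act M g v \<in> carrier M" if "g \<in> F" for g using that F v by auto
  have re: "2 * Re (sprod M (act M g v) (act M h v)) = 2 * ?N - d g h" if "g \<in> F" "h \<in> F" for g h
    using that F v cl by (simp add: d_def hnorm_sq_diff subset_iff)
  have d0: "0 \<le> d g h" for g h by (simp add: d_def)
  have sym: "d g h = d h g" if "g \<in> F" "h \<in> F" for g h
    using arg_cong[OF sprod_cnj[of "act M g v" "act M h v"], of Re] that cl
    by (simp add: d_def hnorm_sq_diff)
  have one: "d g \<one>\<^bsub>G\<^esub> = (hnorm M (act M g v \<ominus>\<^bsub>M\<^esub> v))\<^sup>2" for g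
    using v by (simp add: d_def act_one)
  have "(hnorm M (v \<ominus>\<^bsub>M\<^esub> v))\<^sup>2 = 0"
    using v by (simp only: hnorm_sq_diff) (simp add: hnorm_sq)
  then have one0: "d \<one>\<^bsub>G\<^esub> \<one>\<^bsub>G\<^esub> = 0" by (simp only: one) (simp add: act_one v)
  let ?F = "F - {\<one>\<^bsub>G\<^esub>}"
  have disp: "displacement M F v = (\<Sum>g\<in>?F. d g \<one>\<^bsub>G\<^esub>)"
    unfolding displacement_def one[symmetric] using F one0 by (simp add: sum.remove)
  have "(\<Sum>h\<in>?F. d \<one>\<^bsub>G\<^esub> h) = (\<Sum>g\<in>?F. d g \<one>\<^bsub>G\<^esub>)"
    using F sym by (intro sum.cong refl) auto
  then have "2 * displacement M F v = (\<Sum>h\<in>?F. d \<one>\<^bsub>G\<^esub> h) + (\<Sum>g\<in>?F. d g \<one>\<^bsub>G\<^esub>)"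
    unfolding disp by simp
  also have "\<dots> \<le> (\<Sum>h\<in>F. d \<one>\<^bsub>G\<^esub> h) + (\<Sum>g\<in>?F. \<Sum>h\<in>F. d g h)"
  proof (intro add_mono sum_mono)
    show "(\<Sum>h\<in>?F. d \<one>\<^bsub>G\<^esub> h) \<le> (\<Sum>h\<in>F. d \<one>\<^bsub>G\<^esub> h)"
      using F d0 by (intro sum_mono2) auto
    show "d g \<one>\<^bsub>G\<^esub> \<le> (\<Sum>h\<in>F. d g h)" for g
      using F d0 by (intro member_le_sum) auto
  qed
  also have "\<dots> = (\<Sum>g\<in>F. \<Sum>h\<in>F. d g h)"
    using F by (simp add: sum.remove[of F "\<one>\<^bsub>G\<^esub>"])
  finally have "2 * displacement M F v \<le> (\<Sum>g\<in>F. \<Sum>h\<in>F. d g h)" .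
  moreover have "2 * (hnorm M (alg_act M (indicator F) v))\<^sup>2
      = (\<Sum>g\<in>F. \<Sum>h\<in>F. 2 * ?N - d g h)"
    unfolding hnorm_alg_act_indicator[OF F(1,2) v] sum_distrib_left
    using re by (intro sum.cong refl) auto
  ultimately show ?thesis
    by (simp add: sum_subtractf power2_eq_square)
qed

text \<open>
  A spectral gap is seen by one element of the group algebra, the sum of the elements of \<open>F\<close>: in a
  representation with a fixed unit vector it has norm at least \<open>card F\<close>, but here its norm is at most
  \<open>sqrt (max 0 ((card F)\<^sup>2 - \<delta>))\<close>.
\<close>

lemma opnorm_indicator_less:
  assumes F: "finite F" "F \<subseteq> carrier G" "\<one>\<^bsub>G\<^esub> \<in> F" and "0 < \<delta>"
    and gap: "\<And>v. v \<in> carrier M \<Longrightarrow> \<delta> * (hnorm M v)\<^sup>2 \<le> displacement M F v"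
  shows "opnorm M (indicator F) < real (card F)"
proof -
  let ?m = "real (card F)"
  (* If all vectors are null, the hypothesis holds for every \<delta>, so ?m\<^sup>2 - \<delta> can be negative. *)
  define B where "B = sqrt (max 0 (?m\<^sup>2 - \<delta>))"
  have "0 < ?m" using F by (auto simp: card_gt_0_iff)
  have "hnorm M (alg_act M (indicator F) v) \<le> B" if v: "v \<in> carrier M" "hnorm M v \<le> 1" for v
  proof -
    have n1: "0 \<le> (hnorm M v)\<^sup>2" "(hnorm M v)\<^sup>2 \<le> 1"
      using v by (simp_all add: power_le_one)
    have "(hnorm M (alg_act M (indicator F) v))\<^sup>2 \<le> (?m\<^sup>2 - \<delta>) * (hnorm M v)\<^sup>2"
      using hnorm_alg_act_le[OF F v(1)] gap[OF v(1)] by (simp add: algebra_simps)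
    also have "\<dots> \<le> max 0 (?m\<^sup>2 - \<delta>) * (hnorm M v)\<^sup>2"
      using n1 by (intro mult_right_mono) auto
    also have "\<dots> \<le> max 0 (?m\<^sup>2 - \<delta>) * 1"
      using n1 by (intro mult_left_mono) auto
    finally show ?thesis unfolding B_def by (intro real_le_rsqrt) simp
  qed
  moreover have "\<zero>\<^bsub>M\<^esub> \<in> carrier M" "hnorm M \<zero>\<^bsub>M\<^esub> \<le> 1" by (simp_all add: hnorm_def)
  ultimately have "opnorm M (indicator F) \<le> B"
    unfolding opnorm_def by (intro cSup_least) auto
  also have "B < ?m"
    unfolding B_def using \<open>0 < ?m\<close> \<open>0 < \<delta>\<close> by (intro real_less_lsqrt) auto
  finally show ?thesis .
qed

lemma opnorm_indicator_fixed_vector: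
  assumes F: "finite F" "F \<subseteq> carrier G"
    and v: "v \<in> carrier M" "hnorm M v = 1" "\<And>g. g \<in> F \<Longrightarrow> act M g v = v"
  shows "real (card F) \<le> opnorm M (indicator F)"
proof -
  have bound: "hnorm M (alg_act M (indicator F) w) \<le> real (card F)"
    if w: "w \<in> carrier M" "hnorm M w \<le> 1" for w
  proof (rule power2_le_imp_le)
    have "(hnorm M (alg_act M (indicator F) w))\<^sup>2 \<le> (\<Sum>g\<in>F. \<Sum>h\<in>F. 1)"
      unfolding hnorm_alg_act_indicator[OF F w(1)]
    proof (intro sum_mono)
      fix g h assume "g \<in> F" "h \<in> F"
      then have gh: "g \<in> carrier G" "h \<in> carrier G" using F by auto
      have "Re (sprod M (act M g w) (act M h w)) \<le> hnorm M w * hnorm M w"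
        using order_trans[OF complex_Re_le_cmod cauchy_schwarz[of "act M g w" "act M h w"]] gh w by simp
      also have "\<dots> \<le> 1" using w by (simp add: mult_le_one)
      finally show "Re (sprod M (act M g w) (act M h w)) \<le> 1" .
    qed
    then show "(hnorm M (alg_act M (indicator F) w))\<^sup>2 \<le> (real (card F))\<^sup>2"
      by (simp add: power2_eq_square)
  qed simp
  have "(hnorm M (alg_act M (indicator F) v))\<^sup>2 = (\<Sum>g\<in>F. \<Sum>h\<in>F. 1)"
    unfolding hnorm_alg_act_indicator[OF F v(1)]
    using v by (intro sum.cong refl) (simp flip: hnorm_sq)
  then have "(hnorm M (alg_act M (indicator F) v))\<^sup>2 = (real (card F))\<^sup>2"
    by (simp add: power2_eq_square)
  then have "hnorm M (alg_act M (indicator F) v) = real (card F)"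
    by (rule power2_eq_imp_eq) (simp_all add: alg_act_indicator_closed F v)
  moreover have "bdd_above {hnorm M (alg_act M (indicator F) w) | w. w \<in> carrier M \<and> hnorm M w \<le> 1}"
    using bound by (intro bdd_aboveI[of _ "real (card F)"]) auto
  ultimately show ?thesis
    unfolding opnorm_def using v by (intro cSup_upper) (auto intro!: exI[of _ v])
qed

end

section \<open>Quotients, sequence spaces and completions\<close>

text \<open>
  The axioms are identities between the operations and the form, so they pass to any image under a
  map compatible with all of these. This covers quotients by null vectors as well as the passage to
  coordinates.
\<close>

lemma unitary_module_image:
  assumes M: "unitary_module G M"
    and car: "carrier K = q ` carrier M"
    and zero: "\<zero>\<^bsub>K\<^esub> = q \<zero>\<^bsub>M\<^esub>"
    and add: "\<And>v w. v \<in> carrier M \<Longrightarrow> w \<in> carrier M \<Longrightarrow> q v \<oplus>\<^bsub>K\<^esub> q w = q (v \<oplus>\<^bsub>M\<^esub> w)"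
    and smult: "\<And>c v. v \<in> carrier M \<Longrightarrow> c \<odot>\<^bsub>K\<^esub> q v = q (c \<odot>\<^bsub>M\<^esub> v)"
    and sprod: "\<And>v w. v \<in> carrier M \<Longrightarrow> w \<in> carrier M \<Longrightarrow> sprod K (q v) (q w) = sprod M v w"
    and act: "\<And>g v. g \<in> carrier G \<Longrightarrow> v \<in> carrier M \<Longrightarrow> act K g (q v) = q (act M g v)"
  shows "unitary_module G K"
proof -
  interpret M: unitary_module G M by (rule M)
  have neg: "\<exists>w\<in>carrier M. q (v \<oplus>\<^bsub>M\<^esub> w) = q \<zero>\<^bsub>M\<^esub>" if "v \<in> carrier M" for v
    using that by (intro bexI[of _ "\<ominus>\<^bsub>M\<^esub> v"]) (simp_all add: M.M.r_neg)
  have "module class_ring K"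
    by (rule module_criteria[OF module.axioms(1)[OF M.module_axioms]])
      (auto simp: car zero add smult neg M.scale_add_left M.scale_add_right M.scale_scale
        M.M.a_assoc M.M.a_comm M.M.a_lcomm)
  moreover have "unitary_rep G K"
    by (auto simp: unitary_rep_def module_hom_def car add smult act sprod
        M.act_add M.act_smult M.act_one M.act_mult)
  ultimately show ?thesis
    by (intro unitary_module.intro unitary_module_axioms.intro M.grp.group_axioms)
      (auto simp: car add smult sprod M.sprod_add_left M.sprod_smult_left M.sprod_cnj M.sprod_nonneg)
qed

text \<open>
  Bounded sequences with a limit along an ultrafilter and Cauchy sequences with an ordinary limit
  are two instances of one construction: pointwise operations, and a form that is the limit of the
  forms of the components. Each axiom for the form is an equation or a weak inequality and survives
  the limit.
\<close>

lemma unitary_module_limit: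
  fixes M :: "'i \<Rightarrow> ('g, 'v) gspace" and K :: "('g, 'i \<Rightarrow> 'v) gspace"
  assumes M: "\<And>n. unitary_module G (M n)" and "F \<noteq> bot"
    and car: "\<And>s n. s \<in> carrier K \<Longrightarrow> s n \<in> carrier (M n)"
    and zero: "\<zero>\<^bsub>K\<^esub> = (\<lambda>n. \<zero>\<^bsub>M n\<^esub>)" "\<zero>\<^bsub>K\<^esub> \<in> carrier K"
    and add: "\<And>s t. s \<oplus>\<^bsub>K\<^esub> t = (\<lambda>n. s n \<oplus>\<^bsub>M n\<^esub> t n)"
      "\<And>s t. s \<in> carrier K \<Longrightarrow> t \<in> carrier K \<Longrightarrow> s \<oplus>\<^bsub>K\<^esub> t \<in> carrier K"
    and smult: "\<And>c s. c \<odot>\<^bsub>K\<^esub> s = (\<lambda>n. c \<odot>\<^bsub>M n\<^esub> s n)"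
      "\<And>c s. s \<in> carrier K \<Longrightarrow> c \<odot>\<^bsub>K\<^esub> s \<in> carrier K"
    and act: "\<And>g s. act K g s = (\<lambda>n. act (M n) g (s n))"
      "\<And>g s. g \<in> carrier G \<Longrightarrow> s \<in> carrier K \<Longrightarrow> act K g s \<in> carrier K"
    and lim: "\<And>s t. s \<in> carrier K \<Longrightarrow> t \<in> carrier K
      \<Longrightarrow> ((\<lambda>n. sprod (M n) (s n) (t n)) \<longlongrightarrow> sprod K s t) F"
  shows "unitary_module G K"
proof -
  interpret M: unitary_module G "M n" for n by (rule M)
  have eqI: "x = y" if "(f \<longlongrightarrow> x) F" "(h \<longlongrightarrow> y) F" "f = h" for f h :: "'i \<Rightarrow> complex" and x y
    using that tendsto_unique \<open>F \<noteq> bot\<close> by blast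
  have neg: "\<exists>t\<in>carrier K. s \<oplus>\<^bsub>K\<^esub> t = \<zero>\<^bsub>K\<^esub>" if s: "s \<in> carrier K" for s
  proof (intro bexI ext)
    show "(- 1) \<odot>\<^bsub>K\<^esub> s \<in> carrier K" using s by (rule smult)
    show "(s \<oplus>\<^bsub>K\<^esub> (- 1) \<odot>\<^bsub>K\<^esub> s) n = \<zero>\<^bsub>K\<^esub> n" for n
      using car[OF s, of n] by (simp add: add(1) smult(1) zero(1) M.minus_as_scale[symmetric] M.M.r_neg)
  qed
  have "module class_ring K"
  proof (rule module_criteria[OF module.axioms(1)[OF M.module_axioms]])
    show "\<forall>v\<in>carrier K. \<exists>neg_v\<in>carrier K. v \<oplus>\<^bsub>K\<^esub> neg_v = \<zero>\<^bsub>K\<^esub>" using neg by blast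
  qed (auto simp: zero(2) add(2) smult(2),
      auto simp: zero(1) add(1) smult(1) fun_eq_iff car M.scale_add_left M.scale_add_right M.scale_scale
        M.M.a_assoc M.M.a_comm M.M.a_lcomm)
  moreover have "unitary_rep G K"
    unfolding unitary_rep_def
  proof (intro conjI ballI)
    fix g s t assume "g \<in> carrier G" "s \<in> carrier K" "t \<in> carrier K"
    then show "sprod K (act K g s) (act K g t) = sprod K s t"
      by (intro eqI[OF lim lim] act(2)) (auto simp: act(1) car fun_eq_iff)
  next
    fix g assume "g \<in> carrier G"
    then show "act K g \<in> module_hom class_ring K K"
      unfolding module_hom_def using act(2)
      by (auto simp: act(1) add(1) smult(1) car M.act_add M.act_smult)
  qed (auto simp: act(1) car M.act_one M.act_mult)
  ultimately show ?thesis
  proof (intro unitary_module.intro unitary_module_axioms.intro M.grp.group_axioms)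
    fix s t u assume s: "s \<in> carrier K" and t: "t \<in> carrier K" and u: "u \<in> carrier K"
    show "sprod K (s \<oplus>\<^bsub>K\<^esub> t) u = sprod K s u + sprod K t u"
      using s t u
      by (intro eqI[OF lim tendsto_add[OF lim lim]] add(2)) (auto simp: add(1) car M.sprod_add_left)
  next
    fix s t c assume s: "s \<in> carrier K" and t: "t \<in> carrier K"
    show "sprod K (c \<odot>\<^bsub>K\<^esub> s) t = c * sprod K s t"
      using s t
      by (intro eqI[OF lim tendsto_mult_left[OF lim]] smult(2)) (auto simp: smult(1) car M.sprod_smult_left)
    show "cnj (sprod K s t) = sprod K t s"
      using s t by (intro eqI[OF tendsto_cnj[OF lim] lim]) (auto simp: car M.sprod_cnj)
    show "0 \<le> Re (sprod K s s)"
      using s by (intro tendsto_lowerbound[OF tendsto_Re[OF lim] _ \<open>F \<noteq> bot\<close>])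
        (auto simp: car M.sprod_nonneg)
  qed
qed

subsection \<open>The quotient by the null vectors\<close>

context unitary_module
begin

lemma null_vecs_iff: "v \<in> null_vecs M \<longleftrightarrow> v \<in> carrier M \<and> hnorm M v = 0"
  by (auto simp: null_vecs_def sprod_self)

lemma abelian_subgroup_null_vecs: "abelian_subgroup (null_vecs M) M"
proof -
  have zero: "\<zero>\<^bsub>M\<^esub> \<in> null_vecs M" by (simp add: null_vecs_def)
  have minus: "\<ominus>\<^bsub>M\<^esub> v \<in> null_vecs M" if "v \<in> null_vecs M" for v
    using that by (simp add: null_vecs_iff minus_as_scale hnorm_smult)
  have add: "v \<oplus>\<^bsub>M\<^esub> w \<in> null_vecs M" if "v \<in> null_vecs M" "w \<in> null_vecs M" for v w
    using that hnorm_triangle[of v w] by (auto simp: null_vecs_iff intro: antisym)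
  have "subgroup (null_vecs M) (add_monoid M)"
    using zero minus add by (intro subgroup.intro) (auto simp: null_vecs_iff a_inv_def)
  then show ?thesis
    by (intro abelian_subgroupI3 additive_subgroup.intro M.abelian_group_axioms)
qed

interpretation null: abelian_subgroup "null_vecs M" M
  by (rule abelian_subgroup_null_vecs)

lemma mem_qmap_iff:
  assumes "v \<in> carrier M"
  shows "x \<in> qmap M v \<longleftrightarrow> x \<in> carrier M \<and> hnorm M (x \<ominus>\<^bsub>M\<^esub> v) = 0"
proof (cases "x \<in> carrier M")
  case True
  then show ?thesis
    using assms by (simp add: qmap_def null.a_rcos_module null_vecs_iff a_minus_def)
next
  case False
  then show ?thesis
    using assms null.a_elemrcos_carrier unfolding qmap_def by blast
qed

lemma mem_qmap_self: "v \<in> carrier M \<Longrightarrow> v \<in> qmap M v"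
  unfolding qmap_def by (rule null.a_rcos_self)

lemma qmap_eq:
  assumes "v \<in> carrier M" "x \<in> qmap M v"
  shows "qmap M x = qmap M v"
  using null.a_repr_independence'[OF assms(2)[unfolded qmap_def] assms(1)] unfolding qmap_def by (rule sym)

text \<open>
  By the Cauchy-Schwarz inequality a null vector is orthogonal to every vector, so changing a
  representative does not change the form.
\<close>

lemma sprod_cong_qmap:
  assumes v: "v \<in> carrier M" and w: "w \<in> carrier M" and x: "x \<in> qmap M v" and y: "y \<in> qmap M w"
  shows "sprod M x y = sprod M v w"
proof -
  have xc: "x \<in> carrier M" "hnorm M (x \<ominus>\<^bsub>M\<^esub> v) = 0" and yc: "y \<in> carrier M" "hnorm M (y \<ominus>\<^bsub>M\<^esub> w) = 0"
    using assms by (simp_all add: mem_qmap_iff)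
  have "sprod M x y - sprod M v w = sprod M (x \<ominus>\<^bsub>M\<^esub> v) y + sprod M v (y \<ominus>\<^bsub>M\<^esub> w)"
    using v w xc yc by (simp add: sprod_diff_left sprod_diff_right)
  moreover have "sprod M (x \<ominus>\<^bsub>M\<^esub> v) y = 0" "sprod M v (y \<ominus>\<^bsub>M\<^esub> w) = 0"
    using cauchy_schwarz[of "x \<ominus>\<^bsub>M\<^esub> v" y] cauchy_schwarz[of v "y \<ominus>\<^bsub>M\<^esub> w"] v w xc yc by simp_all
  ultimately show ?thesis by simp
qed

lemma carrier_hquot: "carrier (hquot M) = qmap M ` carrier M"
  by (auto simp: hquot_def qmap_def A_RCOSETS_def')

lemma zero_hquot: "\<zero>\<^bsub>hquot M\<^esub> = qmap M \<zero>\<^bsub>M\<^esub>"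
  using null.a_subset by (simp add: hquot_def qmap_def M.a_coset_add_zero)

lemma add_hquot:
  assumes "v \<in> carrier M" "w \<in> carrier M"
  shows "qmap M v \<oplus>\<^bsub>hquot M\<^esub> qmap M w = qmap M (v \<oplus>\<^bsub>M\<^esub> w)"
  using assms by (simp add: hquot_def qmap_def null.a_rcos_sum)

lemma smult_hquot:
  assumes v: "v \<in> carrier M"
  shows "c \<odot>\<^bsub>hquot M\<^esub> qmap M v = qmap M (c \<odot>\<^bsub>M\<^esub> v)"
proof -
  have eq: "qmap M (c \<odot>\<^bsub>M\<^esub> x) = qmap M (c \<odot>\<^bsub>M\<^esub> v)" if "x \<in> qmap M v" for x
  proof (rule qmap_eq)
    have "x \<in> carrier M" "hnorm M (x \<ominus>\<^bsub>M\<^esub> v) = 0" using that v by (simp_all add: mem_qmap_iff)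
    moreover have "c \<odot>\<^bsub>M\<^esub> x \<ominus>\<^bsub>M\<^esub> c \<odot>\<^bsub>M\<^esub> v = c \<odot>\<^bsub>M\<^esub> (x \<ominus>\<^bsub>M\<^esub> v)"
      using calculation v by (simp add: diff_as_scale scale_add_right scale_scale)
    ultimately show "c \<odot>\<^bsub>M\<^esub> x \<in> qmap M (c \<odot>\<^bsub>M\<^esub> v)"
      using v by (simp add: mem_qmap_iff hnorm_smult)
  qed (use v in simp)
  have "(\<Union>x\<in>qmap M v. qmap M (c \<odot>\<^bsub>M\<^esub> x)) = qmap M (c \<odot>\<^bsub>M\<^esub> v)"
    using mem_qmap_self[OF v] by (intro SUP_eq_const[OF _ eq]) blast+
  then show ?thesis by (simp add: hquot_def qmap_def)
qed

lemma sprod_hquot: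
  assumes v: "v \<in> carrier M" and w: "w \<in> carrier M"
  shows "sprod (hquot M) (qmap M v) (qmap M w) = sprod M v w"
proof -
  have "(\<Union>a\<in>qmap M v. \<Union>b\<in>qmap M w. {sprod M a b}) = (\<Union>a\<in>qmap M v. \<Union>b\<in>qmap M w. {sprod M v w})"
    by (intro SUP_cong[OF refl] arg_cong[where f = "\<lambda>z. {z}"] sprod_cong_qmap[OF v w])
  also have "\<dots> = {sprod M v w}"
    using mem_qmap_self[OF v] mem_qmap_self[OF w] by auto
  finally have "(\<Union>a\<in>qmap M v. \<Union>b\<in>qmap M w. {sprod M a b}) = {sprod M v w}" .
  then show ?thesis by (simp add: hquot_def)
qed

lemma act_hquot:
  assumes g: "g \<in> carrier G" and v: "v \<in> carrier M"
  shows "act (hquot M) g (qmap M v) = qmap M (act M g v)"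
proof -
  have eq: "qmap M (act M g x) = qmap M (act M g v)" if "x \<in> qmap M v" for x
  proof (rule qmap_eq)
    have "x \<in> carrier M" "hnorm M (x \<ominus>\<^bsub>M\<^esub> v) = 0" using that v by (simp_all add: mem_qmap_iff)
    then show "act M g x \<in> qmap M (act M g v)"
      using g v by (simp add: mem_qmap_iff flip: act_diff)
  qed (use g v in simp)
  have "(\<Union>x\<in>qmap M v. qmap M (act M g x)) = qmap M (act M g v)"
    using mem_qmap_self[OF v] by (intro SUP_eq_const[OF _ eq]) blast+
  then show ?thesis by (simp add: hquot_def qmap_def)
qed

lemma unitary_module_hquot: "unitary_module G (hquot M)"
  by (rule unitary_module_image[OF unitary_module_axioms carrier_hquot zero_hquot
        add_hquot smult_hquot sprod_hquot act_hquot])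

end

subsection \<open>Completion\<close>

lemma cauchy_seqsD:
  assumes "s \<in> carrier (cauchy_seqs M)" "0 < e"
  shows "\<exists>k. \<forall>m\<ge>k. \<forall>n\<ge>k. hnorm M (s m \<ominus>\<^bsub>M\<^esub> s n) < e"
  using assms by (simp add: cauchy_seqs_def)

lemma (in unitary_module) cauchy_seqs_sprod_convergent:
  assumes s: "s \<in> carrier (cauchy_seqs M)" and t: "t \<in> carrier (cauchy_seqs M)"
  shows "(\<lambda>n. sprod M (s n) (t n)) \<longlonglongrightarrow> sprod (cauchy_seqs M) s t"
proof -
  have cs: "s n \<in> carrier M" "t n \<in> carrier M" for n using s t by (auto simp: cauchy_seqs_def)
  have bounded: "\<exists>B>0. \<forall>n. hnorm M (u n) \<le> B" if u: "u \<in> carrier (cauchy_seqs M)" for u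
  proof -
    have cu: "u n \<in> carrier M" for n using u by (auto simp: cauchy_seqs_def)
    obtain k where k [rule_format]: "\<forall>m\<ge>k. \<forall>n\<ge>k. hnorm M (u m \<ominus>\<^bsub>M\<^esub> u n) < 1"
      using cauchy_seqsD[OF u, of 1] by auto
    have tail: "hnorm M (u n) \<le> 1 + hnorm M (u k)" if "n \<ge> k" for n
    proof -
      have "(u n \<ominus>\<^bsub>M\<^esub> u k) \<oplus>\<^bsub>M\<^esub> u k = u n"
        using cu by (simp add: a_minus_def M.a_assoc M.l_neg)
      then have "hnorm M (u n) \<le> hnorm M (u n \<ominus>\<^bsub>M\<^esub> u k) + hnorm M (u k)"
        using hnorm_triangle[of "u n \<ominus>\<^bsub>M\<^esub> u k" "u k"] cu by simp
      then show ?thesis using k[OF that order_refl] by simp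
    qed
    let ?B = "1 + (\<Sum>i\<le>k. hnorm M (u i))"
    have le: "hnorm M (u i) \<le> (\<Sum>i\<le>k. hnorm M (u i))" if "i \<le> k" for i
      using that cu by (intro member_le_sum) auto
    have "0 \<le> (\<Sum>i\<le>k. hnorm M (u i))" using cu by (intro sum_nonneg) auto
    moreover have "hnorm M (u n) \<le> ?B" for n
    proof (cases "n \<le> k")
      case True
      then show ?thesis using le[OF True] by simp
    next
      case False
      then show ?thesis using tail[of n] le[of k] by simp
    qed
    ultimately show ?thesis by (intro exI[of _ ?B]) auto
  qed
  obtain A where A: "A > 0" "\<And>n. hnorm M (s n) \<le> A" using bounded[OF s] by auto
  obtain B where B: "B > 0" "\<And>n. hnorm M (t n) \<le> B" using bounded[OF t] by auto
  have "Cauchy (\<lambda>n. sprod M (s n) (t n))"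
  proof (rule CauchyI)
    fix e :: real assume "0 < e"
    define e' where "e' = e / (A + B)"
    have "0 < e'" "e' * (A + B) = e"
      using \<open>0 < e\<close> A(1) B(1) by (auto simp: e'_def)
    then have e': "0 < e'" "e' * B + A * e' = e" by (auto simp: algebra_simps)
    obtain k where k [rule_format]: "\<forall>m\<ge>k. \<forall>n\<ge>k. hnorm M (s m \<ominus>\<^bsub>M\<^esub> s n) < e'"
      using cauchy_seqsD[OF s e'(1)] by auto
    obtain l where l [rule_format]: "\<forall>m\<ge>l. \<forall>n\<ge>l. hnorm M (t m \<ominus>\<^bsub>M\<^esub> t n) < e'"
      using cauchy_seqsD[OF t e'(1)] by auto
    show "\<exists>M'. \<forall>m\<ge>M'. \<forall>n\<ge>M'. cmod (sprod M (s m) (t m) - sprod M (s n) (t n)) < e"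
    proof (intro exI allI impI)
      fix m n assume m: "max k l \<le> m" and n: "max k l \<le> n"
      have "sprod M (s m) (t m) - sprod M (s n) (t n)
          = sprod M (s m \<ominus>\<^bsub>M\<^esub> s n) (t m) + sprod M (s n) (t m \<ominus>\<^bsub>M\<^esub> t n)"
        using cs by (simp add: sprod_diff_left sprod_diff_right)
      also have "cmod \<dots> \<le> hnorm M (s m \<ominus>\<^bsub>M\<^esub> s n) * hnorm M (t m) + hnorm M (s n) * hnorm M (t m \<ominus>\<^bsub>M\<^esub> t n)"
        using cs by (intro order_trans[OF norm_triangle_ineq] add_mono cauchy_schwarz) auto
      also have "\<dots> < e' * B + A * e'"
      proof (rule add_less_le_mono)
        have "hnorm M (s m \<ominus>\<^bsub>M\<^esub> s n) * hnorm M (t m) \<le> hnorm M (s m \<ominus>\<^bsub>M\<^esub> s n) * B"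
          using cs B(2) by (intro mult_left_mono) auto
        also have "\<dots> < e' * B" using k[of m n] m n B(1) by simp
        finally show "hnorm M (s m \<ominus>\<^bsub>M\<^esub> s n) * hnorm M (t m) < e' * B" .
        show "hnorm M (s n) * hnorm M (t m \<ominus>\<^bsub>M\<^esub> t n) \<le> A * e'"
          using cs A l[of m n] m n by (intro mult_mono) (auto intro: less_imp_le)
      qed
      finally show "cmod (sprod M (s m) (t m) - sprod M (s n) (t n)) < e" by (simp only: e')
    qed
  qed
  then show ?thesis
    by (simp add: cauchy_seqs_def Cauchy_convergent_iff convergent_LIMSEQ_iff)
qed

context unitary_module
begin

lemma cauchy_seqs_carrierI:
  assumes s: "\<And>n. s n \<in> carrier M"
    and ev: "\<And>e. 0 < e \<Longrightarrow> \<exists>k. \<forall>m\<ge>k. \<forall>n\<ge>k. hnorm M (s m \<ominus>\<^bsub>M\<^esub> s n) < e"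
  shows "s \<in> carrier (cauchy_seqs M)"
  using assms by (simp add: cauchy_seqs_def)

lemma const_in_cauchy_seqs: "v \<in> carrier M \<Longrightarrow> (\<lambda>n. v) \<in> carrier (cauchy_seqs M)"
  by (rule cauchy_seqs_carrierI) (simp_all add: M.r_neg a_minus_def hnorm_def)

lemma unitary_module_cauchy_seqs: "unitary_module G (cauchy_seqs M)"
proof (rule unitary_module_limit[where M = "\<lambda>n. M" and F = sequentially])
  let ?C = "cauchy_seqs M"
  have cs: "s n \<in> carrier M" if "s \<in> carrier ?C" for s n
    using that by (auto simp: cauchy_seqs_def)
  show "\<zero>\<^bsub>?C\<^esub> \<in> carrier ?C"
    using const_in_cauchy_seqs[of "\<zero>\<^bsub>M\<^esub>"] by (simp add: cauchy_seqs_def)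
  show "s \<oplus>\<^bsub>?C\<^esub> t \<in> carrier ?C" if s: "s \<in> carrier ?C" and t: "t \<in> carrier ?C" for s t
  proof (rule cauchy_seqs_carrierI)
    show "(s \<oplus>\<^bsub>?C\<^esub> t) n \<in> carrier M" for n using cs s t by (simp add: cauchy_seqs_def)
    fix e :: real assume "0 < e"
    then have e2: "0 < e / 2" by simp
    obtain k where k [rule_format]: "\<forall>m\<ge>k. \<forall>n\<ge>k. hnorm M (s m \<ominus>\<^bsub>M\<^esub> s n) < e / 2"
      using cauchy_seqsD[OF s e2] by auto
    obtain l where l [rule_format]: "\<forall>m\<ge>l. \<forall>n\<ge>l. hnorm M (t m \<ominus>\<^bsub>M\<^esub> t n) < e / 2"
      using cauchy_seqsD[OF t e2] by auto
    show "\<exists>k. \<forall>m\<ge>k. \<forall>n\<ge>k. hnorm M ((s \<oplus>\<^bsub>?C\<^esub> t) m \<ominus>\<^bsub>M\<^esub> (s \<oplus>\<^bsub>?C\<^esub> t) n) < e"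
    proof (intro exI allI impI)
      fix m n assume m: "max k l \<le> m" and n: "max k l \<le> n"
      have "(s m \<oplus>\<^bsub>M\<^esub> t m) \<ominus>\<^bsub>M\<^esub> (s n \<oplus>\<^bsub>M\<^esub> t n) = (s m \<ominus>\<^bsub>M\<^esub> s n) \<oplus>\<^bsub>M\<^esub> (t m \<ominus>\<^bsub>M\<^esub> t n)"
        using cs[OF s] cs[OF t]
        by (simp add: diff_as_scale scale_add_right M.a_assoc M.a_comm M.a_lcomm)
      then have "hnorm M ((s m \<oplus>\<^bsub>M\<^esub> t m) \<ominus>\<^bsub>M\<^esub> (s n \<oplus>\<^bsub>M\<^esub> t n))
          \<le> hnorm M (s m \<ominus>\<^bsub>M\<^esub> s n) + hnorm M (t m \<ominus>\<^bsub>M\<^esub> t n)"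
        using hnorm_triangle[of "s m \<ominus>\<^bsub>M\<^esub> s n" "t m \<ominus>\<^bsub>M\<^esub> t n"] cs[OF s] cs[OF t] by simp
      then show "hnorm M ((s \<oplus>\<^bsub>?C\<^esub> t) m \<ominus>\<^bsub>M\<^esub> (s \<oplus>\<^bsub>?C\<^esub> t) n) < e"
        using k[of m n] l[of m n] m n by (simp add: cauchy_seqs_def)
    qed
  qed
  show "c \<odot>\<^bsub>?C\<^esub> s \<in> carrier ?C" if s: "s \<in> carrier ?C" for c s
  proof (rule cauchy_seqs_carrierI)
    show "(c \<odot>\<^bsub>?C\<^esub> s) n \<in> carrier M" for n using cs s by (simp add: cauchy_seqs_def)
    fix e :: real assume "0 < e"
    then have ec: "0 < e / (cmod c + 1)" by (simp add: add_nonneg_pos)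
    obtain k where k [rule_format]: "\<forall>m\<ge>k. \<forall>n\<ge>k. hnorm M (s m \<ominus>\<^bsub>M\<^esub> s n) < e / (cmod c + 1)"
      using cauchy_seqsD[OF s ec] by auto
    show "\<exists>k. \<forall>m\<ge>k. \<forall>n\<ge>k. hnorm M ((c \<odot>\<^bsub>?C\<^esub> s) m \<ominus>\<^bsub>M\<^esub> (c \<odot>\<^bsub>?C\<^esub> s) n) < e"
    proof (intro exI allI impI)
      fix m n assume m: "k \<le> m" and n: "k \<le> n"
      have "c \<odot>\<^bsub>M\<^esub> s m \<ominus>\<^bsub>M\<^esub> c \<odot>\<^bsub>M\<^esub> s n = c \<odot>\<^bsub>M\<^esub> (s m \<ominus>\<^bsub>M\<^esub> s n)"
        using cs[OF s] by (simp add: diff_as_scale scale_add_right scale_scale)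
      then have "hnorm M ((c \<odot>\<^bsub>?C\<^esub> s) m \<ominus>\<^bsub>M\<^esub> (c \<odot>\<^bsub>?C\<^esub> s) n) = cmod c * hnorm M (s m \<ominus>\<^bsub>M\<^esub> s n)"
        using cs[OF s] by (simp add: cauchy_seqs_def hnorm_smult)
      also have "\<dots> \<le> (cmod c + 1) * hnorm M (s m \<ominus>\<^bsub>M\<^esub> s n)"
        using cs[OF s] by (intro mult_right_mono) auto
      also have "\<dots> < e"
        using k[OF m n] by (simp add: add_nonneg_pos pos_less_divide_eq mult.commute)
      finally show "hnorm M ((c \<odot>\<^bsub>?C\<^esub> s) m \<ominus>\<^bsub>M\<^esub> (c \<odot>\<^bsub>?C\<^esub> s) n) < e" .
    qed
  qed
  show "act ?C g s \<in> carrier ?C" if "g \<in> carrier G" "s \<in> carrier ?C" for g s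
    using that by (auto simp: cauchy_seqs_def simp flip: act_diff)
  show "(\<lambda>n. sprod M (s n) (t n)) \<longlonglongrightarrow> sprod ?C s t" if "s \<in> carrier ?C" "t \<in> carrier ?C" for s t
    using that by (rule cauchy_seqs_sprod_convergent)
qed (auto simp: cauchy_seqs_def unitary_module_axioms)

lemma unitary_module_completion: "unitary_module G (completion M)"
  unfolding completion_def by (rule unitary_module.unitary_module_hquot[OF unitary_module_cauchy_seqs])

interpretation cauchy: unitary_module G "cauchy_seqs M"
  by (rule unitary_module_cauchy_seqs)

lemma to_completion_closed: "v \<in> carrier M \<Longrightarrow> to_completion M v \<in> carrier (completion M)"
  unfolding completion_def to_completion_def cauchy.carrier_hquot using const_in_cauchy_seqs by blast

lemma sprod_completion:
  assumes "v \<in> carrier M" "w \<in> carrier M"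
  shows "sprod (completion M) (to_completion M v) (to_completion M w) = sprod M v w"
  using assms unfolding completion_def to_completion_def
  by (subst cauchy.sprod_hquot) (simp_all add: const_in_cauchy_seqs, simp add: cauchy_seqs_def)

lemma add_completion:
  assumes "v \<in> carrier M" "w \<in> carrier M"
  shows "to_completion M v \<oplus>\<^bsub>completion M\<^esub> to_completion M w = to_completion M (v \<oplus>\<^bsub>M\<^esub> w)"
  using assms unfolding completion_def to_completion_def
  by (subst cauchy.add_hquot) (simp_all add: const_in_cauchy_seqs, simp add: cauchy_seqs_def)

lemma smult_completion:
  assumes "v \<in> carrier M"
  shows "c \<odot>\<^bsub>completion M\<^esub> to_completion M v = to_completion M (c \<odot>\<^bsub>M\<^esub> v)"
  using assms unfolding completion_def to_completion_def
  by (subst cauchy.smult_hquot) (simp_all add: const_in_cauchy_seqs, simp add: cauchy_seqs_def)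

lemma zero_completion: "\<zero>\<^bsub>completion M\<^esub> = to_completion M \<zero>\<^bsub>M\<^esub>"
  unfolding completion_def to_completion_def cauchy.zero_hquot by (simp add: cauchy_seqs_def)

lemma act_completion:
  assumes "g \<in> carrier G" "v \<in> carrier M"
  shows "act (completion M) g (to_completion M v) = to_completion M (act M g v)"
  using assms unfolding completion_def to_completion_def
  by (subst cauchy.act_hquot) (simp_all add: const_in_cauchy_seqs, simp add: cauchy_seqs_def)

end

subsection \<open>Closures of invariant submodules\<close>

context unitary_module
begin

lemma hclosure_carrier: "v \<in> hclosure M S \<Longrightarrow> v \<in> carrier M"
  by (simp add: hclosure_def)

lemma hclosureE:
  assumes "v \<in> hclosure M S" "0 < e"
  obtains s where "s \<in> S" "hnorm M (v \<ominus>\<^bsub>M\<^esub> s) < e"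
  using assms unfolding hclosure_def by auto

lemma hclosure_seq:
  assumes S: "S \<subseteq> carrier M" and v: "v \<in> hclosure M S"
  shows "\<exists>s. (\<forall>n. s n \<in> S) \<and> (\<lambda>n. hnorm M (v \<ominus>\<^bsub>M\<^esub> s n)) \<longlonglongrightarrow> 0"
proof -
  have "\<exists>s\<in>S. hnorm M (v \<ominus>\<^bsub>M\<^esub> s) < inverse (real (Suc n))" for n
    using v by (simp add: hclosure_def)
  then obtain s where s: "\<And>n. s n \<in> S" "\<And>n. hnorm M (v \<ominus>\<^bsub>M\<^esub> s n) < inverse (real (Suc n))"
    by metis
  have "(\<lambda>n. hnorm M (v \<ominus>\<^bsub>M\<^esub> s n)) \<longlonglongrightarrow> 0"
  proof (rule tendsto_sandwich[OF always_eventually always_eventually tendsto_const LIMSEQ_inverse_real_of_nat])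
    show "\<forall>n. 0 \<le> hnorm M (v \<ominus>\<^bsub>M\<^esub> s n)"
      using hclosure_carrier[OF v] S s(1) by (auto intro!: hnorm_nonneg)
    show "\<forall>n. hnorm M (v \<ominus>\<^bsub>M\<^esub> s n) \<le> inverse (real (Suc n))"
      using less_imp_le[OF s(2)] by blast
  qed
  with s(1) show ?thesis by blast
qed

lemma submodule_hclosure:
  assumes S: "submodule class_ring S M"
  shows "submodule class_ring (hclosure M S) M"
proof (rule submodule.intro)
  have sub: "s \<in> carrier M" if "s \<in> S" for s using submodule.subset[OF S] that by auto
  show "module class_ring M" by (rule module_axioms)
  show "hclosure M S \<subseteq> carrier M" by (auto simp: hclosure_def)
  have "\<zero>\<^bsub>M\<^esub> \<in> S" by (rule submodule.zero_closed[OF S])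
  then show "\<zero>\<^bsub>M\<^esub> \<in> hclosure M S"
    by (auto simp: hclosure_def diff_as_scale hnorm_def intro!: bexI[of _ "\<zero>\<^bsub>M\<^esub>"])
  fix v assume v: "v \<in> hclosure M S"
  note vc = hclosure_carrier[OF v]
  show "v \<oplus>\<^bsub>M\<^esub> w \<in> hclosure M S" if w: "w \<in> hclosure M S" for w
    unfolding hclosure_def
  proof (intro CollectI conjI allI impI)
    note wc = hclosure_carrier[OF w]
    show "v \<oplus>\<^bsub>M\<^esub> w \<in> carrier M" using vc wc by simp
    fix e :: real assume "0 < e"
    then have e2: "0 < e / 2" by simp
    obtain s where s: "s \<in> S" "hnorm M (v \<ominus>\<^bsub>M\<^esub> s) < e / 2" using hclosureE[OF v e2] .
    obtain t where t: "t \<in> S" "hnorm M (w \<ominus>\<^bsub>M\<^esub> t) < e / 2" using hclosureE[OF w e2] .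
    have "(v \<oplus>\<^bsub>M\<^esub> w) \<ominus>\<^bsub>M\<^esub> (s \<oplus>\<^bsub>M\<^esub> t) = (v \<ominus>\<^bsub>M\<^esub> s) \<oplus>\<^bsub>M\<^esub> (w \<ominus>\<^bsub>M\<^esub> t)"
      using vc wc sub[OF s(1)] sub[OF t(1)]
      by (simp add: diff_as_scale scale_add_right M.a_assoc M.a_comm M.a_lcomm)
    then have "hnorm M ((v \<oplus>\<^bsub>M\<^esub> w) \<ominus>\<^bsub>M\<^esub> (s \<oplus>\<^bsub>M\<^esub> t)) < e"
      using hnorm_triangle[of "v \<ominus>\<^bsub>M\<^esub> s" "w \<ominus>\<^bsub>M\<^esub> t"] vc wc sub[OF s(1)] sub[OF t(1)] s(2) t(2) by simp
    moreover have "s \<oplus>\<^bsub>M\<^esub> t \<in> S" using s(1) t(1) by (rule submodule.m_closed[OF S])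
    ultimately show "\<exists>s\<in>S. hnorm M ((v \<oplus>\<^bsub>M\<^esub> w) \<ominus>\<^bsub>M\<^esub> s) < e" by blast
  qed
  show "c \<odot>\<^bsub>M\<^esub> v \<in> hclosure M S" for c
    unfolding hclosure_def
  proof (intro CollectI conjI allI impI)
    show "c \<odot>\<^bsub>M\<^esub> v \<in> carrier M" using vc by simp
    fix e :: real assume "0 < e"
    then have ec: "0 < e / (cmod c + 1)" by (simp add: add_nonneg_pos)
    obtain s where s: "s \<in> S" "hnorm M (v \<ominus>\<^bsub>M\<^esub> s) < e / (cmod c + 1)" using hclosureE[OF v ec] .
    have "c \<odot>\<^bsub>M\<^esub> v \<ominus>\<^bsub>M\<^esub> c \<odot>\<^bsub>M\<^esub> s = c \<odot>\<^bsub>M\<^esub> (v \<ominus>\<^bsub>M\<^esub> s)"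
      using vc sub[OF s(1)] by (simp add: diff_as_scale scale_add_right scale_scale)
    then have "hnorm M (c \<odot>\<^bsub>M\<^esub> v \<ominus>\<^bsub>M\<^esub> c \<odot>\<^bsub>M\<^esub> s) = cmod c * hnorm M (v \<ominus>\<^bsub>M\<^esub> s)"
      using vc sub[OF s(1)] by (simp add: hnorm_smult)
    also have "\<dots> \<le> (cmod c + 1) * hnorm M (v \<ominus>\<^bsub>M\<^esub> s)"
      using vc sub[OF s(1)] by (intro mult_right_mono) auto
    also have "\<dots> < e"
      using s(2) by (simp add: add_nonneg_pos pos_less_divide_eq mult.commute)
    finally show "\<exists>s\<in>S. hnorm M (c \<odot>\<^bsub>M\<^esub> v \<ominus>\<^bsub>M\<^esub> s) < e"
      using submodule.smult_closed[OF S, of c s] s(1) by auto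
  qed
qed

lemma hclosure_invariant:
  assumes S: "S \<subseteq> carrier M" and g: "g \<in> carrier G" and inv: "act M g ` S \<subseteq> S"
  shows "act M g ` hclosure M S \<subseteq> hclosure M S"
proof (clarify)
  fix v assume v: "v \<in> hclosure M S"
  note vc = hclosure_carrier[OF v]
  show "act M g v \<in> hclosure M S"
    unfolding hclosure_def
  proof (intro CollectI conjI allI impI)
    show "act M g v \<in> carrier M" using g vc by simp
    fix e :: real assume "0 < e"
    obtain s where s: "s \<in> S" "hnorm M (v \<ominus>\<^bsub>M\<^esub> s) < e" using hclosureE[OF v \<open>0 < e\<close>] .
    have "hnorm M (act M g v \<ominus>\<^bsub>M\<^esub> act M g s) = hnorm M (v \<ominus>\<^bsub>M\<^esub> s)"
      using g vc S s(1) by (subst act_diff[symmetric]) auto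
    then show "\<exists>s\<in>S. hnorm M (act M g v \<ominus>\<^bsub>M\<^esub> s) < e" using s inv by force
  qed
qed

text \<open>
  Both sides of the spectral gap are continuous, so a gap on a set extends to its closure.
\<close>

lemma displacement_hclosure:
  assumes S: "S \<subseteq> carrier M" and F: "F \<subseteq> carrier G"
    and gap: "\<And>s. s \<in> S \<Longrightarrow> \<delta> * (hnorm M s)\<^sup>2 \<le> displacement M F s"
    and v: "v \<in> hclosure M S"
  shows "\<delta> * (hnorm M v)\<^sup>2 \<le> displacement M F v"
proof -
  note vc = hclosure_carrier[OF v]
  obtain s where s: "\<And>n. s n \<in> S" and lim: "(\<lambda>n. hnorm M (v \<ominus>\<^bsub>M\<^esub> s n)) \<longlonglongrightarrow> 0"
    using hclosure_seq[OF S v] by blast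
  have sc: "s n \<in> carrier M" for n using s S by auto
  have norm: "(\<lambda>n. (hnorm M (s n))\<^sup>2) \<longlonglongrightarrow> (hnorm M v)\<^sup>2"
    using tendsto_Re[OF tendsto_sprod[OF sc sc vc vc lim lim]] sc vc by (simp add: hnorm_sq)
  have coeff: "(\<lambda>n. Re (sprod M (act M g (s n)) (s n))) \<longlonglongrightarrow> Re (sprod M (act M g v) v)"
    if "g \<in> F" for g
  proof (intro tendsto_Re tendsto_sprod vc sc)
    have g: "g \<in> carrier G" using that F by auto
    show "act M g (s n) \<in> carrier M" for n using g sc by simp
    show "act M g v \<in> carrier M" using g vc by simp
    show "(\<lambda>n. hnorm M (act M g v \<ominus>\<^bsub>M\<^esub> act M g (s n))) \<longlonglongrightarrow> 0"
      using lim g vc sc by (simp flip: act_diff)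
  qed (rule lim)
  have "(\<lambda>n. displacement M F (s n)) \<longlonglongrightarrow> displacement M F v"
    unfolding displacement_eq[OF F vc] displacement_eq[OF F sc]
    by (intro tendsto_sum tendsto_diff tendsto_mult_left norm coeff)
  then show ?thesis
    by (rule LIMSEQ_le[OF tendsto_mult_left[OF norm]]) (auto intro: gap s)
qed

end

section \<open>Property \<open>(\<tau>)\<close> as a spectral gap for irreducible representations\<close>

lemma cn_rep_simps [simp]:
  "carrier (cn_rep d \<pi>) = carrier_vec d"
  "v \<oplus>\<^bsub>cn_rep d \<pi>\<^esub> w = v + w"
  "\<zero>\<^bsub>cn_rep d \<pi>\<^esub> = 0\<^sub>v d"
  "c \<odot>\<^bsub>cn_rep d \<pi>\<^esub> v = c \<cdot>\<^sub>v v"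
  "sprod (cn_rep d \<pi>) v w = v \<bullet>c w"
  "act (cn_rep d \<pi>) = \<pi>"
  by (simp_all add: cn_rep_def module.extend_def gspace.fields_def module_vec_def)

lemma cscalar_prod_sum:
  fixes v w :: "complex vec"
  shows "w \<in> carrier_vec d \<Longrightarrow> v \<bullet>c w = (\<Sum>i<d. v $ i * cnj (w $ i))"
  by (auto simp: scalar_prod_def lessThan_atLeast0)

lemma module_cn_rep: "module class_ring (cn_rep d \<pi>)"
proof (rule module_criteria[OF class_cring.cring_axioms])
  show "\<forall>v\<in>carrier (cn_rep d \<pi>). \<exists>w\<in>carrier (cn_rep d \<pi>). v \<oplus>\<^bsub>cn_rep d \<pi>\<^esub> w = \<zero>\<^bsub>cn_rep d \<pi>\<^esub>"
  proof
    fix v assume "v \<in> carrier (cn_rep d \<pi>)"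
    then show "\<exists>w\<in>carrier (cn_rep d \<pi>). v \<oplus>\<^bsub>cn_rep d \<pi>\<^esub> w = \<zero>\<^bsub>cn_rep d \<pi>\<^esub>"
      by (intro bexI[of _ "- v"]) auto
  qed
qed (auto simp: smult_smult_assoc add_smult_distrib_vec smult_add_distrib_vec comm_add_vec
    intro: assoc_add_vec)

lemma unitary_module_cn_rep:
  assumes "group G" "unitary_rep G (cn_rep d \<pi>)"
  shows "unitary_module G (cn_rep d \<pi>)"
proof (intro unitary_module.intro unitary_module_axioms.intro assms module_cn_rep)
  fix v w :: "complex vec" and c
  assume "v \<in> carrier (cn_rep d \<pi>)" and w: "w \<in> carrier (cn_rep d \<pi>)"
  then have vw: "v \<in> carrier_vec d" "w \<in> carrier_vec d" by simp_all
  then show "sprod (cn_rep d \<pi>) (u \<oplus>\<^bsub>cn_rep d \<pi>\<^esub> v) w = sprod (cn_rep d \<pi>) u w + sprod (cn_rep d \<pi>) v w"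
    if "u \<in> carrier (cn_rep d \<pi>)" for u
    using that by (simp add: cscalar_prod_sum[of w d] distrib_right sum.distrib)
  show "sprod (cn_rep d \<pi>) (c \<odot>\<^bsub>cn_rep d \<pi>\<^esub> v) w = c * sprod (cn_rep d \<pi>) v w"
    using vw by (simp add: cscalar_prod_sum[of w d] sum_distrib_left mult.assoc)
  show "cnj (sprod (cn_rep d \<pi>) v w) = sprod (cn_rep d \<pi>) w v"
    using vw by (simp add: cscalar_prod_sum[of _ d] mult.commute)
next
  fix v assume "v \<in> carrier (cn_rep d \<pi>)"
  then show "0 \<le> Re (sprod (cn_rep d \<pi>) v v)"
    by (simp add: cscalar_prod_sum[of v d] sum_nonneg)
qed

lemma fd_irreps_unitary_module: "group G \<Longrightarrow> Q \<in> fd_irreps G \<Longrightarrow> unitary_module G Q"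
  by (auto simp: fd_irreps_def unitary_module_cn_rep)

lemma self_in_fd_class: "Q \<in> fd_irreps G \<Longrightarrow> Q \<in> fd_class G Q"
proof -
  assume Q: "Q \<in> fd_irreps G"
  have "unitarily_equivalent G Q Q"
    unfolding unitarily_equivalent_def
    by (intro bexI[of _ id]) (auto simp: module_hom_def)
  with Q show ?thesis by (simp add: fd_class_def)
qed

lemma fd_class_trivial_imp_act_trivial:
  fixes G :: "('g, 'm) monoid_scheme"
  assumes Q: "Q \<in> fd_irreps G" and cls: "fd_class G Q = fd_class G trivial_rep"
    and g: "g \<in> carrier G" and v: "v \<in> carrier Q"
  shows "act Q g v = v"
proof -
  let ?t = "trivial_rep :: ('g, complex vec) gspace"
  have "unitarily_equivalent G ?t Q"
    using self_in_fd_class[OF Q] unfolding cls by (simp add: fd_class_def)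
  then obtain T where T: "bij_betw T (carrier ?t) (carrier Q)"
    "\<forall>g\<in>carrier G. \<forall>v\<in>carrier ?t. T (act ?t g v) = act Q g (T v)"
    unfolding unitarily_equivalent_def by blast
  obtain u where "u \<in> carrier ?t" "v = T u"
    using v T(1) by (auto simp: bij_betw_def)
  then show ?thesis using T(2) g by (simp add: trivial_rep_def)
qed

text \<open>
  Almost invariance is expressed through the matrix coefficient of a unit vector, since the Fell
  topology is given by matrix coefficients.
\<close>

definition almost_fixes :: "('g, 'v) gspace \<Rightarrow> 'g set \<Rightarrow> real \<Rightarrow> bool" where
  "almost_fixes Q F \<epsilon> \<longleftrightarrow> (\<exists>w\<in>carrier Q. sprod Q w w = 1 \<and> (\<forall>g\<in>F. cmod (pos_fun Q w g - 1) < \<epsilon>))"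

lemma almost_fixes_mono:
  "almost_fixes Q F \<epsilon> \<Longrightarrow> F' \<subseteq> F \<Longrightarrow> \<epsilon> \<le> \<epsilon>' \<Longrightarrow> almost_fixes Q F' \<epsilon>'"
  unfolding almost_fixes_def by (meson less_le_trans subsetD)

text \<open>
  On the trivial representation all functions of positive type are nonnegative constants, so a basic
  set containing its class only asks that certain constants \<open>c v \<ge> 0\<close> be approximated within \<open>e\<close>. If
  \<open>w\<close> is a unit vector of \<open>Q\<close> with coefficient close to \<open>1\<close> on \<open>F\<close>, the vector \<open>sqrt (c v) w\<close> has
  coefficient close to \<open>c v\<close>. There is room to spare because the approximations are strict and
  there are finitely many of them.
\<close>

lemma fell_nbhd_absorbs_almost_fixed:
  assumes G: "group G" and V: "finite V" and F: "finite F" "F \<subseteq> carrier G"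
    and triv: "fd_class G trivial_rep \<in> fd_class G ` fell_nbhd G P V F e"
  obtains \<epsilon> where "0 < \<epsilon>" "\<And>Q. Q \<in> fd_irreps G \<Longrightarrow> almost_fixes Q F \<epsilon> \<Longrightarrow> Q \<in> fell_nbhd G P V F e"
proof -
  obtain Q0 where Q0: "Q0 \<in> fell_nbhd G P V F e" "fd_class G Q0 = fd_class G trivial_rep"
    using triv by auto
  then have irr: "Q0 \<in> fd_irreps G" by (simp add: fell_nbhd_def)
  interpret Q0: unitary_module G Q0 using fd_irreps_unitary_module[OF G irr] .
  have fixed: "pos_fun Q0 w g = complex_of_real ((hnorm Q0 w)\<^sup>2)" if "g \<in> F" "w \<in> carrier Q0" for w g
    using fd_class_trivial_imp_act_trivial[OF irr Q0(2)] that F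
    by (simp add: pos_fun_def Q0.sprod_self subset_iff)
  have "\<exists>c\<ge>0. \<forall>g\<in>F. cmod (pos_fun P v g - complex_of_real c) < e" if "v \<in> V" for v
  proof -
    obtain ws where ws: "set ws \<subseteq> carrier Q0"
      "\<forall>g\<in>F. cmod (pos_fun P v g - (\<Sum>w\<leftarrow>ws. pos_fun Q0 w g)) < e"
      using Q0(1) \<open>v \<in> V\<close> by (auto simp: fell_nbhd_def)
    let ?c = "\<Sum>w\<leftarrow>ws. (hnorm Q0 w)\<^sup>2"
    have "(\<Sum>w\<leftarrow>ws. pos_fun Q0 w g) = complex_of_real ?c" if "g \<in> F" for g
      using ws(1) by (induction ws) (simp_all add: fixed[OF that])
    moreover have "0 \<le> ?c" by (intro sum_list_nonneg) auto
    ultimately show ?thesis using ws(2) by (intro exI[of _ ?c]) auto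
  qed
  then obtain c where c: "\<And>v. v \<in> V \<Longrightarrow> 0 \<le> c v"
    "\<And>v g. v \<in> V \<Longrightarrow> g \<in> F \<Longrightarrow> cmod (pos_fun P v g - complex_of_real (c v)) < e"
    by metis
  define s where "s v g = e - cmod (pos_fun P v g - complex_of_real (c v))" for v g
  have s: "0 < s v g" if "v \<in> V" "g \<in> F" for v g using c(2)[OF that] by (simp add: s_def)
  have "eventually (\<lambda>\<epsilon>. c v * \<epsilon> < s v g) (at_right 0)" if "v \<in> V" "g \<in> F" for v g
  proof -
    have "((\<lambda>\<epsilon>. c v * \<epsilon>) \<longlongrightarrow> c v * 0) (at_right 0)" by (intro tendsto_intros)
    then show ?thesis using order_tendstoD(2)[of _ "c v * 0"] s[OF that] by simp
  qed
  then have "eventually (\<lambda>\<epsilon>. \<forall>v\<in>V. \<forall>g\<in>F. c v * \<epsilon> < s v g) (at_right 0)"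
    using V F(1) by (simp add: eventually_ball_finite)
  then have "eventually (\<lambda>\<epsilon>. 0 < \<epsilon> \<and> (\<forall>v\<in>V. \<forall>g\<in>F. c v * \<epsilon> < s v g)) (at_right 0)"
    by (intro eventually_conj eventually_at_right_less)
  then obtain \<epsilon> where \<epsilon> [rule_format]: "0 < \<epsilon>" "\<forall>v\<in>V. \<forall>g\<in>F. c v * \<epsilon> < s v g"
    using eventually_happens'[OF trivial_limit_at_right_real] by blast
  show thesis
  proof (rule that[OF \<epsilon>(1)])
    fix Q assume Q: "Q \<in> fd_irreps G" "almost_fixes Q F \<epsilon>"
    interpret Q: unitary_module G Q using fd_irreps_unitary_module[OF G Q(1)] .
    obtain w where w: "w \<in> carrier Q" "\<And>g. g \<in> F \<Longrightarrow> cmod (pos_fun Q w g - 1) < \<epsilon>"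
      using Q(2) by (auto simp: almost_fixes_def)
    have "\<exists>ws. set ws \<subseteq> carrier Q \<and> (\<forall>g\<in>F. cmod (pos_fun P v g - (\<Sum>w\<leftarrow>ws. pos_fun Q w g)) < e)"
      if v: "v \<in> V" for v
    proof (intro exI conjI ballI)
      let ?r = "complex_of_real (sqrt (c v))"
      show "set [?r \<odot>\<^bsub>Q\<^esub> w] \<subseteq> carrier Q" using w by simp
      fix g assume g: "g \<in> F"
      have rr: "?r * ?r = complex_of_real (c v)"
        using c(1)[OF v] by (simp flip: of_real_mult)
      have "pos_fun Q (?r \<odot>\<^bsub>Q\<^esub> w) g = (?r * ?r) * pos_fun Q w g"
        using g F w(1) by (simp add: pos_fun_def Q.act_smult Q.sprod_smult_left Q.sprod_smult_right subset_iff)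
      then have "cmod (pos_fun P v g - (\<Sum>w\<leftarrow>[?r \<odot>\<^bsub>Q\<^esub> w]. pos_fun Q w g))
          = cmod ((pos_fun P v g - complex_of_real (c v)) - complex_of_real (c v) * (pos_fun Q w g - 1))"
        unfolding rr by (simp add: algebra_simps)
      also have "\<dots> \<le> cmod (pos_fun P v g - complex_of_real (c v)) + c v * cmod (pos_fun Q w g - 1)"
        using norm_triangle_ineq4[of "pos_fun P v g - complex_of_real (c v)"
            "complex_of_real (c v) * (pos_fun Q w g - 1)"] c(1)[OF v] by (simp add: norm_mult)
      also have "\<dots> \<le> cmod (pos_fun P v g - complex_of_real (c v)) + c v * \<epsilon>"
        using w(2)[OF g] c(1)[OF v] by (intro add_left_mono mult_left_mono) auto
      also have "\<dots> < e" using \<epsilon>(2)[OF v g] by (simp add: s_def)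
      finally show "cmod (pos_fun P v g - (\<Sum>w\<leftarrow>[?r \<odot>\<^bsub>Q\<^esub> w]. pos_fun Q w g)) < e" .
    qed
    then show "Q \<in> fell_nbhd G P V F e" using Q(1) by (simp add: fell_nbhd_def)
  qed
qed

text \<open>
  The open sets arise from the basic ones by finite intersections and arbitrary unions, and the
  property in question is stable under both.
\<close>

lemma fell_open_absorbs_almost_fixed:
  assumes G: "group G" and A: "openin (fell_topology G) A" and triv: "fd_class G trivial_rep \<in> A"
  shows "\<exists>F \<epsilon>. finite F \<and> F \<subseteq> carrier G \<and> 0 < \<epsilon> \<and>
    (\<forall>Q\<in>fd_irreps G. almost_fixes Q F \<epsilon> \<longrightarrow> fd_class G Q \<in> A)"
  using openin_topology_generated_by[OF A[unfolded fell_topology_def]] triv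
proof (induction rule: generate_topology_on.induct)
  case (Int A B)
  obtain F \<epsilon> where F: "finite F" "F \<subseteq> carrier G" "0 < \<epsilon>"
    "\<forall>Q\<in>fd_irreps G. almost_fixes Q F \<epsilon> \<longrightarrow> fd_class G Q \<in> A"
    using Int by auto
  obtain F' \<epsilon>' where F': "finite F'" "F' \<subseteq> carrier G" "0 < \<epsilon>'"
    "\<forall>Q\<in>fd_irreps G. almost_fixes Q F' \<epsilon>' \<longrightarrow> fd_class G Q \<in> B"
    using Int by auto
  have "fd_class G Q \<in> A \<inter> B" if "Q \<in> fd_irreps G" "almost_fixes Q (F \<union> F') (min \<epsilon> \<epsilon>')" for Q
    using that(1) F(4) F'(4) almost_fixes_mono[OF that(2)] by simp
  then show ?case
    using F F' by (intro exI[of _ "F \<union> F'"] exI[of _ "min \<epsilon> \<epsilon>'"]) auto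
next
  case (UN K)
  then obtain k where "k \<in> K" "fd_class G trivial_rep \<in> k" by blast
  then show ?case using UN.IH[of k] by blast
next
  case (Basis A)
  then obtain P V F e where A: "A = fd_class G ` fell_nbhd G P V F e" "finite V" "finite F" "F \<subseteq> carrier G"
    by blast
  obtain \<epsilon> where "0 < \<epsilon>" "\<And>Q. Q \<in> fd_irreps G \<Longrightarrow> almost_fixes Q F \<epsilon> \<Longrightarrow> Q \<in> fell_nbhd G P V F e"
    using fell_nbhd_absorbs_almost_fixed[OF G A(2,3,4) Basis(2)[unfolded A(1)]] by blast
  then show ?case using A by blast
qed simp

text \<open>
  The analogue of a Kazhdan pair in which only the irreducible finite-dimensional representations
  are tested.
\<close>

definition tau_pair :: "('g, 'm) monoid_scheme \<Rightarrow> 'g set \<Rightarrow> real \<Rightarrow> bool" where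
  "tau_pair G F \<epsilon> \<longleftrightarrow> finite F \<and> F \<subseteq> carrier G \<and> 0 < \<epsilon> \<and>
     (\<forall>Q\<in>fd_irreps G. almost_fixes Q F \<epsilon> \<longrightarrow> (\<forall>g\<in>carrier G. \<forall>v\<in>carrier Q. act Q g v = v))"

lemma tau_pairD:
  assumes "tau_pair G F \<epsilon>"
  shows "finite F" "F \<subseteq> carrier G" "0 < \<epsilon>"
    and "\<lbrakk>Q \<in> fd_irreps G; almost_fixes Q F \<epsilon>; g \<in> carrier G; v \<in> carrier Q\<rbrakk> \<Longrightarrow> act Q g v = v"
  using assms by (simp_all add: tau_pair_def)

text \<open>
  The hypothesis says that the class of the trivial representation is an open point, so an
  irreducible representation that almost fixes a vector lies in that class.
\<close>

lemma property_tau_imp_tau_pair: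
  assumes G: "group G" and tau: "property_tau G"
  shows "\<exists>F \<epsilon>. tau_pair G F \<epsilon>"
proof -
  obtain F \<epsilon> where F: "finite F" "F \<subseteq> carrier G" "0 < \<epsilon>"
    "\<forall>Q\<in>fd_irreps G. almost_fixes Q F \<epsilon> \<longrightarrow> fd_class G Q \<in> {fd_class G trivial_rep}"
    using fell_open_absorbs_almost_fixed[OF G tau[unfolded property_tau_def] singletonI]
    by (elim exE conjE) (rule that)
  have "act Q g v = v"
    if Q: "Q \<in> fd_irreps G" "almost_fixes Q F \<epsilon>" and gv: "g \<in> carrier G" "v \<in> carrier Q" for Q g v
  proof -
    have "fd_class G Q = fd_class G trivial_rep" using F(4) Q by simp
    then show ?thesis by (rule fd_class_trivial_imp_act_trivial[OF Q(1) _ gv])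
  qed
  with F(1-3) have "tau_pair G F \<epsilon>" unfolding tau_pair_def by blast
  then show ?thesis by blast
qed

section \<open>Finite-dimensional representations\<close>

subsection \<open>Orthonormal systems\<close>

definition orthonormal :: "('g, 'v) gspace \<Rightarrow> nat \<Rightarrow> (nat \<Rightarrow> 'v) \<Rightarrow> bool" where
  "orthonormal M k e \<longleftrightarrow> (\<forall>i<k. e i \<in> carrier M) \<and>
     (\<forall>i<k. \<forall>j<k. sprod M (e i) (e j) = (if i = j then 1 else 0))"

definition lin_comb :: "('g, 'v) gspace \<Rightarrow> nat \<Rightarrow> (nat \<Rightarrow> 'v) \<Rightarrow> (nat \<Rightarrow> complex) \<Rightarrow> 'v" where
  "lin_comb M k e c = (\<Oplus>\<^bsub>M\<^esub>i\<in>{..<k}. c i \<odot>\<^bsub>M\<^esub> e i)"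

abbreviation fourier :: "('g, 'v) gspace \<Rightarrow> nat \<Rightarrow> (nat \<Rightarrow> 'v) \<Rightarrow> 'v \<Rightarrow> 'v" where
  "fourier M k e v \<equiv> lin_comb M k e (\<lambda>i. sprod M v (e i))"

context unitary_module
begin

lemma add_diff_cancel: "\<lbrakk>v \<in> carrier M; w \<in> carrier M\<rbrakk> \<Longrightarrow> w \<oplus>\<^bsub>M\<^esub> (v \<ominus>\<^bsub>M\<^esub> w) = v"
  by (simp add: a_minus_def M.a_comm M.a_lcomm M.r_neg)

lemma orthonormal_carrier: "orthonormal M k e \<Longrightarrow> i < k \<Longrightarrow> e i \<in> carrier M"
  by (simp add: orthonormal_def)

lemma orthonormal_sprod:
  "orthonormal M k e \<Longrightarrow> i < k \<Longrightarrow> j < k \<Longrightarrow> sprod M (e i) (e j) = (if i = j then 1 else 0)"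
  by (simp add: orthonormal_def)

lemma lin_comb_closed:
  assumes "orthonormal M k e"
  shows "lin_comb M k e c \<in> carrier M"
  unfolding lin_comb_def using assms by (intro M.finsum_closed) (auto simp: orthonormal_def)

lemma lin_comb_in_submodule:
  assumes W: "submodule class_ring W M" and e: "\<And>i. i < k \<Longrightarrow> e i \<in> W"
  shows "lin_comb M k e c \<in> W"
proof -
  have sub: "w \<in> carrier M" if "w \<in> W" for w using submodule.subset[OF W] that by auto
  have "finite A \<Longrightarrow> A \<subseteq> {..<k} \<Longrightarrow> (\<Oplus>\<^bsub>M\<^esub>i\<in>A. c i \<odot>\<^bsub>M\<^esub> e i) \<in> W" for A
  proof (induction A rule: finite_induct)
    case empty
    then show ?case by (simp add: submodule.zero_closed[OF W])
  next
    case (insert i A)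
    then have "(\<lambda>i. c i \<odot>\<^bsub>M\<^esub> e i) \<in> A \<rightarrow> carrier M" "c i \<odot>\<^bsub>M\<^esub> e i \<in> W"
      using e sub submodule.smult_closed[OF W, of "c i" "e i"] by auto
    then show ?case
      using insert sub submodule.m_closed[OF W] by (simp add: M.finsum_insert)
  qed
  then show ?thesis by (simp add: lin_comb_def)
qed

lemma sprod_lin_comb_left:
  assumes e: "orthonormal M k e" and w: "w \<in> carrier M"
  shows "sprod M (lin_comb M k e c) w = (\<Sum>i<k. c i * sprod M (e i) w)"
  unfolding lin_comb_def using e w
  by (subst sprod_finsum_left) (auto simp: orthonormal_def sprod_smult_left intro!: sum.cong)

lemma sprod_lin_comb_basis:
  assumes e: "orthonormal M k e" and j: "j < k"
  shows "sprod M (lin_comb M k e c) (e j) = c j"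
proof -
  have "sprod M (lin_comb M k e c) (e j) = (\<Sum>i<k. if i = j then c j else 0)"
    unfolding sprod_lin_comb_left[OF e orthonormal_carrier[OF e j]]
    using orthonormal_sprod[OF e _ j] by (intro sum.cong) auto
  then show ?thesis using j by simp
qed

lemma sprod_lin_comb:
  assumes e: "orthonormal M k e"
  shows "sprod M (lin_comb M k e b) (lin_comb M k e c) = (\<Sum>i<k. b i * cnj (c i))"
proof -
  have "sprod M (e i) (lin_comb M k e c) = cnj (c i)" if "i < k" for i
    using sprod_cnj[OF lin_comb_closed[OF e] orthonormal_carrier[OF e that], of c]
      sprod_lin_comb_basis[OF e that, of c] by simp
  then show ?thesis
    unfolding sprod_lin_comb_left[OF e lin_comb_closed[OF e]] by (intro sum.cong) auto
qed

lemma residual_orthogonal: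
  assumes e: "orthonormal M k e" and v: "v \<in> carrier M" and j: "j < k"
  shows "sprod M (v \<ominus>\<^bsub>M\<^esub> fourier M k e v) (e j) = 0"
  using v orthonormal_carrier[OF e j] lin_comb_closed[OF e]
  by (simp add: sprod_diff_left sprod_lin_comb_basis[OF e j])

text \<open>Expand \<open>\<parallel>p - v\<parallel>\<^sup>2 \<ge> 0\<close>, where \<open>p\<close> is the Fourier expansion of \<open>v\<close>.\<close>

lemma bessel:
  assumes e: "orthonormal M k e" and v: "v \<in> carrier M"
  shows "(\<Sum>i<k. (cmod (sprod M v (e i)))\<^sup>2) \<le> (hnorm M v)\<^sup>2"
proof -
  let ?p = "fourier M k e v"
  let ?S = "\<Sum>i<k. (cmod (sprod M v (e i)))\<^sup>2"
  have p: "?p \<in> carrier M" by (rule lin_comb_closed[OF e])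
  have sq: "(\<Sum>i<k. sprod M v (e i) * cnj (sprod M v (e i))) = complex_of_real ?S"
    by (simp only: of_real_sum complex_norm_square)
  have pp: "sprod M ?p ?p = complex_of_real ?S" using sprod_lin_comb[OF e] sq by simp
  have "sprod M ?p v = (\<Sum>i<k. sprod M v (e i) * sprod M (e i) v)"
    by (rule sprod_lin_comb_left[OF e v])
  also have "\<dots> = complex_of_real ?S"
    unfolding sq[symmetric] using sprod_cnj[OF v orthonormal_carrier[OF e]] by (intro sum.cong) auto
  finally have pv: "sprod M ?p v = complex_of_real ?S" .
  have "0 \<le> (hnorm M (?p \<ominus>\<^bsub>M\<^esub> v))\<^sup>2" by simp
  also have "\<dots> = (hnorm M v)\<^sup>2 - ?S"
    using p v hnorm_sq[OF p] by (simp only: hnorm_sq_diff pv pp Re_complex_of_real)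
  finally show ?thesis by simp
qed

lemma orthonormal_extend:
  assumes e: "orthonormal M k e" and u: "u \<in> carrier M" "hnorm M u = 1"
    and orth: "\<And>i. i < k \<Longrightarrow> sprod M u (e i) = 0"
  shows "orthonormal M (Suc k) (e(k := u))"
proof -
  have "sprod M (e i) u = 0" if "i < k" for i
    using sprod_cnj[OF u(1) orthonormal_carrier[OF e that]] orth[OF that] by simp
  moreover have "sprod M u u = 1" using u by (simp add: sprod_self)
  ultimately show ?thesis
    using e u orth by (auto simp: orthonormal_def less_Suc_eq)
qed

lemma normalize:
  assumes "v \<in> carrier M" "hnorm M v \<noteq> 0"
  shows "complex_of_real (1 / hnorm M v) \<odot>\<^bsub>M\<^esub> v \<in> carrier M"
    and "hnorm M (complex_of_real (1 / hnorm M v) \<odot>\<^bsub>M\<^esub> v) = 1"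
  using assms by (simp_all add: hnorm_smult norm_divide)

lemma orthonormal_extend_residual:
  assumes e: "orthonormal M k e" and u: "u \<in> carrier M" "hnorm M u \<noteq> 0"
    and orth: "\<And>i. i < k \<Longrightarrow> sprod M u (e i) = 0"
  shows "\<exists>f. orthonormal M (Suc k) f"
  using orthonormal_extend[OF e normalize[OF u]] u(1) orth orthonormal_carrier[OF e]
  by (auto simp: sprod_smult_left)

text \<open>
  An orthonormal system of maximal length is a basis: a vector differing from its Fourier expansion
  would give, after normalising the difference, a longer system.
\<close>

lemma maximal_orthonormal_basis:
  assumes def: "\<And>v. v \<in> carrier M \<Longrightarrow> hnorm M v = 0 \<Longrightarrow> v = \<zero>\<^bsub>M\<^esub>"
    and bound: "\<And>k e. orthonormal M k e \<Longrightarrow> k \<le> d"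
  shows "\<exists>k e. orthonormal M k e \<and> (\<forall>v\<in>carrier M. fourier M k e v = v)"
proof -
  have "\<exists>e. orthonormal M 0 e" by (simp add: orthonormal_def)
  then obtain k where k: "\<exists>e. orthonormal M k e" and max: "\<And>l. \<exists>e. orthonormal M l e \<Longrightarrow> l \<le> k"
    using Nat.ex_has_greatest_nat[of "\<lambda>k. \<exists>e. orthonormal M k e" 0 d] bound by auto
  from k obtain e where e: "orthonormal M k e" by blast
  show ?thesis
  proof (intro exI conjI ballI)
    show "orthonormal M k e" by (rule e)
    fix v assume v: "v \<in> carrier M"
    let ?p = "fourier M k e v"
    have p: "?p \<in> carrier M" by (rule lin_comb_closed[OF e])
    have "hnorm M (v \<ominus>\<^bsub>M\<^esub> ?p) = 0"
      using orthonormal_extend_residual[OF e _ _ residual_orthogonal[OF e v]] max[of "Suc k"] v p by force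
    then have "v \<ominus>\<^bsub>M\<^esub> ?p = \<zero>\<^bsub>M\<^esub>" using def v p by simp
    then show "?p = v" using add_diff_cancel[OF v p] p by simp
  qed
qed

lemma lin_comb_restrict:
  assumes W: "submodule class_ring W M" and e: "\<And>i. i < k \<Longrightarrow> e i \<in> W"
  shows "lin_comb (M\<lparr>carrier := W\<rparr>) k e c = lin_comb M k e c"
proof -
  interpret W: module class_ring "M\<lparr>carrier := W\<rparr>"
    by (rule submodule_is_module[OF W])
  have sub: "w \<in> carrier M" if "w \<in> W" for w using submodule.subset[OF W] that by auto
  have "finite A \<Longrightarrow> A \<subseteq> {..<k} \<Longrightarrow>
      finsum (M\<lparr>carrier := W\<rparr>) (\<lambda>i. c i \<odot>\<^bsub>M\<^esub> e i) A = finsum M (\<lambda>i. c i \<odot>\<^bsub>M\<^esub> e i) A" for A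
  proof (induction A rule: finite_induct)
    case empty
    then show ?case by simp
  next
    case (insert i A)
    then have "(\<lambda>i. c i \<odot>\<^bsub>M\<^esub> e i) \<in> A \<rightarrow> W" "c i \<odot>\<^bsub>M\<^esub> e i \<in> W"
      using e submodule.smult_closed[OF W] by auto
    moreover from this have "(\<lambda>i. c i \<odot>\<^bsub>M\<^esub> e i) \<in> A \<rightarrow> carrier M" "c i \<odot>\<^bsub>M\<^esub> e i \<in> carrier M"
      using sub by auto
    ultimately show ?case
      using insert by (simp add: M.finsum_insert W.M.finsum_insert)
  qed
  then show ?thesis by (simp add: lin_comb_def)
qed

lemma displacement_smult:
  assumes "F \<subseteq> carrier G" "v \<in> carrier M"
  shows "displacement M F (c \<odot>\<^bsub>M\<^esub> v) = (cmod c)\<^sup>2 * displacement M F v"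
proof -
  have "act M g (c \<odot>\<^bsub>M\<^esub> v) \<ominus>\<^bsub>M\<^esub> c \<odot>\<^bsub>M\<^esub> v = c \<odot>\<^bsub>M\<^esub> (act M g v \<ominus>\<^bsub>M\<^esub> v)" if "g \<in> F" for g
    using assms that by (simp add: act_smult diff_as_scale scale_add_right scale_scale subset_iff)
  then show ?thesis
    using assms by (simp add: displacement_def sum_distrib_left hnorm_smult power_mult_distrib subset_iff)
qed

lemma displacement_orthogonal_sum:
  assumes F: "F \<subseteq> carrier G" and v: "v \<in> carrier M" and w: "w \<in> carrier M"
    and orth: "sprod M v w = 0" "\<And>g. g \<in> F \<Longrightarrow> sprod M (act M g v) w = 0"
      "\<And>g. g \<in> F \<Longrightarrow> sprod M (act M g w) v = 0"
  shows "(hnorm M (v \<oplus>\<^bsub>M\<^esub> w))\<^sup>2 = (hnorm M v)\<^sup>2 + (hnorm M w)\<^sup>2"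
    and "displacement M F (v \<oplus>\<^bsub>M\<^esub> w) = displacement M F v + displacement M F w"
proof -
  have "sprod M w v = 0" using sprod_cnj[OF v w] orth(1) by simp
  then show n: "(hnorm M (v \<oplus>\<^bsub>M\<^esub> w))\<^sup>2 = (hnorm M v)\<^sup>2 + (hnorm M w)\<^sup>2"
    using v w orth(1) by (simp add: hnorm_sq sprod_add_left sprod_add_right)
  have "sprod M (act M g (v \<oplus>\<^bsub>M\<^esub> w)) (v \<oplus>\<^bsub>M\<^esub> w) = sprod M (act M g v) v + sprod M (act M g w) w"
    if "g \<in> F" for g
    using that F v w orth by (simp add: act_add sprod_add_left sprod_add_right subset_iff)
  then show "displacement M F (v \<oplus>\<^bsub>M\<^esub> w) = displacement M F v + displacement M F w"
    using F v w by (simp add: displacement_eq n algebra_simps flip: sum.distrib)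
qed

end

subsection \<open>Spectral gap for finite-dimensional representations\<close>

text \<open>
  Coordinates with respect to an orthonormal basis identify \<open>M\<close> with an irreducible representation \<open>Q\<close>
  on \<open>\<complex>\<^sup>k\<close>, which is an element of \<open>fd_irreps G\<close>. If the matrix coefficient of \<open>u\<close> were \<open>\<epsilon>\<close>-close to \<open>1\<close> on
  all of \<open>F\<close>, then \<open>Q\<close> would be trivial and \<open>u\<close> invariant. So \<open>\<epsilon> \<le> \<bar>\<langle>g u - u, u\<rangle>\<bar> \<le> \<parallel>g u - u\<parallel>\<close> for some
  \<open>g \<in> F\<close>.
\<close>

lemma (in unitary_module) displacement_gap_irreducible:
  assumes def: "\<And>v. v \<in> carrier M \<Longrightarrow> hnorm M v = 0 \<Longrightarrow> v = \<zero>\<^bsub>M\<^esub>"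
    and bound: "\<And>k e. orthonormal M k e \<Longrightarrow> k \<le> d"
    and irr: "fd_irreducible G M"
    and pair: "tau_pair G F \<epsilon>"
    and ninv: "\<And>v. v \<in> carrier M \<Longrightarrow> (\<And>g. g \<in> carrier G \<Longrightarrow> act M g v = v) \<Longrightarrow> v = \<zero>\<^bsub>M\<^esub>"
    and u: "u \<in> carrier M" "hnorm M u = 1"
  shows "\<epsilon>\<^sup>2 \<le> displacement M F u"
proof -
  note F = tau_pairD(1-3)[OF pair]
  have "\<exists>k e. orthonormal M k e \<and> (\<forall>v\<in>carrier M. fourier M k e v = v)"
    by (rule maximal_orthonormal_basis[of d]) (auto intro: def bound)
  then obtain k e where e: "orthonormal M k e" and span: "\<forall>v\<in>carrier M. fourier M k e v = v"
    by blast
  define T where "T v = vec k (\<lambda>i. sprod M v (e i))" for v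
  define L where "L c = lin_comb M k e (\<lambda>i. c $ i)" for c
  have Lc: "L c \<in> carrier M" for c unfolding L_def by (rule lin_comb_closed[OF e])
  have Tc: "T v \<in> carrier_vec k" for v by (simp add: T_def)
  have LT: "L (T v) = v" if v: "v \<in> carrier M" for v
  proof -
    have "L (T v) = fourier M k e v"
      unfolding L_def lin_comb_def T_def using v e
      by (intro M.finsum_cong') (auto simp: orthonormal_def)
    then show ?thesis using span v by simp
  qed
  have TL: "T (L c) = c" if "c \<in> carrier_vec k" for c
    using that by (intro eq_vecI) (auto simp: T_def L_def sprod_lin_comb_basis[OF e])
  have ec: "e i \<in> carrier M" if "i < k" for i using orthonormal_carrier[OF e that] .
  have Tadd: "T (v \<oplus>\<^bsub>M\<^esub> w) = T v + T w" if "v \<in> carrier M" "w \<in> carrier M" for v w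
    using that ec by (intro eq_vecI) (auto simp: T_def sprod_add_left)
  have Tsm: "T (c \<odot>\<^bsub>M\<^esub> v) = c \<cdot>\<^sub>v T v" if "v \<in> carrier M" for c v
    using that ec by (intro eq_vecI) (auto simp: T_def sprod_smult_left)
  have T0: "T \<zero>\<^bsub>M\<^esub> = 0\<^sub>v k" using ec by (intro eq_vecI) (auto simp: T_def)
  have Tsp: "T v \<bullet>c T w = sprod M v w" if "v \<in> carrier M" "w \<in> carrier M" for v w
  proof -
    have "T v \<bullet>c T w = (\<Sum>i<k. sprod M v (e i) * cnj (sprod M w (e i)))"
      unfolding cscalar_prod_sum[OF Tc] by (intro sum.cong) (auto simp: T_def)
    also have "\<dots> = sprod M (fourier M k e v) (fourier M k e w)"
      by (rule sprod_lin_comb[OF e, symmetric])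
    finally show ?thesis using span that by simp
  qed
  define \<pi> where "\<pi> g c = T (act M g (L c))" for g c
  define Q where "Q = cn_rep k \<pi>"
  have "T ` carrier M = carrier_vec k"
    using Tc TL Lc by (auto simp: image_iff) (metis)
  then have "unitary_module G Q"
    unfolding Q_def
    by (intro unitary_module_image[OF unitary_module_axioms, where q = T])
      (simp_all add: T0 Tadd Tsm Tsp \<pi>_def LT)
  then interpret Q: unitary_module G Q .
  have actT: "act Q g (T v) = T (act M g v)" if "v \<in> carrier M" for g v
    by (simp add: Q_def \<pi>_def LT[OF that])
  have "fd_irreducible G Q"
    unfolding fd_irreducible_def
  proof (intro conjI allI impI)
    obtain v where "v \<in> carrier M" "v \<noteq> \<zero>\<^bsub>M\<^esub>"
      using irr M.zero_closed unfolding fd_irreducible_def by blast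
    then have "T v \<noteq> T \<zero>\<^bsub>M\<^esub>" using LT by (metis M.zero_closed)
    then show "carrier Q \<noteq> {\<zero>\<^bsub>Q\<^esub>}" using Tc[of v] by (auto simp: Q_def T0)
  next
    fix W assume "submodule class_ring W Q \<and> (\<forall>g\<in>carrier G. act Q g ` W \<subseteq> W)"
    then have W: "submodule class_ring W Q" and inv: "\<And>g w. g \<in> carrier G \<Longrightarrow> w \<in> W \<Longrightarrow> act Q g w \<in> W"
      by auto
    have sub: "W \<subseteq> carrier_vec k" using submodule.subset[OF W] by (simp add: Q_def)
    let ?V = "{v \<in> carrier M. T v \<in> W}"
    have "submodule class_ring ?V M"
      using submodule.m_closed[OF W] submodule.zero_closed[OF W] submodule.smult_closed[OF W]
      by (intro submodule.intro module_axioms) (auto simp: Q_def Tadd Tsm T0)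
    moreover have "\<forall>g\<in>carrier G. act M g ` ?V \<subseteq> ?V"
      using inv by (auto simp flip: actT)
    ultimately have "?V = {\<zero>\<^bsub>M\<^esub>} \<or> ?V = carrier M"
      using irr unfolding fd_irreducible_def by blast
    then show "W = {\<zero>\<^bsub>Q\<^esub>} \<or> W = carrier Q"
    proof
      assume V: "?V = {\<zero>\<^bsub>M\<^esub>}"
      have "w = \<zero>\<^bsub>Q\<^esub>" if w: "w \<in> W" for w
      proof -
        have "L w \<in> ?V" using w sub Lc TL by auto
        then have "L w = \<zero>\<^bsub>M\<^esub>" using V by blast
        then show ?thesis using TL[of w] w sub T0 by (auto simp: Q_def)
      qed
      then show ?thesis using submodule.zero_closed[OF W] by blast
    next
      assume V: "?V = carrier M"
      have "c \<in> W" if "c \<in> carrier_vec k" for c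
        using TL[OF that] Lc[of c] V by (metis (mono_tags, lifting) mem_Collect_eq)
      then show ?thesis using sub by (auto simp: Q_def)
    qed
  qed
  then have "Q \<in> fd_irreps G" using Q.unitary unfolding fd_irreps_def Q_def by blast
  note gapQ = tau_pairD(4)[OF pair this]
  have "\<not> almost_fixes Q F \<epsilon>"
  proof
    assume *: "almost_fixes Q F \<epsilon>"
    have "act M g u = u" if g: "g \<in> carrier G" for g
    proof -
      have "T (act M g u) = T u"
        using gapQ[OF * g, of "T u"] actT[OF u(1), of g] Tc[of u] by (simp add: Q_def)
      then show ?thesis using LT[of u] LT[of "act M g u"] u g by simp
    qed
    then have "u = \<zero>\<^bsub>M\<^esub>" using ninv u by blast
    then show False using u by (simp add: hnorm_def)
  qed
  moreover have "pos_fun Q (T u) g = sprod M (act M g u) u" if "g \<in> F" for g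
    using that F u by (simp add: pos_fun_def actT Q_def Tsp \<pi>_def LT subset_iff)
  moreover have "sprod Q (T u) (T u) = 1" using u by (simp add: Q_def Tsp sprod_self)
  moreover have "T u \<in> carrier Q" using Tc by (simp add: Q_def)
  ultimately obtain g where g: "g \<in> F" "\<epsilon> \<le> cmod (sprod M (act M g u) u - 1)"
    unfolding almost_fixes_def by (metis not_le)
  have gG: "g \<in> carrier G" using g F by auto
  have "sprod M (act M g u) u - 1 = sprod M (act M g u \<ominus>\<^bsub>M\<^esub> u) u"
    using u gG by (simp add: sprod_diff_left sprod_self)
  then have "\<epsilon> \<le> hnorm M (act M g u \<ominus>\<^bsub>M\<^esub> u)"
    using cauchy_schwarz[of "act M g u \<ominus>\<^bsub>M\<^esub> u" u] g(2) u gG by simp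
  then have "\<epsilon>\<^sup>2 \<le> (hnorm M (act M g u \<ominus>\<^bsub>M\<^esub> u))\<^sup>2"
    using F(3) by (intro power_mono) auto
  also have "\<dots> \<le> displacement M F u"
    unfolding displacement_def using F g by (intro member_le_sum) auto
  finally show ?thesis .
qed

text \<open>
  Induction on a bound \<open>d\<close> for the length of orthonormal systems, which serves as the dimension. A
  reducible \<open>M\<close> is the orthogonal sum of an invariant submodule \<open>W\<close> and its orthogonal complement
  \<open>V\<close>, and both sides of the inequality are additive over this sum. The bound drops for \<open>W\<close> and for
  \<open>V\<close> because an orthonormal system in one of them can be extended by a unit vector of the other.
\<close>

lemma displacement_gap_finite_dim:
  fixes G :: "('g, 'm) monoid_scheme" and M :: "('g, 'v) gspace"
  assumes pair: "tau_pair G F \<epsilon>"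
    and "unitary_module G M"
    and "\<And>v. v \<in> carrier M \<Longrightarrow> hnorm M v = 0 \<Longrightarrow> v = \<zero>\<^bsub>M\<^esub>"
    and "\<And>k e. orthonormal M k e \<Longrightarrow> k \<le> d"
    and "\<And>v. v \<in> carrier M \<Longrightarrow> (\<And>g. g \<in> carrier G \<Longrightarrow> act M g v = v) \<Longrightarrow> v = \<zero>\<^bsub>M\<^esub>"
    and "v \<in> carrier M"
  shows "\<epsilon>\<^sup>2 * (hnorm M v)\<^sup>2 \<le> displacement M F v"
  using assms(2-)
proof (induction d arbitrary: M v)
  case (0 M v)
  interpret unitary_module G M by (rule 0(1))
  have "hnorm M v = 0"
    using orthonormal_extend_residual[of 0 "\<lambda>_. v" v] 0(3) 0(5) by (force simp: orthonormal_def)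
  then show ?case by (simp add: displacement_def sum_nonneg)
next
  case (Suc d M v)
  interpret unitary_module G M by (rule Suc.prems(1))
  note F = tau_pairD(1-3)[OF pair]
  note def = Suc.prems(2) and bound = Suc.prems(3) and ninv = Suc.prems(4) and v = Suc.prems(5)
  consider "hnorm M v = 0" | "hnorm M v \<noteq> 0" "fd_irreducible G M" | "hnorm M v \<noteq> 0" "\<not> fd_irreducible G M"
    by blast
  then show ?case
  proof cases
    case 1
    then show ?thesis by (simp add: displacement_def sum_nonneg)
  next
    case 2
    have "\<epsilon>\<^sup>2 \<le> displacement M F (complex_of_real (1 / hnorm M v) \<odot>\<^bsub>M\<^esub> v)"
      by (rule displacement_gap_irreducible[OF def bound 2(2) pair ninv normalize[OF v 2(1)]])
    also have "\<dots> = displacement M F v / (hnorm M v)\<^sup>2"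
      using v by (simp add: displacement_smult[OF F(2)] norm_divide power_divide)
    finally show ?thesis using 2(1) by (simp add: pos_le_divide_eq)
  next
    case 3
    have "carrier M \<noteq> {\<zero>\<^bsub>M\<^esub>}" using 3(1) v by (auto simp: hnorm_def)
    then obtain W where W: "submodule class_ring W M" and Winv: "\<And>g. g \<in> carrier G \<Longrightarrow> act M g ` W \<subseteq> W"
      and Wne: "W \<noteq> {\<zero>\<^bsub>M\<^esub>}" "W \<noteq> carrier M"
      using 3(2) unfolding fd_irreducible_def by auto
    have Wsub: "W \<subseteq> carrier M" using submodule.subset[OF W] .
    define V where "V = {x \<in> carrier M. \<forall>w\<in>W. sprod M x w = 0}"
    have Vsub: "V \<subseteq> carrier M" by (auto simp: V_def)
    have V: "submodule class_ring V M"
      using Wsub by (intro submodule.intro module_axioms)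
        (auto simp: V_def sprod_add_left sprod_smult_left subset_iff)
    have Vinv: "act M g ` V \<subseteq> V" if g: "g \<in> carrier G" for g
    proof -
      have "sprod M (act M g x) w = 0" if "x \<in> V" "w \<in> W" for x w
        using that g Wsub Winv[of "inv\<^bsub>G\<^esub> g"] unfolding V_def
        by (subst sprod_act_adjoint) auto
      then show ?thesis using g by (auto simp: V_def)
    qed
    let ?MW = "M\<lparr>carrier := W\<rparr>" and ?MV = "M\<lparr>carrier := V\<rparr>"
    interpret MW: unitary_module G ?MW using restrict[OF W Winv] .
    interpret MV: unitary_module G ?MV using restrict[OF V Vinv] .
    have orthW: "orthonormal M k e \<and> (\<forall>i<k. e i \<in> W)" if "orthonormal ?MW k e" for k e
      using that Wsub by (auto simp: orthonormal_def)
    have orthV: "orthonormal M k e \<and> (\<forall>i<k. e i \<in> V)" if "orthonormal ?MV k e" for k e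
      using that Vsub by (auto simp: orthonormal_def)
    have hn [simp]: "hnorm ?MW x = hnorm M x" "hnorm ?MV x = hnorm M x" for x
      by (simp_all add: hnorm_def)
    have disp: "displacement ?MW F w = displacement M F w" if "w \<in> W" for w
      using that Wsub F(2) by (subst MW.displacement_eq, simp_all, subst displacement_eq, auto)
    have disp': "displacement ?MV F w = displacement M F w" if "w \<in> V" for w
      using that Vsub F(2) by (subst MV.displacement_eq, simp_all, subst displacement_eq, auto)
    have boundW: "k \<le> Suc d" if "orthonormal ?MW k e" for k e using orthW[OF that] bound by blast
    have "\<exists>m f. orthonormal ?MW m f \<and> (\<forall>w\<in>carrier ?MW. fourier ?MW m f w = w)"
    proof (rule MW.maximal_orthonormal_basis[of "Suc d"])
      show "x = \<zero>\<^bsub>?MW\<^esub>" if "x \<in> carrier ?MW" "hnorm ?MW x = 0" for x using def that Wsub by auto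
    qed (rule boundW)
    then obtain m f where f: "orthonormal ?MW m f" and fspan: "\<forall>w\<in>carrier ?MW. fourier ?MW m f w = w"
      by blast
    note fM = orthW[OF f, THEN conjunct1] and fW = orthW[OF f, THEN conjunct2, rule_format]
    (* Fourier expansion in the basis f of W is the orthogonal projection onto W. *)
    have split: "fourier M m f x \<in> W" "x \<ominus>\<^bsub>M\<^esub> fourier M m f x \<in> V" if x: "x \<in> carrier M" for x
    proof -
      show p: "fourier M m f x \<in> W" by (rule lin_comb_in_submodule[OF W fW])
      let ?r = "x \<ominus>\<^bsub>M\<^esub> fourier M m f x"
      have r: "?r \<in> carrier M" using p x Wsub by auto
      have "sprod M ?r w = 0" if w: "w \<in> W" for w
      proof -
        let ?c = "\<lambda>i. sprod M w (f i)"
        have "sprod M (f i) ?r = 0" if "i < m" for i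
          using sprod_cnj[OF r orthonormal_carrier[OF fM that]] residual_orthogonal[OF fM x that] by simp
        then have "sprod M (lin_comb M m f ?c) ?r = 0"
          unfolding sprod_lin_comb_left[OF fM r] by (intro sum.neutral) auto
        moreover have "lin_comb M m f ?c = w"
          using fspan w lin_comb_restrict[OF W fW] by simp
        ultimately show ?thesis
          using sprod_cnj[of w ?r] w Wsub r by auto
      qed
      then show "?r \<in> V" using r by (simp add: V_def)
    qed
    have sumM: "fourier M m f x \<oplus>\<^bsub>M\<^esub> (x \<ominus>\<^bsub>M\<^esub> fourier M m f x) = x" if "x \<in> carrier M" for x
      using add_diff_cancel that split(1)[OF that] Wsub by blast
    have VW: "sprod M x w = 0" "sprod M w x = 0" if "x \<in> V" "w \<in> W" for x w
      using that sprod_cnj[of x w] Wsub by (auto simp: V_def)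
    have dW: "k \<le> d" if e: "orthonormal ?MW k e" for k e
    proof -
      obtain x where x: "x \<in> carrier M" "x \<notin> W" using Wne(2) Wsub by blast
      let ?r = "x \<ominus>\<^bsub>M\<^esub> fourier M m f x"
      have r: "?r \<in> V" "?r \<in> carrier M" using split(2)[OF x(1)] Vsub by auto
      have "hnorm M ?r \<noteq> 0"
      proof
        assume "hnorm M ?r = 0"
        then have "?r = \<zero>\<^bsub>M\<^esub>" using def r by blast
        then have "fourier M m f x = x" using sumM[OF x(1)] split(1)[OF x(1)] Wsub by auto
        then show False using split(1)[OF x(1)] x(2) by simp
      qed
      then have "\<exists>h. orthonormal M (Suc k) h"
        using orthonormal_extend_residual[of k e ?r] orthW[OF e] r VW by blast
      then show ?thesis using bound by fastforce
    qed
    have dV: "k \<le> d" if e: "orthonormal ?MV k e" for k e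
    proof -
      obtain w where w: "w \<in> W" "w \<noteq> \<zero>\<^bsub>M\<^esub>" using Wne(1) submodule.zero_closed[OF W] by blast
      then have "w \<in> carrier M" "hnorm M w \<noteq> 0" using def Wsub by auto
      then have "\<exists>h. orthonormal M (Suc k) h"
        using orthonormal_extend_residual[of k e w] orthV[OF e] w VW by blast
      then show ?thesis using bound by fastforce
    qed
    define p where "p = fourier M m f v"
    define r where "r = v \<ominus>\<^bsub>M\<^esub> p"
    have p: "p \<in> W" and r: "r \<in> V" and pr: "p \<oplus>\<^bsub>M\<^esub> r = v"
      using split[OF v] sumM[OF v] by (simp_all add: p_def r_def)
    have "\<epsilon>\<^sup>2 * (hnorm ?MW p)\<^sup>2 \<le> displacement ?MW F p"
    proof (rule Suc.IH[OF MW.unitary_module_axioms])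
      show "x = \<zero>\<^bsub>?MW\<^esub>" if "x \<in> carrier ?MW" "hnorm ?MW x = 0" for x
        using def that Wsub by auto
      show "x = \<zero>\<^bsub>?MW\<^esub>" if "x \<in> carrier ?MW" "\<And>g. g \<in> carrier G \<Longrightarrow> act ?MW g x = x" for x
        using ninv that Wsub by auto
      show "k \<le> d" if "orthonormal ?MW k e" for k e using dW[OF that] .
      show "p \<in> carrier ?MW" using p by simp
    qed
    moreover have "\<epsilon>\<^sup>2 * (hnorm ?MV r)\<^sup>2 \<le> displacement ?MV F r"
    proof (rule Suc.IH[OF MV.unitary_module_axioms])
      show "x = \<zero>\<^bsub>?MV\<^esub>" if "x \<in> carrier ?MV" "hnorm ?MV x = 0" for x
        using def that Vsub by auto
      show "x = \<zero>\<^bsub>?MV\<^esub>" if "x \<in> carrier ?MV" "\<And>g. g \<in> carrier G \<Longrightarrow> act ?MV g x = x" for x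
        using ninv that Vsub by auto
      show "k \<le> d" if "orthonormal ?MV k e" for k e using dV[OF that] .
      show "r \<in> carrier ?MV" using r by simp
    qed
    moreover have "(hnorm M (p \<oplus>\<^bsub>M\<^esub> r))\<^sup>2 = (hnorm M p)\<^sup>2 + (hnorm M r)\<^sup>2"
      "displacement M F (p \<oplus>\<^bsub>M\<^esub> r) = displacement M F p + displacement M F r"
    proof -
      have "act M g p \<in> W" "act M g r \<in> V" if "g \<in> F" for g
        using p r Winv[of g] Vinv[of g] that F(2) by auto
      then show "(hnorm M (p \<oplus>\<^bsub>M\<^esub> r))\<^sup>2 = (hnorm M p)\<^sup>2 + (hnorm M r)\<^sup>2"
        "displacement M F (p \<oplus>\<^bsub>M\<^esub> r) = displacement M F p + displacement M F r"
        using displacement_orthogonal_sum[OF F(2), of p r] p r Wsub Vsub VW by blast+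
    qed
    ultimately show ?thesis by (simp add: pr disp[OF p] disp'[OF r] distrib_left)
  qed
qed

section \<open>Ultraproducts of unitary representations\<close>

text \<open>
  The limit is the supremum of the numbers \<open>x\<close> with \<open>x \<le> f i\<close> for almost all \<open>i\<close>. If \<open>y\<close> lies above the
  supremum, it is not one of these numbers, and the ultrafilter property gives \<open>f i < y\<close> for almost all
  \<open>i\<close>.
\<close>

lemma ultrafilter_tendsto_real:
  fixes f :: "'i \<Rightarrow> real"
  assumes "U \<noteq> bot" and ultra: "\<And>P. eventually P U \<or> eventually (\<lambda>i. \<not> P i) U"
    and bound: "\<And>i. \<bar>f i\<bar> \<le> B"
  shows "\<exists>l. (f \<longlongrightarrow> l) U"
proof -
  let ?A = "{x. eventually (\<lambda>i. x \<le> f i) U}"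
  have lower: "- B \<in> ?A"
    using bound by (auto intro!: always_eventually simp: abs_le_iff minus_le_iff)
  have upper: "x \<le> B" if "x \<in> ?A" for x
  proof -
    have "eventually (\<lambda>i. x \<le> f i) U" using that by simp
    then obtain i where "x \<le> f i" using eventually_happens'[OF \<open>U \<noteq> bot\<close>] by blast
    then show ?thesis using bound[of i] by simp
  qed
  have bdd: "bdd_above ?A" using upper by (intro bdd_aboveI[of _ B]) auto
  have "(f \<longlongrightarrow> Sup ?A) U"
  proof (rule order_tendstoI)
    fix y assume "y < Sup ?A"
    then obtain x where "x \<in> ?A" "y < x" using less_cSup_iff[OF _ bdd] lower by blast
    then show "eventually (\<lambda>i. y < f i) U" by (auto elim: eventually_mono)
  next
    fix y assume y: "Sup ?A < y"
    then have "y \<notin> ?A" using cSup_upper[OF _ bdd] by (meson not_le)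
    then have "eventually (\<lambda>i. \<not> y \<le> f i) U" using ultra[of "\<lambda>i. y \<le> f i"] by simp
    then show "eventually (\<lambda>i. f i < y) U" by (simp add: not_le)
  qed
  then show ?thesis by blast
qed

lemma ultrafilter_tendsto_complex:
  fixes f :: "'i \<Rightarrow> complex"
  assumes U: "U \<noteq> bot" "\<And>P. eventually P U \<or> eventually (\<lambda>i. \<not> P i) U"
    and bound: "\<And>i. cmod (f i) \<le> B"
  shows "(f \<longlongrightarrow> Lim U f) U"
proof -
  have "\<bar>Re (f i)\<bar> \<le> B" "\<bar>Im (f i)\<bar> \<le> B" for i
    using bound[of i] abs_Re_le_cmod[of "f i"] abs_Im_le_cmod[of "f i"] by linarith+
  then obtain a b where "((\<lambda>i. Re (f i)) \<longlongrightarrow> a) U" "((\<lambda>i. Im (f i)) \<longlongrightarrow> b) U"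
    using ultrafilter_tendsto_real[OF U, of "\<lambda>i. Re (f i)" B]
      ultrafilter_tendsto_real[OF U, of "\<lambda>i. Im (f i)" B] by blast
  then have "((\<lambda>i. Complex (Re (f i)) (Im (f i))) \<longlongrightarrow> Complex a b) U" by (rule tendsto_Complex)
  then have f: "(f \<longlongrightarrow> Complex a b) U" by simp
  then have "Lim U f = Complex a b" by (rule tendsto_Lim[OF U(1)])
  with f show ?thesis by simp
qed

lemma bounded_seqs_carrier_bound:
  assumes "s \<in> carrier (bounded_seqs U M)"
  shows "\<exists>B. \<forall>n. hnorm (M n) (s n) \<le> B"
  using assms by (auto simp: bounded_seqs_def bdd_above_def)

lemma bounded_seqs_carrierI:
  assumes "\<And>n. s n \<in> carrier (M n)" "\<And>n. hnorm (M n) (s n) \<le> B"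
  shows "s \<in> carrier (bounded_seqs U M)"
  using assms by (auto simp: bounded_seqs_def bdd_above_def)

lemma bounded_seqs_component: "s \<in> carrier (bounded_seqs U M) \<Longrightarrow> s n \<in> carrier (M n)"
  by (simp add: bounded_seqs_def)

lemma bounded_seqs_sprod_tendsto:
  assumes M: "\<And>n. unitary_module G (M n)" and U: "nonprincipal_ultrafilter U"
    and s: "s \<in> carrier (bounded_seqs U M)" and t: "t \<in> carrier (bounded_seqs U M)"
  shows "((\<lambda>n. sprod (M n) (s n) (t n)) \<longlongrightarrow> sprod (bounded_seqs U M) s t) U"
proof -
  interpret M: unitary_module G "M n" for n by (rule M)
  obtain A where A: "\<And>n. hnorm (M n) (s n) \<le> A" using bounded_seqs_carrier_bound[OF s] by blast
  obtain B where B: "\<And>n. hnorm (M n) (t n) \<le> B" using bounded_seqs_carrier_bound[OF t] by blast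
  have sc: "s n \<in> carrier (M n)" and tc: "t n \<in> carrier (M n)" for n
    using bounded_seqs_component[OF s] bounded_seqs_component[OF t] by auto
  have "cmod (sprod (M n) (s n) (t n)) \<le> A * B" for n
  proof -
    have "cmod (sprod (M n) (s n) (t n)) \<le> hnorm (M n) (s n) * hnorm (M n) (t n)"
      by (rule M.cauchy_schwarz[OF sc tc])
    also have "\<dots> \<le> A * B"
      using A[of n] B[of n] sc[of n] tc[of n] order_trans[OF M.hnorm_nonneg[OF sc[of n]] A[of n]]
      by (intro mult_mono) auto
    finally show ?thesis .
  qed
  then have "((\<lambda>n. sprod (M n) (s n) (t n)) \<longlongrightarrow> Lim U (\<lambda>n. sprod (M n) (s n) (t n))) U"
    using U by (intro ultrafilter_tendsto_complex) (auto simp: nonprincipal_ultrafilter_def)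
  then show ?thesis by (simp add: bounded_seqs_def)
qed

lemma unitary_module_bounded_seqs:
  assumes M: "\<And>n. unitary_module G (M n)" and U: "nonprincipal_ultrafilter U"
  shows "unitary_module G (bounded_seqs U M)"
proof (rule unitary_module_limit[where M = M and F = U])
  let ?B = "bounded_seqs U M"
  interpret M: unitary_module G "M n" for n by (rule M)
  note comp = bounded_seqs_component
  show "unitary_module G (M n)" for n by (rule M)
  show "U \<noteq> bot" using U by (simp add: nonprincipal_ultrafilter_def)
  show "\<zero>\<^bsub>?B\<^esub> \<in> carrier ?B"
    by (rule bounded_seqs_carrierI[of _ _ 0]) (simp_all add: bounded_seqs_def hnorm_def)
  fix s t assume s: "s \<in> carrier ?B" and t: "t \<in> carrier ?B"
  obtain A where A: "\<And>n. hnorm (M n) (s n) \<le> A" using bounded_seqs_carrier_bound[OF s] by blast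
  obtain B where B: "\<And>n. hnorm (M n) (t n) \<le> B" using bounded_seqs_carrier_bound[OF t] by blast
  show "s \<oplus>\<^bsub>?B\<^esub> t \<in> carrier ?B"
  proof (rule bounded_seqs_carrierI[of _ _ "A + B"])
    show "(s \<oplus>\<^bsub>?B\<^esub> t) n \<in> carrier (M n)" for n
      using comp[OF s, of n] comp[OF t, of n] by (simp add: bounded_seqs_def)
    show "hnorm (M n) ((s \<oplus>\<^bsub>?B\<^esub> t) n) \<le> A + B" for n
      using order_trans[OF M.hnorm_triangle[OF comp[OF s] comp[OF t]] add_mono[OF A B]]
      by (simp add: bounded_seqs_def)
  qed
  show "((\<lambda>n. sprod (M n) (s n) (t n)) \<longlongrightarrow> sprod ?B s t) U"
    by (rule bounded_seqs_sprod_tendsto[OF M U s t])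
next
  let ?B = "bounded_seqs U M"
  interpret M: unitary_module G "M n" for n by (rule M)
  note comp = bounded_seqs_component
  fix s assume s: "s \<in> carrier ?B"
  obtain A where A: "\<And>n. hnorm (M n) (s n) \<le> A" using bounded_seqs_carrier_bound[OF s] by blast
  show "c \<odot>\<^bsub>?B\<^esub> s \<in> carrier ?B" for c
  proof (rule bounded_seqs_carrierI[of _ _ "cmod c * A"])
    show "(c \<odot>\<^bsub>?B\<^esub> s) n \<in> carrier (M n)" for n
      using comp[OF s, of n] by (simp add: bounded_seqs_def)
    show "hnorm (M n) ((c \<odot>\<^bsub>?B\<^esub> s) n) \<le> cmod c * A" for n
      using comp[OF s, of n] A[of n] by (simp add: bounded_seqs_def M.hnorm_smult mult_left_mono)
  qed
  show "act ?B g s \<in> carrier ?B" if g: "g \<in> carrier G" for g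
  proof (rule bounded_seqs_carrierI[of _ _ A])
    show "act ?B g s n \<in> carrier (M n)" for n
      using comp[OF s, of n] g by (simp add: bounded_seqs_def)
    show "hnorm (M n) (act ?B g s n) \<le> A" for n
      using comp[OF s, of n] A[of n] g by (simp add: bounded_seqs_def)
  qed
  show "s n \<in> carrier (M n)" for n by (rule comp[OF s])
qed (simp_all add: bounded_seqs_def)

section \<open>Quasi-regular representations of finite quotients\<close>

locale finite_quotient = normal N G
  for N :: "'g set" and G :: "('g, 'm) monoid_scheme" (structure) +
  assumes finite_cosets: "finite (carrier (G Mod N))"
begin

abbreviation X :: "'g set set" where "X \<equiv> carrier (G Mod N)"

lemma coset_subset: "x \<in> X \<Longrightarrow> x \<subseteq> carrier G"
  using rcosets_carrier by (auto simp: FactGroup_def)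

lemma translate_rep:
  assumes "g \<in> carrier G" "a \<in> carrier G"
  shows "g <# (N #> a) = N #> (g \<otimes> a)"
  using assms coset_eq subset by (simp add: lcos_m_assoc)

lemma coset_rep: "x \<in> X \<Longrightarrow> \<exists>a\<in>carrier G. x = N #> a"
  by (auto simp: FactGroup_def RCOSETS_def)

lemma rep_coset: "a \<in> carrier G \<Longrightarrow> N #> a \<in> X"
  by (auto simp: FactGroup_def RCOSETS_def)

lemma translate_closed: "g \<in> carrier G \<Longrightarrow> x \<in> X \<Longrightarrow> g <# x \<in> X"
  using coset_rep[of x] rep_coset by (auto simp: translate_rep)

lemma translate_translate:
  "g \<in> carrier G \<Longrightarrow> h \<in> carrier G \<Longrightarrow> x \<in> X \<Longrightarrow> g <# (h <# x) = (g \<otimes> h) <# x"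
  using coset_subset by (rule lcos_m_assoc)

lemma translate_one: "x \<in> X \<Longrightarrow> \<one> <# x = x"
  using coset_subset by (rule lcos_mult_one)

lemma translate_bij: "g \<in> carrier G \<Longrightarrow> bij_betw (\<lambda>x. g <# x) X X"
  by (rule bij_betwI[where g = "\<lambda>x. inv g <# x"])
    (auto simp: translate_closed translate_translate translate_one)

lemma translate_transitive:
  assumes "x \<in> X" "y \<in> X"
  shows "\<exists>g\<in>carrier G. g <# x = y"
proof -
  obtain a b where ab: "a \<in> carrier G" "x = N #> a" "b \<in> carrier G" "y = N #> b"
    using coset_rep assms by blast
  then have "(b \<otimes> inv a) <# x = y" by (simp add: translate_rep m_assoc)
  then show ?thesis using ab by blast
qed

lemma card_X_pos: "0 < card X"
  using finite_cosets rep_coset[OF one_closed] by (auto simp: card_gt_0_iff)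

abbreviation L2 :: "('g, 'g set \<Rightarrow> complex) gspace" where "L2 \<equiv> quasi_regular G N"

lemma L2_carrier_iff: "\<xi> \<in> carrier L2 \<longleftrightarrow> (\<forall>x. x \<notin> X \<longrightarrow> \<xi> x = 0)"
  by (simp add: quasi_regular_def)

lemma L2_simps [simp]:
  "\<zero>\<^bsub>L2\<^esub> = (\<lambda>x. 0)"
  "\<xi> \<oplus>\<^bsub>L2\<^esub> \<eta> = (\<lambda>x. \<xi> x + \<eta> x)"
  "c \<odot>\<^bsub>L2\<^esub> \<xi> = (\<lambda>x. c * \<xi> x)"
  "sprod L2 \<xi> \<eta> = (\<Sum>x\<in>X. \<xi> x * cnj (\<eta> x))"
  by (simp_all add: quasi_regular_def)

lemma L2_act: "act L2 g \<xi> x = (if x \<in> X then \<xi> (inv g <# x) else 0)"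
  by (simp add: quasi_regular_def)

lemma sum_act:
  assumes "g \<in> carrier G"
  shows "(\<Sum>x\<in>X. f (inv g <# x)) = (\<Sum>x\<in>X. f x)"
  using sum.reindex_bij_betw[OF translate_bij[of "inv g"]] assms by simp

lemma module_L2: "module class_ring L2"
proof (rule module_criteria[OF class_cring.cring_axioms])
  show "\<forall>\<xi>\<in>carrier L2. \<exists>\<eta>\<in>carrier L2. \<xi> \<oplus>\<^bsub>L2\<^esub> \<eta> = \<zero>\<^bsub>L2\<^esub>"
  proof
    fix \<xi> assume "\<xi> \<in> carrier L2"
    then show "\<exists>\<eta>\<in>carrier L2. \<xi> \<oplus>\<^bsub>L2\<^esub> \<eta> = \<zero>\<^bsub>L2\<^esub>"
      by (intro bexI[of _ "\<lambda>x. - \<xi> x"]) (auto simp: L2_carrier_iff)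
  qed
qed (auto simp: L2_carrier_iff algebra_simps fun_eq_iff)

lemma unitary_module_L2: "unitary_module G L2"
proof (intro unitary_module.intro unitary_module_axioms.intro is_group module_L2)
  show "unitary_rep G L2"
    unfolding unitary_rep_def
  proof (intro conjI ballI)
    fix g assume g: "g \<in> carrier G"
    show "act L2 g \<in> module_hom class_ring L2 L2"
      by (auto simp: module_hom_def L2_carrier_iff L2_act fun_eq_iff)
    fix \<xi> \<eta>
    show "sprod L2 (act L2 g \<xi>) (act L2 g \<eta>) = sprod L2 \<xi> \<eta>"
      using sum_act[OF g, of "\<lambda>x. \<xi> x * cnj (\<eta> x)"] by (simp add: L2_act)
  next
    fix \<xi> assume "\<xi> \<in> carrier L2"
    then show "act L2 \<one> \<xi> = \<xi>"
      by (auto simp: L2_act L2_carrier_iff translate_one fun_eq_iff)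
  next
    fix g h \<xi> assume g: "g \<in> carrier G" and h: "h \<in> carrier G"
    show "act L2 (g \<otimes> h) \<xi> = act L2 g (act L2 h \<xi>)"
      using g h by (auto simp: L2_act fun_eq_iff translate_closed translate_translate inv_mult_group)
  qed
qed (auto simp: algebra_simps sum.distrib sum_distrib_left sum_nonneg)

interpretation L2: unitary_module G L2
  by (rule unitary_module_L2)

lemma L2_hnorm_sq: "\<xi> \<in> carrier L2 \<Longrightarrow> (hnorm L2 \<xi>)\<^sup>2 = (\<Sum>x\<in>X. (cmod (\<xi> x))\<^sup>2)"
  by (simp add: L2.hnorm_sq complex_mult_cnj cmod_power2)

lemma L2_definite:
  assumes "\<xi> \<in> carrier L2" "hnorm L2 \<xi> = 0"
  shows "\<xi> = \<zero>\<^bsub>L2\<^esub>"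
proof -
  have "(\<Sum>x\<in>X. (cmod (\<xi> x))\<^sup>2) = 0" using L2_hnorm_sq[OF assms(1)] assms(2) by simp
  then have "\<forall>x\<in>X. \<xi> x = 0" using finite_cosets by (simp add: sum_nonneg_eq_0_iff)
  then show ?thesis using assms(1) by (auto simp: L2_carrier_iff fun_eq_iff)
qed

text \<open>
  Bessel's inequality for the point mass at \<open>x\<close> reads \<open>(\<Sum>i<k. \<bar>e i x\<bar>\<^sup>2) \<le> 1\<close>; summing over \<open>x\<close> gives
  \<open>k \<le> card X\<close>.
\<close>

lemma L2_orthonormal_bound:
  assumes e: "orthonormal L2 k e"
  shows "k \<le> card X"
proof -
  have ec: "e i \<in> carrier L2" if "i < k" for i using L2.orthonormal_carrier[OF e that] .
  have point: "(\<Sum>i<k. (cmod (e i x))\<^sup>2) \<le> 1" if x: "x \<in> X" for x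
  proof -
    let ?d = "\<lambda>y. if y = x then 1 else (0 :: complex)"
    have d: "?d \<in> carrier L2" using x by (auto simp: L2_carrier_iff)
    have "sprod L2 ?d (e i) = cnj (e i x)" for i
    proof -
      have "sprod L2 ?d (e i) = (\<Sum>y\<in>X. if y = x then cnj (e i x) else 0)"
        by (simp, rule sum.cong) auto
      then show ?thesis using x finite_cosets by simp
    qed
    moreover have "(hnorm L2 ?d)\<^sup>2 = 1"
    proof -
      have "(hnorm L2 ?d)\<^sup>2 = (\<Sum>y\<in>X. if y = x then 1 else 0)"
        unfolding L2_hnorm_sq[OF d] by (rule sum.cong) auto
      then show ?thesis using x finite_cosets by simp
    qed
    ultimately show ?thesis using L2.bessel[OF e d] by simp
  qed
  have "real k = (\<Sum>i<k. (hnorm L2 (e i))\<^sup>2)"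
    using L2.orthonormal_sprod[OF e] ec by (simp add: L2.hnorm_sq del: L2_simps)
  also have "\<dots> = (\<Sum>i<k. \<Sum>x\<in>X. (cmod (e i x))\<^sup>2)"
    using ec by (intro sum.cong) (auto simp: L2_hnorm_sq)
  also have "\<dots> = (\<Sum>x\<in>X. \<Sum>i<k. (cmod (e i x))\<^sup>2)" by (rule sum.swap)
  also have "\<dots> \<le> (\<Sum>x\<in>X. 1)" by (intro sum_mono point)
  finally show ?thesis by simp
qed

text \<open>
  The orthogonal complement of the constant functions. Since the group acts transitively on the
  cosets, only constants are invariant.
\<close>

definition L20 :: "('g set \<Rightarrow> complex) set" where
  "L20 = {\<xi> \<in> carrier L2. (\<Sum>x\<in>X. \<xi> x) = 0}"

lemma submodule_L20: "submodule class_ring L20 L2"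
  by (intro submodule.intro module_L2)
    (auto simp: L20_def L2_carrier_iff sum.distrib simp flip: sum_distrib_left)

lemma L20_invariant: "g \<in> carrier G \<Longrightarrow> act L2 g ` L20 \<subseteq> L20"
  by (auto simp: L20_def L2_act L2_carrier_iff sum_act)

lemma L20_no_invariants:
  assumes \<xi>: "\<xi> \<in> L20" and inv: "\<And>g. g \<in> carrier G \<Longrightarrow> act L2 g \<xi> = \<xi>"
  shows "\<xi> = \<zero>\<^bsub>L2\<^esub>"
proof -
  have const: "\<xi> x = \<xi> y" if x: "x \<in> X" and y: "y \<in> X" for x y
  proof -
    obtain g where g: "g \<in> carrier G" "g <# x = y" using translate_transitive[OF x y] by blast
    have "act L2 (inv g) \<xi> x = \<xi> x" using inv g(1) by simp
    then show ?thesis using x g by (simp add: L2_act)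
  qed
  have "\<xi> x = 0" for x
  proof (cases "x \<in> X")
    case True
    have "(\<Sum>y\<in>X. \<xi> y) = (\<Sum>y\<in>X. \<xi> x)" by (rule sum.cong[OF refl const[OF _ True]])
    then have "of_nat (card X) * \<xi> x = 0" using \<xi> by (simp add: L20_def)
    then show ?thesis using card_X_pos by simp
  next
    case False
    then show ?thesis using \<xi> by (simp add: L20_def L2_carrier_iff)
  qed
  then show ?thesis by (simp add: fun_eq_iff)
qed

lemma L20_displacement_gap:
  assumes pair: "tau_pair G F \<epsilon>"
    and \<xi>: "\<xi> \<in> L20"
  shows "\<epsilon>\<^sup>2 * (hnorm L2 \<xi>)\<^sup>2 \<le> displacement L2 F \<xi>"
proof -
  note F = tau_pairD(1-3)[OF pair]
  let ?Z = "L2\<lparr>carrier := L20\<rparr>"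
  interpret Z: unitary_module G ?Z
    by (rule L2.restrict[OF submodule_L20 L20_invariant])
  have sub: "L20 \<subseteq> carrier L2" by (auto simp: L20_def)
  have hn: "hnorm ?Z \<eta> = hnorm L2 \<eta>" for \<eta> by (simp add: hnorm_def)
  have "\<epsilon>\<^sup>2 * (hnorm ?Z \<xi>)\<^sup>2 \<le> displacement ?Z F \<xi>"
  proof (rule displacement_gap_finite_dim[OF pair Z.unitary_module_axioms])
    show "v = \<zero>\<^bsub>?Z\<^esub>" if "v \<in> carrier ?Z" "hnorm ?Z v = 0" for v
      using L2_definite[of v] that sub by (auto simp: hn)
    show "k \<le> card X" if "orthonormal ?Z k e" for k e
    proof (rule L2_orthonormal_bound)
      show "orthonormal L2 k e"
        using that sub unfolding orthonormal_def by (simp del: L2_simps add: subset_iff)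
    qed
    show "v = \<zero>\<^bsub>?Z\<^esub>" if "v \<in> carrier ?Z" "\<And>g. g \<in> carrier G \<Longrightarrow> act ?Z g v = v" for v
      using L20_no_invariants[of v] that by simp
  qed (use \<xi> in simp_all)
  moreover have "displacement ?Z F \<xi> = displacement L2 F \<xi>"
    using Z.displacement_eq[OF F(2), of \<xi>] L2.displacement_eq[OF F(2), of \<xi>] \<xi> sub by (auto simp: hn)
  ultimately show ?thesis by (simp add: hn)
qed

text \<open>Cauchy-Schwarz against the indicator function of the support.\<close>

lemma norm_sum_sq_le_support:
  assumes \<xi>: "\<xi> \<in> carrier L2"
  shows "(cmod (\<Sum>x\<in>X. \<xi> x))\<^sup>2 \<le> real (card {x \<in> X. \<xi> x \<noteq> 0}) * (hnorm L2 \<xi>)\<^sup>2"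
proof -
  let ?s = "\<lambda>x. if x \<in> X \<and> \<xi> x \<noteq> 0 then 1 else (0 :: complex)"
  have s: "?s \<in> carrier L2" by (auto simp: L2_carrier_iff)
  have "sprod L2 \<xi> ?s = (\<Sum>x\<in>X. \<xi> x)"
    by (simp, rule sum.cong) auto
  moreover have "(hnorm L2 ?s)\<^sup>2 = real (card {x \<in> X. \<xi> x \<noteq> 0})"
  proof -
    have "(hnorm L2 ?s)\<^sup>2 = (\<Sum>x\<in>X. if \<xi> x \<noteq> 0 then 1 else 0)"
      unfolding L2_hnorm_sq[OF s] by (rule sum.cong) auto
    also have "\<dots> = real (card {x \<in> X. \<xi> x \<noteq> 0})"
      using finite_cosets by (simp add: sum.If_cases Int_def conj_commute)
    finally show ?thesis .
  qed
  ultimately show ?thesis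
    using power_mono[OF L2.cauchy_schwarz[OF \<xi> s], of 2] by (simp add: power_mult_distrib mult.commute)
qed

text \<open>
  Split \<open>\<xi> = \<kappa> + \<eta>\<close> into its mean \<open>\<kappa>\<close> and a function \<open>\<eta>\<close> of sum zero. The gap applies to \<open>\<eta>\<close>, and the
  constant \<open>\<kappa>\<close> carries at most the fraction \<open>card (supp \<xi>) / card X\<close> of the squared norm of \<open>\<xi>\<close>.
\<close>

lemma displacement_gap_small_support:
  assumes pair: "tau_pair G F \<epsilon>"
    and \<xi>: "\<xi> \<in> carrier L2"
  shows "\<epsilon>\<^sup>2 * (1 - real (card {x \<in> X. \<xi> x \<noteq> 0}) / real (card X)) * (hnorm L2 \<xi>)\<^sup>2 \<le> displacement L2 F \<xi>"
proof -
  note F = tau_pairD(1-3)[OF pair]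
  define S where "S = (\<Sum>x\<in>X. \<xi> x)"
  define c where "c = S / of_nat (card X)"
  define \<kappa> where "\<kappa> = (\<lambda>x. if x \<in> X then c else 0)"
  define \<eta> where "\<eta> = (\<lambda>x. \<xi> x - \<kappa> x)"
  have \<kappa>: "\<kappa> \<in> carrier L2" by (simp add: \<kappa>_def L2_carrier_iff)
  have card: "of_nat (card X) \<noteq> (0 :: complex)" using card_X_pos by simp
  have sum\<kappa>: "(\<Sum>x\<in>X. \<kappa> x) = S" using card by (simp add: \<kappa>_def c_def)
  have \<eta>: "\<eta> \<in> L20"
    using \<xi> sum\<kappa> by (simp add: L20_def \<eta>_def L2_carrier_iff sum_subtractf S_def \<kappa>_def)
  then have \<eta>': "\<eta> \<in> carrier L2" by (simp add: L20_def)
  have dec: "\<kappa> \<oplus>\<^bsub>L2\<^esub> \<eta> = \<xi>" by (simp add: \<eta>_def)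
  have orth: "sprod L2 \<zeta> \<kappa> = 0" "sprod L2 \<kappa> \<zeta> = 0" if "\<zeta> \<in> L20" for \<zeta>
  proof -
    have "(\<Sum>x\<in>X. \<zeta> x * cnj (\<kappa> x)) = (\<Sum>x\<in>X. \<zeta> x) * cnj c"
      unfolding sum_distrib_right by (rule sum.cong) (auto simp: \<kappa>_def)
    then show "sprod L2 \<zeta> \<kappa> = 0" using that by (simp add: L20_def)
    then show "sprod L2 \<kappa> \<zeta> = 0"
      using L2.sprod_cnj[of \<zeta> \<kappa>] \<kappa> that by (simp add: L20_def)
  qed
  have act\<kappa>: "act L2 g \<kappa> = \<kappa>" if "g \<in> carrier G" for g
    using that by (auto simp: \<kappa>_def L2_act fun_eq_iff translate_closed)
  have "act L2 g \<eta> \<in> L20" if "g \<in> F" for g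
    using L20_invariant[of g] \<eta> that F(2) by auto
  then have o: "sprod L2 (act L2 g \<kappa>) \<eta> = 0" "sprod L2 (act L2 g \<eta>) \<kappa> = 0" if "g \<in> F" for g
    using orth \<eta> act\<kappa>[of g] that F(2) by auto
  note split = L2.displacement_orthogonal_sum[OF F(2) \<kappa> \<eta>' orth(2)[OF \<eta>] o, unfolded dec]
  have n\<kappa>: "(hnorm L2 \<kappa>)\<^sup>2 = (cmod S)\<^sup>2 / real (card X)"
  proof -
    have "(hnorm L2 \<kappa>)\<^sup>2 = (\<Sum>x\<in>X. (cmod c)\<^sup>2)"
      unfolding L2_hnorm_sq[OF \<kappa>] by (rule sum.cong) (auto simp: \<kappa>_def)
    then show ?thesis
      using card_X_pos by (simp add: c_def norm_divide power_divide power2_eq_square)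
  qed
  have "(hnorm L2 \<kappa>)\<^sup>2 \<le> real (card {x \<in> X. \<xi> x \<noteq> 0}) / real (card X) * (hnorm L2 \<xi>)\<^sup>2"
    using divide_right_mono[OF norm_sum_sq_le_support[OF \<xi>], of "real (card X)"]
    by (simp add: n\<kappa> S_def)
  then have "(1 - real (card {x \<in> X. \<xi> x \<noteq> 0}) / real (card X)) * (hnorm L2 \<xi>)\<^sup>2 \<le> (hnorm L2 \<eta>)\<^sup>2"
    using split(1) by (simp add: left_diff_distrib)
  then have "\<epsilon>\<^sup>2 * ((1 - real (card {x \<in> X. \<xi> x \<noteq> 0}) / real (card X)) * (hnorm L2 \<xi>)\<^sup>2)
      \<le> \<epsilon>\<^sup>2 * (hnorm L2 \<eta>)\<^sup>2"
    by (rule mult_left_mono) simp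
  also have "\<dots> \<le> displacement L2 F \<eta>"
    by (rule L20_displacement_gap[OF pair \<eta>])
  also have "\<dots> \<le> displacement L2 F \<xi>"
    using split(2) by (simp add: displacement_def sum_nonneg)
  finally show ?thesis by (simp add: mult.assoc)
qed

lemma card_support_act:
  assumes g: "g \<in> carrier G"
  shows "card {x \<in> X. act L2 g \<xi> x \<noteq> 0} \<le> card {x \<in> X. \<xi> x \<noteq> 0}"
proof (rule card_inj_on_le)
  show "inj_on (\<lambda>x. inv g <# x) {x \<in> X. act L2 g \<xi> x \<noteq> 0}"
    using translate_bij[of "inv g"] g by (auto simp: bij_betw_def intro: inj_on_subset)
  show "(\<lambda>x. inv g <# x) ` {x \<in> X. act L2 g \<xi> x \<noteq> 0} \<subseteq> {x \<in> X. \<xi> x \<noteq> 0}"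
    using g by (auto simp: L2_act translate_closed)
qed (use finite_cosets in simp)

end

section \<open>The representations on vectors of small support\<close>

lemma submodule_image:
  assumes S: "submodule class_ring S M" and K: "module class_ring K"
    and closed: "\<And>v. v \<in> carrier M \<Longrightarrow> q v \<in> carrier K"
    and zero: "\<zero>\<^bsub>K\<^esub> = q \<zero>\<^bsub>M\<^esub>"
    and add: "\<And>v w. v \<in> carrier M \<Longrightarrow> w \<in> carrier M \<Longrightarrow> q v \<oplus>\<^bsub>K\<^esub> q w = q (v \<oplus>\<^bsub>M\<^esub> w)"
    and smult: "\<And>c v. v \<in> carrier M \<Longrightarrow> c \<odot>\<^bsub>K\<^esub> q v = q (c \<odot>\<^bsub>M\<^esub> v)"
  shows "submodule class_ring (q ` S) K"
proof (intro submodule.intro K)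
  have sub: "v \<in> carrier M" if "v \<in> S" for v using submodule.subset[OF S] that by auto
  show "q ` S \<subseteq> carrier K" using sub closed by auto
  show "\<zero>\<^bsub>K\<^esub> \<in> q ` S" unfolding zero using submodule.zero_closed[OF S] by (rule imageI)
  show "v \<oplus>\<^bsub>K\<^esub> w \<in> q ` S" if "v \<in> q ` S" "w \<in> q ` S" for v w
    using that sub by (auto simp: add intro!: imageI submodule.m_closed[OF S])
  show "c \<odot>\<^bsub>K\<^esub> v \<in> q ` S" if "v \<in> q ` S" for c v
    using that sub submodule.smult_closed[OF S] by (auto simp: smult intro!: imageI)
qed

locale quotient_sequence =
  fixes G :: "('g, 'm) monoid_scheme" and N :: "nat \<Rightarrow> 'g set" and U :: "nat filter"
  assumes quotient: "\<And>n. finite_quotient (N n) G"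
    and ultrafilter: "nonprincipal_ultrafilter U"
begin

abbreviation L2 :: "nat \<Rightarrow> ('g, 'g set \<Rightarrow> complex) gspace" where
  "L2 n \<equiv> quasi_regular G (N n)"

abbreviation support :: "nat \<Rightarrow> ('g set \<Rightarrow> complex) \<Rightarrow> 'g set set" where
  "support n \<xi> \<equiv> {x \<in> carrier (G Mod N n). \<xi> x \<noteq> 0}"

abbreviation HT :: "('g, nat \<Rightarrow> 'g set \<Rightarrow> complex) gspace" where
  "HT \<equiv> H_tilde G N U"

lemma unitary_module_component: "unitary_module G (L2 n)"
  by (rule finite_quotient.unitary_module_L2[OF quotient])

lemma unitary_module_H_tilde: "unitary_module G HT"
  unfolding H_tilde_def by (rule unitary_module_bounded_seqs[OF unitary_module_component ultrafilter])

interpretation HT: unitary_module G HT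
  by (rule unitary_module_H_tilde)

lemma HT_sprod_tendsto:
  "\<lbrakk>\<xi> \<in> carrier HT; \<eta> \<in> carrier HT\<rbrakk>
    \<Longrightarrow> ((\<lambda>n. sprod (L2 n) (\<xi> n) (\<eta> n)) \<longlongrightarrow> sprod HT \<xi> \<eta>) U"
  unfolding H_tilde_def by (rule bounded_seqs_sprod_tendsto[OF unitary_module_component ultrafilter])

lemma HT_component: "\<xi> \<in> carrier HT \<Longrightarrow> \<xi> n \<in> carrier (L2 n)"
  unfolding H_tilde_def by (rule bounded_seqs_component)

lemma HT_simps:
  "\<zero>\<^bsub>HT\<^esub> = (\<lambda>n x. 0)"
  "\<xi> \<oplus>\<^bsub>HT\<^esub> \<eta> = (\<lambda>n x. \<xi> n x + \<eta> n x)"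
  "c \<odot>\<^bsub>HT\<^esub> \<xi> = (\<lambda>n x. c * \<xi> n x)"
  "act HT g \<xi> = (\<lambda>n. act (L2 n) g (\<xi> n))"
  by (simp_all add: H_tilde_def bounded_seqs_def quasi_regular_def)

lemma finite_support: "finite (support n \<xi>)"
  using finite_quotient.finite_cosets[OF quotient] by simp

lemma H_tilde_gamma_iff:
  "\<xi> \<in> H_tilde_gamma G N U \<gamma> \<longleftrightarrow>
    \<xi> \<in> carrier HT \<and> (\<exists>k\<ge>1. \<forall>n. card (support n (\<xi> n)) \<le> k * \<gamma> n)"
  by (auto simp: H_tilde_gamma_def)

lemma submodule_H_tilde_gamma: "submodule class_ring (H_tilde_gamma G N U \<gamma>) HT"
proof (intro submodule.intro HT.module_axioms)
  show "H_tilde_gamma G N U \<gamma> \<subseteq> carrier HT" by (auto simp: H_tilde_gamma_iff)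
  have "card (support n (\<zero>\<^bsub>HT\<^esub> n)) \<le> 1 * \<gamma> n" for n by (simp add: HT_simps)
  then show "\<zero>\<^bsub>HT\<^esub> \<in> H_tilde_gamma G N U \<gamma>"
    unfolding H_tilde_gamma_iff using HT.M.zero_closed by blast
  fix \<xi> assume "\<xi> \<in> H_tilde_gamma G N U \<gamma>"
  then obtain k where \<xi>: "\<xi> \<in> carrier HT" and k: "k \<ge> 1" "\<And>n. card (support n (\<xi> n)) \<le> k * \<gamma> n"
    unfolding H_tilde_gamma_iff by blast
  show "\<xi> \<oplus>\<^bsub>HT\<^esub> \<eta> \<in> H_tilde_gamma G N U \<gamma>" if mem: "\<eta> \<in> H_tilde_gamma G N U \<gamma>" for \<eta>
  proof -
    obtain l where \<eta>: "\<eta> \<in> carrier HT" and l [rule_format]: "l \<ge> 1" "\<forall>n. card (support n (\<eta> n)) \<le> l * \<gamma> n"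
      using mem unfolding H_tilde_gamma_iff by blast
    have "card (support n ((\<xi> \<oplus>\<^bsub>HT\<^esub> \<eta>) n)) \<le> (k + l) * \<gamma> n" for n
    proof -
      have "support n ((\<xi> \<oplus>\<^bsub>HT\<^esub> \<eta>) n) \<subseteq> support n (\<xi> n) \<union> support n (\<eta> n)"
        by (auto simp: HT_simps)
      then have "card (support n ((\<xi> \<oplus>\<^bsub>HT\<^esub> \<eta>) n)) \<le> card (support n (\<xi> n) \<union> support n (\<eta> n))"
        by (intro card_mono finite_UnI finite_support)
      also have "\<dots> \<le> k * \<gamma> n + l * \<gamma> n"
        using card_Un_le[of "support n (\<xi> n)" "support n (\<eta> n)"] k(2)[of n] l(2)[of n] by linarith
      finally show ?thesis by (simp add: distrib_right)
    qed
    moreover have "k + l \<ge> 1" using k(1) by simp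
    ultimately show ?thesis
      unfolding H_tilde_gamma_iff using HT.M.a_closed[OF \<xi> \<eta>] by blast
  qed
  show "c \<odot>\<^bsub>HT\<^esub> \<xi> \<in> H_tilde_gamma G N U \<gamma>" for c
  proof -
    have "card (support n ((c \<odot>\<^bsub>HT\<^esub> \<xi>) n)) \<le> k * \<gamma> n" for n
    proof -
      have "card (support n ((c \<odot>\<^bsub>HT\<^esub> \<xi>) n)) \<le> card (support n (\<xi> n))"
        by (intro card_mono finite_support) (auto simp: HT_simps)
      then show ?thesis using k(2)[of n] by linarith
    qed
    then show ?thesis unfolding H_tilde_gamma_iff using HT.scale_closed[OF \<xi>] k(1) by blast
  qed
qed

lemma H_tilde_gamma_invariant:
  assumes g: "g \<in> carrier G"
  shows "act HT g ` H_tilde_gamma G N U \<gamma> \<subseteq> H_tilde_gamma G N U \<gamma>"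
proof (clarify)
  fix \<xi> assume "\<xi> \<in> H_tilde_gamma G N U \<gamma>"
  then obtain k where \<xi>: "\<xi> \<in> carrier HT" and k: "k \<ge> 1" "\<And>n. card (support n (\<xi> n)) \<le> k * \<gamma> n"
    unfolding H_tilde_gamma_iff by blast
  have "card (support n (act HT g \<xi> n)) \<le> k * \<gamma> n" for n
    using order_trans[OF finite_quotient.card_support_act[OF quotient g] k(2)] by (simp add: HT_simps)
  then show "act HT g \<xi> \<in> H_tilde_gamma G N U \<gamma>"
    unfolding H_tilde_gamma_iff using HT.act_closed[OF g \<xi>] k(1) by blast
qed

text \<open>
  The supports occupy a fraction of at most \<open>k \<gamma>\<^sub>n / \<nu>\<^sub>n\<close> of the quotients. It tends to \<open>0\<close> along \<open>U\<close>, so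
  in the limit the loss in the gap disappears. The constant \<open>\<epsilon>\<close> does not depend on \<open>n\<close>, since the tau
  pair serves all the finite quotients at once.
\<close>

lemma displacement_gap_H_tilde_gamma:
  assumes growth: "growth_less U \<gamma> (index_seq G N)"
    and pair: "tau_pair G F \<epsilon>"
    and \<xi>: "\<xi> \<in> H_tilde_gamma G N U \<gamma>"
  shows "\<epsilon>\<^sup>2 * (hnorm HT \<xi>)\<^sup>2 \<le> displacement HT F \<xi>"
proof -
  note F = tau_pairD(1-3)[OF pair]
  interpret L2: unitary_module G "L2 n" for n by (rule unitary_module_component)
  obtain k where c: "\<xi> \<in> carrier HT" and k: "\<And>n. card (support n (\<xi> n)) \<le> k * \<gamma> n"
    using \<xi> unfolding H_tilde_gamma_iff by blast
  have cn: "\<xi> n \<in> carrier (L2 n)" for n by (rule HT_component[OF c])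
  let ?\<theta> = "\<lambda>n. real k * (real (\<gamma> n) / real (index_seq G N n))"
  have norm: "((\<lambda>n. (hnorm (L2 n) (\<xi> n))\<^sup>2) \<longlongrightarrow> (hnorm HT \<xi>)\<^sup>2) U"
    using tendsto_Re[OF HT_sprod_tendsto[OF c c]] by (simp add: L2.hnorm_sq[OF cn] HT.hnorm_sq[OF c])
  have coeff: "((\<lambda>n. Re (sprod (L2 n) (act (L2 n) g (\<xi> n)) (\<xi> n))) \<longlongrightarrow> Re (sprod HT (act HT g \<xi>) \<xi>)) U"
    if "g \<in> F" for g
    using tendsto_Re[OF HT_sprod_tendsto[OF HT.act_closed[of g \<xi>] c]] that F(2) c
    by (auto simp: HT_simps)
  have lim: "((\<lambda>n. displacement (L2 n) F (\<xi> n)) \<longlongrightarrow> displacement HT F \<xi>) U"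
    unfolding HT.displacement_eq[OF F(2) c] L2.displacement_eq[OF F(2) cn]
    by (intro tendsto_sum tendsto_diff tendsto_mult_left norm coeff)
  have \<theta>: "(?\<theta> \<longlongrightarrow> real k * 0) U"
    using growth unfolding growth_less_def by (rule tendsto_mult_left)
  have "((\<lambda>n. \<epsilon>\<^sup>2 * (1 - ?\<theta> n) * (hnorm (L2 n) (\<xi> n))\<^sup>2) \<longlongrightarrow> \<epsilon>\<^sup>2 * (1 - real k * 0) * (hnorm HT \<xi>)\<^sup>2) U"
    by (rule tendsto_mult[OF tendsto_mult[OF tendsto_const tendsto_diff[OF tendsto_const \<theta>]] norm])
  moreover have "\<epsilon>\<^sup>2 * (1 - ?\<theta> n) * (hnorm (L2 n) (\<xi> n))\<^sup>2 \<le> displacement (L2 n) F (\<xi> n)" for n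
  proof -
    have "real (card (support n (\<xi> n))) \<le> real k * real (\<gamma> n)"
      using k[of n] by (simp flip: of_nat_mult)
    then have "real (card (support n (\<xi> n))) / real (index_seq G N n) \<le> ?\<theta> n"
      using divide_right_mono[of _ _ "real (index_seq G N n)"] by fastforce
    then have "\<epsilon>\<^sup>2 * (1 - ?\<theta> n) * (hnorm (L2 n) (\<xi> n))\<^sup>2
        \<le> \<epsilon>\<^sup>2 * (1 - real (card (support n (\<xi> n))) / real (index_seq G N n)) * (hnorm (L2 n) (\<xi> n))\<^sup>2"
      by (intro mult_right_mono mult_left_mono) auto
    also have "\<dots> \<le> displacement (L2 n) F (\<xi> n)"
      unfolding index_seq_def
      by (rule finite_quotient.displacement_gap_small_support[OF quotient pair cn])
    finally show ?thesis .
  qed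
  moreover have "U \<noteq> bot" using ultrafilter by (simp add: nonprincipal_ultrafilter_def)
  ultimately have "\<epsilon>\<^sup>2 * (1 - real k * 0) * (hnorm HT \<xi>)\<^sup>2 \<le> displacement HT F \<xi>"
    using lim by (intro tendsto_le[of U]) (auto intro: always_eventually)
  then show ?thesis by simp
qed

abbreviation HH :: "('g, (nat \<Rightarrow> (nat \<Rightarrow> 'g set \<Rightarrow> complex) set) set) gspace" where
  "HH \<equiv> H_hat G N U"

definition to_hat :: "(nat \<Rightarrow> 'g set \<Rightarrow> complex) \<Rightarrow> (nat \<Rightarrow> (nat \<Rightarrow> 'g set \<Rightarrow> complex) set) set" where
  "to_hat \<xi> = to_completion (hquot HT) (qmap HT \<xi>)"

interpretation HQ: unitary_module G "hquot HT"
  by (rule HT.unitary_module_hquot)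

interpretation HH: unitary_module G HH
  unfolding H_hat_def by (rule HQ.unitary_module_completion)

lemma qmap_closed: "\<xi> \<in> carrier HT \<Longrightarrow> qmap HT \<xi> \<in> carrier (hquot HT)"
  by (simp add: HT.carrier_hquot)

lemma to_hat_closed: "\<xi> \<in> carrier HT \<Longrightarrow> to_hat \<xi> \<in> carrier HH"
  unfolding to_hat_def H_hat_def by (rule HQ.to_completion_closed[OF qmap_closed])

lemma to_hat_zero: "\<zero>\<^bsub>HH\<^esub> = to_hat \<zero>\<^bsub>HT\<^esub>"
  by (simp add: to_hat_def H_hat_def HQ.zero_completion HT.zero_hquot)

lemma to_hat_add:
  "\<xi> \<in> carrier HT \<Longrightarrow> \<eta> \<in> carrier HT \<Longrightarrow> to_hat \<xi> \<oplus>\<^bsub>HH\<^esub> to_hat \<eta> = to_hat (\<xi> \<oplus>\<^bsub>HT\<^esub> \<eta>)"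
  by (simp add: to_hat_def H_hat_def HQ.add_completion HT.add_hquot qmap_closed)

lemma to_hat_smult: "\<xi> \<in> carrier HT \<Longrightarrow> c \<odot>\<^bsub>HH\<^esub> to_hat \<xi> = to_hat (c \<odot>\<^bsub>HT\<^esub> \<xi>)"
  by (simp add: to_hat_def H_hat_def HQ.smult_completion HT.smult_hquot qmap_closed)

lemma to_hat_sprod:
  "\<xi> \<in> carrier HT \<Longrightarrow> \<eta> \<in> carrier HT \<Longrightarrow> sprod HH (to_hat \<xi>) (to_hat \<eta>) = sprod HT \<xi> \<eta>"
  by (simp add: to_hat_def H_hat_def HQ.sprod_completion HT.sprod_hquot qmap_closed)

lemma to_hat_act:
  "g \<in> carrier G \<Longrightarrow> \<xi> \<in> carrier HT \<Longrightarrow> act HH g (to_hat \<xi>) = to_hat (act HT g \<xi>)"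
  by (simp add: to_hat_def H_hat_def HQ.act_completion HT.act_hquot qmap_closed)

lemma to_hat_hnorm: "\<xi> \<in> carrier HT \<Longrightarrow> hnorm HH (to_hat \<xi>) = hnorm HT \<xi>"
  by (simp add: hnorm_def to_hat_sprod)

lemma to_hat_displacement:
  assumes "F \<subseteq> carrier G" "\<xi> \<in> carrier HT"
  shows "displacement HH F (to_hat \<xi>) = displacement HT F \<xi>"
  unfolding HT.displacement_eq[OF assms] HH.displacement_eq[OF assms(1) to_hat_closed[OF assms(2)]]
  using assms by (intro sum.cong) (auto simp: to_hat_hnorm to_hat_act to_hat_sprod subset_iff)

lemma H_gamma_eq: "H_gamma G N U \<gamma> = hclosure HH (to_hat ` H_tilde_gamma G N U \<gamma>)"
  by (simp add: H_gamma_def to_hat_def image_image)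

lemma H_tilde_gamma_carrier: "\<xi> \<in> H_tilde_gamma G N U \<gamma> \<Longrightarrow> \<xi> \<in> carrier HT"
  by (simp add: H_tilde_gamma_iff)

lemma submodule_H_gamma: "submodule class_ring (H_gamma G N U \<gamma>) HH"
  unfolding H_gamma_eq
  by (intro HH.submodule_hclosure submodule_image[OF submodule_H_tilde_gamma HH.module_axioms]
      to_hat_closed to_hat_zero to_hat_add to_hat_smult)

lemma H_gamma_invariant:
  assumes g: "g \<in> carrier G"
  shows "act HH g ` H_gamma G N U \<gamma> \<subseteq> H_gamma G N U \<gamma>"
  unfolding H_gamma_eq
proof (rule HH.hclosure_invariant[OF _ g])
  show "to_hat ` H_tilde_gamma G N U \<gamma> \<subseteq> carrier HH"
    using to_hat_closed H_tilde_gamma_carrier by blast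
  show "act HH g ` to_hat ` H_tilde_gamma G N U \<gamma> \<subseteq> to_hat ` H_tilde_gamma G N U \<gamma>"
  proof (clarify)
    fix \<xi> assume \<xi>: "\<xi> \<in> H_tilde_gamma G N U \<gamma>"
    then show "act HH g (to_hat \<xi>) \<in> to_hat ` H_tilde_gamma G N U \<gamma>"
      unfolding to_hat_act[OF g H_tilde_gamma_carrier[OF \<xi>]] using H_tilde_gamma_invariant[OF g] by blast
  qed
qed

lemma unitary_module_pi_rep: "unitary_module G (pi_rep G N U \<gamma>)"
  unfolding pi_rep_def by (rule HH.restrict[OF submodule_H_gamma H_gamma_invariant])

text \<open>
  The canonical map into the completion preserves the form and the action, so the gap holds on a
  dense subspace of \<open>H\<^sub>\<gamma>\<close>, and hence on all of it.
\<close>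

lemma displacement_gap_pi_rep:
  assumes growth: "growth_less U \<gamma> (index_seq G N)"
    and pair: "tau_pair G F \<epsilon>"
    and v: "v \<in> carrier (pi_rep G N U \<gamma>)"
  shows "\<epsilon>\<^sup>2 * (hnorm (pi_rep G N U \<gamma>) v)\<^sup>2 \<le> displacement (pi_rep G N U \<gamma>) F v"
proof -
  note F = tau_pairD(1-3)[OF pair]
  interpret P: unitary_module G "pi_rep G N U \<gamma>" by (rule unitary_module_pi_rep)
  have v': "v \<in> hclosure HH (to_hat ` H_tilde_gamma G N U \<gamma>)"
    using v by (simp add: pi_rep_def H_gamma_eq)
  have "\<epsilon>\<^sup>2 * (hnorm HH v)\<^sup>2 \<le> displacement HH F v"
  proof (rule HH.displacement_hclosure[OF _ F(2) _ v'])
    show "to_hat ` H_tilde_gamma G N U \<gamma> \<subseteq> carrier HH"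
      using to_hat_closed H_tilde_gamma_carrier by blast
    fix s assume "s \<in> to_hat ` H_tilde_gamma G N U \<gamma>"
    then obtain \<xi> where \<xi>: "\<xi> \<in> H_tilde_gamma G N U \<gamma>" "s = to_hat \<xi>" by blast
    show "\<epsilon>\<^sup>2 * (hnorm HH s)\<^sup>2 \<le> displacement HH F s"
      using displacement_gap_H_tilde_gamma[OF growth pair \<xi>(1)] H_tilde_gamma_carrier[OF \<xi>(1)]
      by (simp add: \<xi>(2) to_hat_hnorm to_hat_displacement F(2))
  qed
  moreover have "hnorm (pi_rep G N U \<gamma>) v = hnorm HH v" by (simp add: hnorm_def pi_rep_def)
  moreover have "displacement (pi_rep G N U \<gamma>) F v = displacement HH F v"
    unfolding P.displacement_eq[OF F(2) v] HH.displacement_eq[OF F(2) HH.hclosure_carrier[OF v']]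
    by (simp add: hnorm_def pi_rep_def)
  ultimately show ?thesis by simp
qed

end

lemma unitary_module_trivial_rep: "group G \<Longrightarrow> unitary_module G trivial_rep"
  unfolding trivial_rep_def
  by (rule unitary_module_cn_rep) (auto simp: unitary_rep_def module_hom_def)

lemma opnorm_trivial_rep_indicator:
  assumes "group G" "finite F" "F \<subseteq> carrier G"
  shows "real (card F) \<le> opnorm trivial_rep (indicator F)"
proof -
  interpret T: unitary_module G trivial_rep by (rule unitary_module_trivial_rep[OF assms(1)])
  show ?thesis
    by (rule T.opnorm_indicator_fixed_vector[OF assms(2,3), of "unit_vec 1 0"])
      (auto simp: trivial_rep_def hnorm_def)
qed

theorem theorem6p1:
  fixes G :: "('g, 'm) monoid_scheme"
    and N :: "nat \<Rightarrow> 'g set"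
    and U :: "nat filter"
    and \<gamma> :: "nat \<Rightarrow> nat"
  assumes "group G"
    and "\<And>n. N n \<lhd> G"
    and "\<And>n. finite (carrier (G Mod N n))"
    and "N 0 \<subset> carrier G"
    and "\<And>n. N (Suc n) \<subset> N n"
    and "(\<Inter>n. N n) = {\<one>\<^bsub>G\<^esub>}"
    and "nonprincipal_ultrafilter U"
    and "finitely_generated G"
    and "property_tau G"
    and "\<gamma> \<in> growth_functions (index_seq G N)"
    and "growth_less U \<gamma> (index_seq G N)"
  shows "\<not> weakly_contained G trivial_rep (pi_rep G N U \<gamma>)"
proof -
  interpret quotient_sequence G N U
    using assms by (intro quotient_sequence.intro finite_quotient.intro finite_quotient_axioms.intro)
  interpret P: unitary_module G "pi_rep G N U \<gamma>" by (rule unitary_module_pi_rep)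
  obtain F \<epsilon> where pair: "tau_pair G F \<epsilon>"
    using property_tau_imp_tau_pair[OF assms(1,9)] by blast
  note F = tau_pairD(1-3)[OF pair]
  (* The norm estimate compares the translates g v with v itself, so \<one> has to be a summand. *)
  let ?F = "insert \<one>\<^bsub>G\<^esub> F"
  have F': "finite ?F" "?F \<subseteq> carrier G" "\<one>\<^bsub>G\<^esub> \<in> ?F" using F P.grp.one_closed by auto
  have "opnorm (pi_rep G N U \<gamma>) (indicator ?F) < real (card ?F)"
  proof (rule P.opnorm_indicator_less[OF F'])
    show "0 < \<epsilon>\<^sup>2" using F(3) by simp
    fix v assume v: "v \<in> carrier (pi_rep G N U \<gamma>)"
    have "\<epsilon>\<^sup>2 * (hnorm (pi_rep G N U \<gamma>) v)\<^sup>2 \<le> displacement (pi_rep G N U \<gamma>) F v"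
      by (rule displacement_gap_pi_rep[OF assms(11) pair v])
    also have "\<dots> \<le> displacement (pi_rep G N U \<gamma>) ?F v"
      unfolding displacement_def using F by (intro sum_mono2) auto
    finally show "\<epsilon>\<^sup>2 * (hnorm (pi_rep G N U \<gamma>) v)\<^sup>2 \<le> displacement (pi_rep G N U \<gamma>) ?F v" .
  qed
  also have "\<dots> \<le> opnorm trivial_rep (indicator ?F)"
    by (rule opnorm_trivial_rep_indicator[OF assms(1) F'(1,2)])
  finally have "\<not> opnorm trivial_rep (indicator ?F) \<le> opnorm (pi_rep G N U \<gamma>) (indicator ?F)" by simp
  moreover have "indicator ?F \<in> group_algebra G"
    using F' by (auto simp: group_algebra_def indicator_def elim: finite_subset[rotated])
  ultimately show ?thesis unfolding weakly_contained_def by blast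
qed

end
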